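(* Let $X$ be the $\mathbb{G}$-embedding given by a pair $(\Sigma,e)$, where $\Sigma$ is a fan and $e$ is a Demazure root of $\Sigma$; let $\mathbb{T}$ be the acting torus of the toric variety $X$. Then any $\mathbb{G}$-orbit on $X$ is either a union $\mathcal{O}_1\cup\mathcal{O}_2$ of two $\mathbb{T}$-orbits on $X$ or a unique $\mathbb{T}$-orbit; the first possibility occurs if and only if the pair $(\mathcal{O}_1,\mathcal{O}_2)$ is $H_e$-connected. In particular, the number of $\mathbb{G}$-orbits on $X$ is finite.
   Context: $\mathbb{K}$ is an algebraically closed field of characteristic zero, $\mathbb{G}_a=(\mathbb{K},+)$. Toric notation: $M$ is the character lattice of the torus $\mathbb{T}$, $N$ the dual lattice of one-parameter subgroups, $\langle\cdot,\cdot\rangle$ the pairing. A toric variety $X$ with acting torus $\mathbb{T}$ (a normal variety with an effective action of $\mathbb{T}$ having an open orbit) corresponds to a fan $\Sigma$ in $N_{\mathbb{Q}}=N\otimes_{\mathbb{Z}}\mathbb{Q}$, and $U_\sigma=\mathrm{Spec}\,\mathbb{K}[\sigma^\vee\cap M]$ is the affine chart of $\sigma\in\Sigma$. $\Sigma(1)$ is the set of rays of $\Sigma$ and $n_\rho$ is the primitive lattice vector on a ray $\rho$. A Demazure root of $\Sigma$ is a vector $e\in M$ for which there is a ray $\rho\in\Sigma(1)$ (the distinguished ray of $e$, denoted $\rho_e$; put $n_e=n_{\rho_e}$) such that: (1) $\langle n_\rho,e\rangle=-1$ and $\langle n_{\rho'},e\rangle\geq 0$ for all $\rho'\in\Sigma(1)$,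 $\rho'\neq\rho$; (2) if $\sigma\in\Sigma$ and $\langle v,e\rangle=0$ for all $v\in\sigma$, then the cone generated by $\sigma$ and $\rho$ is in $\Sigma$ as well. A Demazure root $e$ defines a one-parameter subgroup $H_e\cong\mathbb{G}_a$ of $\mathrm{Aut}(X)$ normalized by $\mathbb{T}$: for each $\sigma\in\Sigma$ containing $\rho_e$ the chart $U_\sigma$ is invariant and $s\in\mathbb{G}_a$ acts on $\mathbb{K}[U_\sigma]$ by $\exp(s\partial_e)$ with $\partial_e(\chi^m)=\langle n_e,m\rangle\chi^{m+e}$, while the points outside the union of these charts are fixed. The torus $\mathbb{T}$ acts on $H_e$ by conjugation with the character $e$. The $\mathbb{G}$-embedding given by $(\Sigma,e)$ is the toric variety $X$ of $\Sigma$ with the action of $\mathbb{G}=T\times\mathbb{G}_a$, where $T=\mathrm{Ker}(e)\subseteq\mathbb{T}$ acts through $\mathbb{T}$ and $\mathbb{G}_a$ acts as $H_e$. A pair of (distinct) $\mathbb{T}$-orbits $(\mathcal{O}_1,\mathcal{O}_2)$ on $X$ is called $H_e$-connected if $H_ex\subseteq\mathcal{O}_1\cup\mathcal{O}_2$ for some $x\in X\setminus X^{H_e}$; the pair is ordered so that $\mathcal{O}_2\subseteq\overline{\mathcal{O}_1}$, in which case $\dim\mathcal{O}_1=\dim\mathcal{O}_2+1$. *)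

theory Defs
  imports
    "HOL-Analysis.Analysis"
    "HOL-Algebra.Group_Action"
    "HOL-Library.Poly_Mapping"
    "HOL-Computational_Algebra.Polynomial"
begin

text \<open>
  The lattices \<open>N\<close> and \<open>M\<close> are two copies of \<open>int ^ 'n\<close>, dual to each other under the standard
  pairing; \<open>N\<^sub>\<rat>\<close> and \<open>M\<^sub>\<rat>\<close> are two copies of \<open>rat ^ 'n\<close>.
\<close>

definition rat_vec :: "int ^ 'n \<Rightarrow> rat ^ 'n" where
  "rat_vec m = (\<chi> i. of_int (m $ i))"

definition pairing :: "'a::comm_ring_1 ^ 'n \<Rightarrow> 'a ^ 'n \<Rightarrow> 'a" where
  "pairing v u = (\<Sum>i\<in>UNIV. v $ i * u $ i)"

definition cone_gen :: "(rat ^ 'n) set \<Rightarrow> (rat ^ 'n) set" where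
  "cone_gen S = {\<Sum>u\<in>V. c u *s u | V c. finite V \<and> V \<subseteq> S \<and> (\<forall>u\<in>V. c u \<ge> 0)}"

definition polyhedral_cone :: "(rat ^ 'n) set \<Rightarrow> bool" where
  "polyhedral_cone \<sigma> \<longleftrightarrow> (\<exists>V. finite V \<and> \<sigma> = cone_gen V)"

definition strongly_convex :: "(rat ^ 'n) set \<Rightarrow> bool" where
  "strongly_convex \<sigma> \<longleftrightarrow> \<sigma> \<inter> uminus ` \<sigma> = {0}"

definition dual_cone :: "(rat ^ 'n) set \<Rightarrow> (rat ^ 'n) set" where
  "dual_cone \<sigma> = {u. \<forall>v\<in>\<sigma>. pairing v u \<ge> 0}"

definition cone_face :: "(rat ^ 'n) set \<Rightarrow> (rat ^ 'n) set \<Rightarrow> bool" where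
  "cone_face \<tau> \<sigma> \<longleftrightarrow> (\<exists>u\<in>dual_cone \<sigma>. \<tau> = {v\<in>\<sigma>. pairing v u = 0})"

definition fan :: "(rat ^ 'n) set set \<Rightarrow> bool" where
  "fan \<Sigma> \<longleftrightarrow>
     finite \<Sigma> \<and> \<Sigma> \<noteq> {} \<and>
     (\<forall>\<sigma>\<in>\<Sigma>. polyhedral_cone \<sigma> \<and> strongly_convex \<sigma>) \<and>
     (\<forall>\<sigma>\<in>\<Sigma>. \<forall>\<tau>. cone_face \<tau> \<sigma> \<longrightarrow> \<tau> \<in> \<Sigma>) \<and>
     (\<forall>\<sigma>\<in>\<Sigma>. \<forall>\<tau>\<in>\<Sigma>. cone_face (\<sigma> \<inter> \<tau>) \<sigma> \<and> cone_face (\<sigma> \<inter> \<tau>) \<tau>)"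

definition rays :: "(rat ^ 'n) set set \<Rightarrow> (rat ^ 'n) set set" where
  "rays \<Sigma> = {\<rho>\<in>\<Sigma>. vec.dim \<rho> = 1}"

definition primitive :: "int ^ 'n \<Rightarrow> bool" where
  "primitive v \<longleftrightarrow> (\<forall>k w. v = k *s w \<longrightarrow> k = 1 \<or> k = -1)"

definition ray_vec :: "(rat ^ 'n) set \<Rightarrow> int ^ 'n" where
  "ray_vec \<rho> = (THE v. primitive v \<and> rat_vec v \<in> \<rho>)"

definition demazure_root_at ::
    "(rat ^ 'n) set set \<Rightarrow> (rat ^ 'n) set \<Rightarrow> int ^ 'n \<Rightarrow> bool" where
  "demazure_root_at \<Sigma> \<rho> e \<longleftrightarrow>
     \<rho> \<in> rays \<Sigma> \<and>
     pairing (ray_vec \<rho>) e = -1 \<and>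
     (\<forall>\<rho>'\<in>rays \<Sigma>. \<rho>' \<noteq> \<rho> \<longrightarrow> pairing (ray_vec \<rho>') e \<ge> 0) \<and>
     (\<forall>\<sigma>\<in>\<Sigma>. (\<forall>v\<in>\<sigma>. pairing v (rat_vec e) = 0) \<longrightarrow> cone_gen (\<sigma> \<union> \<rho>) \<in> \<Sigma>)"

definition demazure_root :: "(rat ^ 'n) set set \<Rightarrow> int ^ 'n \<Rightarrow> bool" where
  "demazure_root \<Sigma> e \<longleftrightarrow> (\<exists>\<rho>. demazure_root_at \<Sigma> \<rho> e)"

definition distinguished_ray :: "(rat ^ 'n) set set \<Rightarrow> int ^ 'n \<Rightarrow> (rat ^ 'n) set" where
  "distinguished_ray \<Sigma> e = (THE \<rho>. demazure_root_at \<Sigma> \<rho> e)"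

text \<open>
  The group algebra \<open>\<bbbK>[M]\<close> is the type \<open>(int ^ 'n) \<Rightarrow>\<^sub>0 'k\<close> with the convolution product; the
  character \<open>\<chi>\<^sup>m\<close> is \<open>Poly_Mapping.single m 1\<close> and a constant \<open>c\<close> is
  \<open>Poly_Mapping.single 0 c\<close>.
\<close>

definition chart_ring :: "(rat ^ 'n) set \<Rightarrow> ((int ^ 'n) \<Rightarrow>\<^sub>0 'k::field) set" where
  "chart_ring \<sigma> = {f. \<forall>m\<in>Poly_Mapping.keys f. rat_vec m \<in> dual_cone \<sigma>}"

text \<open>
  As the ground field is algebraically closed, the closed points of an affine variety are the
  algebra homomorphisms from its coordinate ring to the ground field.
\<close>

definition chart :: "(rat ^ 'n) set \<Rightarrow> (((int ^ 'n) \<Rightarrow>\<^sub>0 'k::field) \<Rightarrow> 'k) set" where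
  "chart \<sigma> = {x \<in> extensional (chart_ring \<sigma>).
     (\<forall>c. x (Poly_Mapping.single 0 c) = c) \<and>
     (\<forall>f\<in>chart_ring \<sigma>. \<forall>g\<in>chart_ring \<sigma>. x (f + g) = x f + x g \<and> x (f * g) = x f * x g)}"

type_synonym ('k, 'n) chart_point = "(rat ^ 'n) set \<times> (((int ^ 'n) \<Rightarrow>\<^sub>0 'k) \<Rightarrow> 'k)"

type_synonym ('k, 'n) toric_point = "('k, 'n) chart_point set"

text \<open>
  The charts of \<open>\<sigma>\<close> and \<open>\<tau>\<close> are glued along the chart of \<open>\<sigma> \<inter> \<tau>\<close>, which is an open subset
  of both of them by restriction of homomorphisms.
\<close>

definition glue ::
    "(rat ^ 'n) set set \<Rightarrow> (('k::field, 'n) chart_point \<times> ('k, 'n) chart_point) set" where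
  "glue \<Sigma> = {((\<sigma>, x), (\<tau>, y)). \<sigma> \<in> \<Sigma> \<and> \<tau> \<in> \<Sigma> \<and>
     (\<exists>z\<in>chart (\<sigma> \<inter> \<tau>). x = restrict z (chart_ring \<sigma>) \<and> y = restrict z (chart_ring \<tau>))}"

definition toric_variety :: "(rat ^ 'n) set set \<Rightarrow> ('k::field, 'n) toric_point set" where
  "toric_variety \<Sigma> = (SIGMA \<sigma>:\<Sigma>. chart \<sigma>) // glue \<Sigma>"

definition chart_open ::
    "(rat ^ 'n) set \<Rightarrow> (((int ^ 'n) \<Rightarrow>\<^sub>0 'k::field) \<Rightarrow> 'k) set \<Rightarrow> bool" where
  "chart_open \<sigma> S \<longleftrightarrow> (\<exists>I\<subseteq>chart_ring \<sigma>. S = {x\<in>chart \<sigma>. \<exists>f\<in>I. x f \<noteq> 0})"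

definition zariski_open :: "(rat ^ 'n) set set \<Rightarrow> ('k::field, 'n) toric_point set \<Rightarrow> bool" where
  "zariski_open \<Sigma> U \<longleftrightarrow> U \<subseteq> toric_variety \<Sigma> \<and>
     (\<forall>\<sigma>\<in>\<Sigma>. chart_open \<sigma> {x\<in>chart \<sigma>. glue \<Sigma> `` {(\<sigma>, x)} \<in> U})"

definition zariski :: "(rat ^ 'n) set set \<Rightarrow> ('k::field, 'n) toric_point topology" where
  "zariski \<Sigma> = topology (zariski_open \<Sigma>)"

lemma chart_ring_mult:
  assumes "f \<in> chart_ring \<sigma>" "g \<in> chart_ring \<sigma>"
  shows "f * g \<in> chart_ring \<sigma>"
  unfolding chart_ring_def dual_cone_def
proof (intro CollectI ballI)
  fix m v assume m: "m \<in> Poly_Mapping.keys (f * g)" and v: "v \<in> \<sigma>"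
  then obtain a b where ab: "a \<in> Poly_Mapping.keys f" "b \<in> Poly_Mapping.keys g" "m = a + b"
    using keys_mult[of f g] by blast
  have "pairing v (rat_vec a) \<ge> 0" "pairing v (rat_vec b) \<ge> 0"
    using ab assms v unfolding chart_ring_def dual_cone_def by blast+
  moreover have "pairing v (rat_vec m) = pairing v (rat_vec a) + pairing v (rat_vec b)"
    by (simp add: ab(3) pairing_def rat_vec_def distrib_left sum.distrib)
  ultimately show "pairing v (rat_vec m) \<ge> 0"
    by simp
qed

lemma chart_open_Int:
  assumes "chart_open \<sigma> S" "chart_open \<sigma> T"
  shows "chart_open \<sigma> (S \<inter> T)"
proof -
  obtain I J where I: "I \<subseteq> chart_ring \<sigma>" "S = {x\<in>chart \<sigma>. \<exists>f\<in>I. x f \<noteq> 0}"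
    and J: "J \<subseteq> chart_ring \<sigma>" "T = {x\<in>chart \<sigma>. \<exists>f\<in>J. x f \<noteq> 0}"
    using assms unfolding chart_open_def by (elim exE conjE)
  let ?K = "(\<lambda>(f, g). f * g) ` (I \<times> J)"
  have "?K \<subseteq> chart_ring \<sigma>"
    using I(1) J(1) by (auto intro!: chart_ring_mult)
  moreover have "S \<inter> T = {x\<in>chart \<sigma>. \<exists>h\<in>?K. x h \<noteq> 0}"
  proof -
    have "(\<exists>h\<in>?K. x h \<noteq> 0) \<longleftrightarrow> (\<exists>f\<in>I. x f \<noteq> 0) \<and> (\<exists>g\<in>J. x g \<noteq> 0)" if x: "x \<in> chart \<sigma>" for x
    proof -
      have "x (f * g) = x f * x g" if "f \<in> I" "g \<in> J" for f g
        using x subsetD[OF I(1) that(1)] subsetD[OF J(1) that(2)] by (simp add: chart_def)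
      then show ?thesis
        by (simp add: bex_simps split_beta cong: bex_cong)
    qed
    then show ?thesis
      unfolding I(2) J(2) by blast
  qed
  ultimately show ?thesis
    unfolding chart_open_def by (intro exI[of _ ?K] conjI)
qed

lemma chart_open_Union:
  assumes "\<And>S. S \<in> \<S> \<Longrightarrow> chart_open \<sigma> S"
  shows "chart_open \<sigma> (\<Union>\<S>)"
proof -
  have "\<forall>S\<in>\<S>. \<exists>I. I \<subseteq> chart_ring \<sigma> \<and> S = {x\<in>chart \<sigma>. \<exists>f\<in>I. x f \<noteq> 0}"
    using assms unfolding chart_open_def by (intro ballI)
  from bchoice[OF this] obtain I where
    I: "\<forall>S\<in>\<S>. I S \<subseteq> chart_ring \<sigma> \<and> S = {x\<in>chart \<sigma>. \<exists>f\<in>I S. x f \<noteq> 0}"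
    by (elim exE)
  have "(\<Union>S\<in>\<S>. I S) \<subseteq> chart_ring \<sigma>"
    using I by (intro UN_least) blast
  moreover have "\<Union>\<S> = (\<Union>S\<in>\<S>. {x\<in>chart \<sigma>. \<exists>f\<in>I S. x f \<noteq> 0})"
    using I by (intro arg_cong[where f = Union]) (simp cong: image_cong)
  then have "\<Union>\<S> = {x\<in>chart \<sigma>. \<exists>f\<in>(\<Union>S\<in>\<S>. I S). x f \<noteq> 0}"
    by (simp only:) blast
  ultimately show ?thesis
    unfolding chart_open_def by (intro exI[of _ "\<Union>S\<in>\<S>. I S"] conjI)
qed

lemma Collect_Union_eq: "{x\<in>A. g x \<in> \<Union>\<U>} = \<Union>((\<lambda>U. {x\<in>A. g x \<in> U}) ` \<U>)"
  by auto

lemma istopology_zariski_open: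
  fixes \<Sigma> :: "(rat ^ 'n) set set"
  shows "istopology (zariski_open \<Sigma> :: ('k::field, 'n) toric_point set \<Rightarrow> bool)"
  unfolding istopology_def
proof (intro conjI allI impI)
  fix U V :: "('k, 'n) toric_point set"
  assume U: "zariski_open \<Sigma> U" and V: "zariski_open \<Sigma> V"
  have "{x\<in>chart \<sigma>. glue \<Sigma> `` {(\<sigma>, x)} \<in> U \<inter> V} =
      {x\<in>chart \<sigma>. glue \<Sigma> `` {(\<sigma>, x)} \<in> U} \<inter> {x\<in>chart \<sigma>. glue \<Sigma> `` {(\<sigma>, x)} \<in> V}" for \<sigma>
    by (rule Set.set_eqI) (simp only: mem_Collect_eq Int_iff, iprover)
  with U V show "zariski_open \<Sigma> (U \<inter> V)"
    unfolding zariski_open_def by (simp add: chart_open_Int le_infI1 del: Int_iff)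
next
  fix \<U> :: "('k, 'n) toric_point set set"
  assume \<U>: "\<forall>U\<in>\<U>. zariski_open \<Sigma> U"
  have "chart_open \<sigma> {x\<in>chart \<sigma>. glue \<Sigma> `` {(\<sigma>, x)} \<in> \<Union>\<U>}" if "\<sigma> \<in> \<Sigma>" for \<sigma>
  proof -
    have "{x\<in>chart \<sigma>. glue \<Sigma> `` {(\<sigma>, x)} \<in> \<Union>\<U>} =
        \<Union>((\<lambda>U. {x\<in>chart \<sigma>. glue \<Sigma> `` {(\<sigma>, x)} \<in> U}) ` \<U>)"
      using Collect_Union_eq .
    also have "chart_open \<sigma> \<dots>"
      using \<U> that unfolding zariski_open_def by (intro chart_open_Union) (elim imageE, simp only:)
    finally show ?thesis .
  qed
  moreover have "\<Union>\<U> \<subseteq> toric_variety \<Sigma>"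
    using \<U> unfolding zariski_open_def by (intro Union_least) simp
  ultimately show "zariski_open \<Sigma> (\<Union>\<U>)"
    unfolding zariski_open_def by (intro conjI ballI)
qed

definition torus :: "(int ^ 'n \<Rightarrow> 'k::field) monoid" where
  "torus = \<lparr>carrier = {t. t 0 = 1 \<and> (\<forall>m m'. t (m + m') = t m * t m')},
            mult = (\<lambda>t t' m. t m * t' m), one = (\<lambda>_. 1)\<rparr>"

definition torus_comorphism ::
    "(int ^ 'n \<Rightarrow> 'k::field) \<Rightarrow> ((int ^ 'n) \<Rightarrow>\<^sub>0 'k) \<Rightarrow> ((int ^ 'n) \<Rightarrow>\<^sub>0 'k)" where
  "torus_comorphism t f =
     (\<Sum>m\<in>Poly_Mapping.keys f. Poly_Mapping.single m (t m * Poly_Mapping.lookup f m))"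

text \<open>
  The torus preserves every chart, so that it acts on a point of the glued variety by acting on
  all representatives of the point simultaneously.
\<close>

definition torus_action ::
    "(rat ^ 'n) set set \<Rightarrow> (int ^ 'n \<Rightarrow> 'k::field) \<Rightarrow>
     ('k, 'n) toric_point \<Rightarrow> ('k, 'n) toric_point" where
  "torus_action \<Sigma> t = (\<lambda>P\<in>toric_variety \<Sigma>.
     (\<lambda>(\<sigma>, x). (\<sigma>, \<lambda>f\<in>chart_ring \<sigma>. x (torus_comorphism t f))) ` P)"

definition torus_orbits :: "(rat ^ 'n) set set \<Rightarrow> ('k::field, 'n) toric_point set set" where
  "torus_orbits \<Sigma> = orbits torus (toric_variety \<Sigma>) (torus_action \<Sigma>)"

definition root_derivation ::
    "(rat ^ 'n) set set \<Rightarrow> int ^ 'n \<Rightarrow> ((int ^ 'n) \<Rightarrow>\<^sub>0 'k::field) \<Rightarrow> ((int ^ 'n) \<Rightarrow>\<^sub>0 'k)" where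
  "root_derivation \<Sigma> e f =
     (\<Sum>m\<in>Poly_Mapping.keys f. Poly_Mapping.single (m + e)
        (of_int (pairing (ray_vec (distinguished_ray \<Sigma> e)) m) * Poly_Mapping.lookup f m))"

text \<open>
  \<open>Sum_any\<close> adds up the finitely many nonzero terms. It is a junk value when there are infinitely
  many, which does not happen on the charts of the cones containing the distinguished ray, where
  the derivation is locally nilpotent.
\<close>

definition root_exp ::
    "(rat ^ 'n) set set \<Rightarrow> int ^ 'n \<Rightarrow> 'k::field_char_0 \<Rightarrow>
     ((int ^ 'n) \<Rightarrow>\<^sub>0 'k) \<Rightarrow> ((int ^ 'n) \<Rightarrow>\<^sub>0 'k)" where
  "root_exp \<Sigma> e s f =
     Sum_any (\<lambda>k. Poly_Mapping.single 0 (s ^ k / fact k) * (root_derivation \<Sigma> e ^^ k) f)"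

text \<open>
  A point in the chart of a cone containing the distinguished ray is moved within that chart; the
  union below is over equal classes. All other points are fixed.
\<close>

definition root_action ::
    "(rat ^ 'n) set set \<Rightarrow> int ^ 'n \<Rightarrow> 'k::field_char_0 \<Rightarrow>
     ('k, 'n) toric_point \<Rightarrow> ('k, 'n) toric_point" where
  "root_action \<Sigma> e s = (\<lambda>P\<in>toric_variety \<Sigma>.
     if \<exists>(\<sigma>, x)\<in>P. distinguished_ray \<Sigma> e \<subseteq> \<sigma>
     then \<Union>(\<sigma>, x)\<in>{(\<sigma>, x)\<in>P. distinguished_ray \<Sigma> e \<subseteq> \<sigma>}.
            glue \<Sigma> `` {(\<sigma>, \<lambda>f\<in>chart_ring \<sigma>. x (root_exp \<Sigma> e s f))}
     else P)"

definition additive_group :: "'k::field monoid" where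
  "additive_group = \<lparr>carrier = UNIV, mult = (+), one = 0\<rparr>"

definition root_fixed_points ::
    "(rat ^ 'n) set set \<Rightarrow> int ^ 'n \<Rightarrow> ('k::field_char_0, 'n) toric_point set" where
  "root_fixed_points \<Sigma> e = {P\<in>toric_variety \<Sigma>. \<forall>s. root_action \<Sigma> e s P = P}"

definition root_connected ::
    "(rat ^ 'n) set set \<Rightarrow> int ^ 'n \<Rightarrow>
     ('k::field_char_0, 'n) toric_point set \<Rightarrow> ('k, 'n) toric_point set \<Rightarrow> bool" where
  "root_connected \<Sigma> e O1 O2 \<longleftrightarrow>
     O1 \<in> torus_orbits \<Sigma> \<and> O2 \<in> torus_orbits \<Sigma> \<and> O1 \<noteq> O2 \<and>
     O2 \<subseteq> Abstract_Topology.closure_of (zariski \<Sigma>) O1 \<and>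
     (\<exists>P \<in> toric_variety \<Sigma> - root_fixed_points \<Sigma> e.
        orbit additive_group (root_action \<Sigma> e) P \<subseteq> O1 \<union> O2)"

definition root_kernel :: "int ^ 'n \<Rightarrow> (int ^ 'n \<Rightarrow> 'k::field) monoid" where
  "root_kernel e = torus\<lparr>carrier := {t \<in> carrier torus. t e = 1}\<rparr>"

definition embedding_group :: "int ^ 'n \<Rightarrow> ((int ^ 'n \<Rightarrow> 'k::field) \<times> 'k) monoid" where
  "embedding_group e = root_kernel e \<times>\<times> additive_group"

definition embedding_action ::
    "(rat ^ 'n) set set \<Rightarrow> int ^ 'n \<Rightarrow> (int ^ 'n \<Rightarrow> 'k::field_char_0) \<times> 'k \<Rightarrow>
     ('k, 'n) toric_point \<Rightarrow> ('k, 'n) toric_point" where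
  "embedding_action \<Sigma> e = (\<lambda>(t, s). \<lambda>P\<in>toric_variety \<Sigma>.
     torus_action \<Sigma> t (root_action \<Sigma> e s P))"

definition embedding_orbits ::
    "(rat ^ 'n) set set \<Rightarrow> int ^ 'n \<Rightarrow> ('k::field_char_0, 'n) toric_point set set" where
  "embedding_orbits \<Sigma> e =
     orbits (embedding_group e) (toric_variety \<Sigma>) (embedding_action \<Sigma> e)"

end

theory Submission
  imports Defs
begin

text \<open>
  The torus orbits correspond to the cones of the fan: the orbit of \<open>\<sigma>\<close> consists of the points
  \<open>toric_pt \<Sigma> \<sigma> t\<close>, at which a monomial takes the value of the torus element \<open>t\<close> if it
  annihilates \<open>\<sigma>\<close> and vanishes otherwise (\<open>chart_point_from_face\<close>, \<open>toric_variety_eq\<close>,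
  \<open>torus_orbits_eq\<close>). Two such points are equal only if their cones are equal and their torus
  elements agree on the annihilator of the cone. This makes all actions computable.

  Let \<open>\<rho>\<close> be the distinguished ray of the root \<open>e\<close> and \<open>n\<close> its primitive vector. On the charts
  that contain \<open>\<rho>\<close> the element \<open>s\<close> of the root subgroup acts by \<open>\<chi>\<^sup>m \<mapsto> \<chi>\<^sup>m (1 + s \<chi>\<^sup>e)\<^sup>j\<close>, where
  \<open>j\<close> is the pairing of \<open>n\<close> and \<open>m\<close>. That these charts are preserved rests on the fact that
  strongly convex cones are generated by their rays (\<open>generators_spanning_faces\<close>, from Farkas'
  lemma), because the conditions on \<open>e\<close> concern rays only. Evaluating the formula at the points
  of the orbit of a cone gives three cases.

  If \<open>e\<close> vanishes on \<open>\<sigma>\<close>, the cone \<open>\<sigma>'\<close> generated by \<open>\<sigma>\<close> and \<open>\<rho>\<close> is in the fan. The point given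
  by \<open>t\<close> is moved by the value at \<open>1 + s t(e)\<close> of the one-parameter subgroup \<open>n\<close>, and falls into
  the orbit of \<open>\<sigma>'\<close> when this number is zero (\<open>root_action_orthogonal\<close>). Conversely, every
  \<open>s \<noteq> 0\<close> takes the orbit of \<open>\<sigma>'\<close> into that of \<open>\<sigma>\<close> (\<open>root_action_join_ray\<close>). All other cones
  contain a vector on which \<open>e\<close> is positive, and the points of their orbits are fixed
  (\<open>root_action_unpaired\<close>).

  Adding the action of the kernel of \<open>e\<close> in the torus fuses each pair of orbits of \<open>\<sigma>\<close> and \<open>\<sigma>'\<close>
  into one, and the kernel alone is transitive on the orbit of every other cone
  (\<open>embedding_orbits_eq\<close>). The connected pairs are exactly the pairs of orbits of \<open>\<sigma>\<close> and \<open>\<sigma>'\<close>: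
  the orbit of \<open>\<sigma>'\<close> is in the closure of that of \<open>\<sigma>\<close> because \<open>n\<close> contracts the one to the other
  (\<open>join_ray_orbit_in_closure\<close>), and an orbit of the root subgroup that is not a point meets
  both orbits of a pair (\<open>root_orbit_meets_both\<close>).
\<close>

section \<open>The pairing of dual lattices\<close>

lemma pairing_commute: "pairing u v = pairing v u"
  by (simp add: pairing_def mult.commute)

lemma pairing_add_left: "pairing (u + v) w = pairing u w + pairing v w"
  by (simp add: pairing_def distrib_right sum.distrib)

lemma pairing_add_right: "pairing w (u + v) = pairing w u + pairing w v"
  by (simp add: pairing_def distrib_left sum.distrib)

lemma pairing_scale_left: "pairing (c *s u) w = c * pairing u w"
  by (simp add: pairing_def sum_distrib_left mult.assoc)

lemma pairing_scale_right: "pairing w (c *s u) = c * pairing w u"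
  by (simp add: pairing_commute[of w] pairing_scale_left)

lemma pairing_zero_left [simp]: "pairing 0 w = 0"
  by (simp add: pairing_def)

lemma pairing_zero_right [simp]: "pairing w 0 = 0"
  by (simp add: pairing_def)

lemma pairing_minus_left: "pairing (- u) w = - pairing u w"
  by (simp add: pairing_def sum_negf)

lemma pairing_minus_right: "pairing w (- u) = - pairing w u"
  by (simp add: pairing_def sum_negf)

lemma pairing_diff_left: "pairing (u - v) w = pairing u w - pairing v w"
  by (simp add: pairing_def left_diff_distrib sum_subtractf)

lemma pairing_diff_right: "pairing w (u - v) = pairing w u - pairing w v"
  by (simp add: pairing_def right_diff_distrib sum_subtractf)

lemma pairing_sum_left: "pairing (\<Sum>i\<in>I. f i) w = (\<Sum>i\<in>I. pairing (f i) w)"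
  by (induction I rule: infinite_finite_induct) (simp_all add: pairing_add_left)

lemma pairing_sum_right: "pairing w (\<Sum>i\<in>I. f i) = (\<Sum>i\<in>I. pairing w (f i))"
  by (simp add: pairing_commute[of w] pairing_sum_left)

lemmas pairing_simps = pairing_add_left pairing_add_right pairing_scale_left pairing_scale_right
  pairing_minus_left pairing_minus_right pairing_diff_left pairing_diff_right

lemma rat_vec_add: "rat_vec (a + b) = rat_vec a + rat_vec b"
  by (simp add: rat_vec_def vec_eq_iff)

lemma rat_vec_diff: "rat_vec (a - b) = rat_vec a - rat_vec b"
  by (simp add: rat_vec_def vec_eq_iff)

lemma rat_vec_zero [simp]: "rat_vec 0 = 0"
  by (simp add: rat_vec_def vec_eq_iff)

lemma rat_vec_scale: "rat_vec (k *s a) = of_int k *s rat_vec a"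
  by (simp add: rat_vec_def vec_eq_iff)

lemma rat_vec_eq_iff: "rat_vec a = rat_vec b \<longleftrightarrow> a = b"
  by (simp add: rat_vec_def vec_eq_iff)

lemma pairing_rat_vec: "pairing (rat_vec a) (rat_vec b) = of_int (pairing a b)"
  by (simp add: pairing_def rat_vec_def)

text \<open>
  Clearing denominators makes rational functionals and rational points of cones integral, so
  that they give monomials and one-parameter subgroups.
\<close>
lemma rat_vec_multiple_exists:
  fixes u :: "rat ^ 'n::finite"
  obtains d :: int and m where "d > 0" "rat_vec m = of_int d *s u"
proof -
  define d where "d = (\<Prod>i\<in>UNIV. snd (quotient_of (u $ i)))"
  have pos: "snd (quotient_of (u $ i)) > 0" for i
    by (simp add: quotient_of_denom_pos')
  then have "d > 0"
    unfolding d_def by (intro prod_pos) auto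
  moreover have "\<exists>k. of_int d * u $ i = of_int k" for i
  proof -
    define q where "q = quotient_of (u $ i)"
    have u: "u $ i = of_int (fst q) / of_int (snd q)"
      unfolding q_def by (simp add: quotient_of_div)
    have "snd q dvd d"
      unfolding d_def q_def by (rule dvd_prodI) auto
    then obtain r where "d = snd q * r" ..
    then have "of_int d * u $ i = of_int (r * fst q)"
      using pos[of i, folded q_def] by (subst u) simp
    then show ?thesis ..
  qed
  then obtain k where "\<And>i. of_int d * u $ i = of_int (k i)"
    by metis
  then have "rat_vec (\<chi> i. k i) = of_int d *s u"
    by (simp add: rat_vec_def vec_eq_iff)
  ultimately show ?thesis
    using that by blast
qed

section \<open>Polyhedral cones and their faces\<close>

text \<open>
  A generated cone is the least closed cone that contains the generators, so that inclusions of
  cones can be checked on generators without handling coefficients.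
\<close>
definition closed_cone :: "(rat ^ 'n) set \<Rightarrow> bool" where
  "closed_cone C \<longleftrightarrow> 0 \<in> C \<and> (\<forall>x\<in>C. \<forall>y\<in>C. x + y \<in> C) \<and> (\<forall>x\<in>C. \<forall>a\<ge>0. a *s x \<in> C)"

lemma closed_cone_sum:
  assumes "closed_cone C" "\<And>i. i \<in> I \<Longrightarrow> f i \<in> C"
  shows "(\<Sum>i\<in>I. f i) \<in> C"
  using assms(2)
  by (induction I rule: infinite_finite_induct)
    (use assms(1) in \<open>simp_all add: closed_cone_def\<close>)

lemma cone_gen_least:
  assumes "closed_cone C" "S \<subseteq> C"
  shows "cone_gen S \<subseteq> C"
proof
  fix x assume "x \<in> cone_gen S"
  then obtain V c where V: "x = (\<Sum>u\<in>V. c u *s u)" "V \<subseteq> S" "\<forall>u\<in>V. c u \<ge> 0"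
    unfolding cone_gen_def by blast
  have "c u *s u \<in> C" if "u \<in> V" for u
    using that V(2,3) assms unfolding closed_cone_def by (simp add: subset_iff)
  then show "x \<in> C"
    unfolding V(1) by (rule closed_cone_sum[OF assms(1)])
qed

lemma cone_gen_extend_coefficients:
  assumes "V \<subseteq> W" "finite W" "\<forall>u\<in>V. c u \<ge> (0::rat)"
  obtains d where "(\<Sum>u\<in>V. c u *s u) = (\<Sum>u\<in>W. d u *s u)" "\<forall>u. d u \<ge> 0"
proof
  let ?d = "\<lambda>u. if u \<in> V then c u else 0"
  show "(\<Sum>u\<in>V. c u *s u) = (\<Sum>u\<in>W. ?d u *s u)"
    using assms by (intro sum.mono_neutral_cong_left) auto
  show "\<forall>u. ?d u \<ge> 0"
    using assms by simp
qed

lemma cone_gen_superset: "S \<subseteq> cone_gen S"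
proof
  fix x assume "x \<in> S"
  then show "x \<in> cone_gen S"
    unfolding cone_gen_def by (intro CollectI exI[of _ "{x}"] exI[of _ "\<lambda>_. 1"]) simp
qed

lemma closed_cone_cone_gen: "closed_cone (cone_gen S)"
  unfolding closed_cone_def
proof (intro conjI ballI allI impI)
  show "0 \<in> cone_gen S"
    unfolding cone_gen_def by (intro CollectI exI[of _ "{}"]) auto
next
  fix x y assume "x \<in> cone_gen S" "y \<in> cone_gen S"
  then obtain V c W d where
    V: "finite V" "V \<subseteq> S" "\<forall>u\<in>V. c u \<ge> 0" "x = (\<Sum>u\<in>V. c u *s u)" and
    W: "finite W" "W \<subseteq> S" "\<forall>u\<in>W. d u \<ge> 0" "y = (\<Sum>u\<in>W. d u *s u)"
    unfolding cone_gen_def by blast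
  obtain c' where c': "x = (\<Sum>u\<in>V\<union>W. c' u *s u)" "\<forall>u. c' u \<ge> 0"
    using cone_gen_extend_coefficients[of V "V \<union> W" c] V W by auto
  obtain d' where d': "y = (\<Sum>u\<in>V\<union>W. d' u *s u)" "\<forall>u. d' u \<ge> 0"
    using cone_gen_extend_coefficients[of W "V \<union> W" d] V W by auto
  have "x + y = (\<Sum>u\<in>V\<union>W. (c' u + d' u) *s u)"
    by (simp add: c' d' sum.distrib vec.scale_left_distrib)
  then show "x + y \<in> cone_gen S"
    unfolding cone_gen_def using V W c' d'
    by (intro CollectI exI[of _ "V \<union> W"] exI[of _ "\<lambda>u. c' u + d' u"]) auto
next
  fix x a assume "x \<in> cone_gen S" "a \<ge> (0::rat)"
  then obtain V c where
    V: "finite V" "V \<subseteq> S" "\<forall>u\<in>V. c u \<ge> 0" "x = (\<Sum>u\<in>V. c u *s u)"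
    unfolding cone_gen_def by blast
  have "a *s x = (\<Sum>u\<in>V. (a * c u) *s u)"
    by (simp add: V vec.scale_sum_right)
  then show "a *s x \<in> cone_gen S"
    unfolding cone_gen_def using V \<open>a \<ge> 0\<close>
    by (intro CollectI exI[of _ V] exI[of _ "\<lambda>u. a * c u"]) auto
qed

lemma cone_gen_zero: "0 \<in> cone_gen S"
  and cone_gen_add: "x \<in> cone_gen S \<Longrightarrow> y \<in> cone_gen S \<Longrightarrow> x + y \<in> cone_gen S"
  and cone_gen_scale: "x \<in> cone_gen S \<Longrightarrow> a \<ge> 0 \<Longrightarrow> a *s x \<in> cone_gen S"
  using closed_cone_cone_gen[of S] unfolding closed_cone_def by auto

lemma cone_gen_subset: "S \<subseteq> cone_gen T \<Longrightarrow> cone_gen S \<subseteq> cone_gen T"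
  by (rule cone_gen_least[OF closed_cone_cone_gen])

lemma cone_gen_mono: "S \<subseteq> T \<Longrightarrow> cone_gen S \<subseteq> cone_gen T"
  using cone_gen_subset cone_gen_superset by blast

lemma cone_gen_coefficients:
  assumes "finite V" "x \<in> cone_gen V"
  obtains c where "x = (\<Sum>u\<in>V. c u *s u)" "\<forall>u. c u \<ge> 0"
proof -
  obtain W d where W: "finite W" "W \<subseteq> V" "\<forall>u\<in>W. d u \<ge> 0" "x = (\<Sum>u\<in>W. d u *s u)"
    using assms(2) unfolding cone_gen_def by blast
  show thesis
    using cone_gen_extend_coefficients[OF W(2) assms(1) W(3)] W(4) that by metis
qed

lemma cone_gen_insert:
  assumes "x \<in> cone_gen (insert v S)"
  obtains y a where "y \<in> cone_gen S" "a \<ge> 0" "x = y + a *s v"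
proof -
  let ?C = "{y + a *s v | y a. y \<in> cone_gen S \<and> a \<ge> 0}"
  have "closed_cone ?C"
    unfolding closed_cone_def
  proof (intro conjI ballI allI impI)
    show "0 \<in> ?C"
      using cone_gen_zero[of S] by (auto intro!: exI[of _ 0])
  next
    fix x y assume "x \<in> ?C" "y \<in> ?C"
    then obtain x' a y' b where *: "x = x' + a *s v" "y = y' + b *s v"
      "x' \<in> cone_gen S" "y' \<in> cone_gen S" "a \<ge> 0" "b \<ge> 0" by blast
    then have "x + y = (x' + y') + (a + b) *s v"
      by (simp add: vec.scale_left_distrib)
    with * show "x + y \<in> ?C"
      using cone_gen_add[of x' S y'] by (intro CollectI exI[of _ "x' + y'"] exI[of _ "a + b"]) auto
  next
    fix x b assume "x \<in> ?C" "b \<ge> (0::rat)"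
    then obtain x' a where *: "x = x' + a *s v" "x' \<in> cone_gen S" "a \<ge> 0" by blast
    then have "b *s x = b *s x' + (b * a) *s v"
      by (simp add: vec.scale_right_distrib)
    with * show "b *s x \<in> ?C"
      using cone_gen_scale[of x' S b] \<open>b \<ge> 0\<close>
      by (intro CollectI exI[of _ "b *s x'"] exI[of _ "b * a"]) auto
  qed
  moreover have "insert v S \<subseteq> ?C"
  proof
    fix x assume "x \<in> insert v S"
    then consider "x = v" | "x \<in> S" by blast
    then show "x \<in> ?C"
    proof cases
      case 1
      then show ?thesis
        using cone_gen_zero[of S] by (intro CollectI exI[of _ 0] exI[of _ 1]) auto
    next
      case 2
      then show ?thesis
        using cone_gen_superset[of S] by (intro CollectI exI[of _ x] exI[of _ 0]) auto
    qed
  qed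
  ultimately show ?thesis
    using cone_gen_least[of ?C "insert v S"] assms that by blast
qed

lemma closed_cone_halfspace: "closed_cone {v. pairing v u \<ge> 0}"
  unfolding closed_cone_def by (simp add: pairing_simps)

lemma dual_cone_cone_gen: "u \<in> dual_cone (cone_gen S) \<longleftrightarrow> (\<forall>v\<in>S. pairing v u \<ge> 0)"
proof
  show "u \<in> dual_cone (cone_gen S) \<Longrightarrow> \<forall>v\<in>S. pairing v u \<ge> 0"
    using cone_gen_superset[of S] unfolding dual_cone_def by auto
next
  assume "\<forall>v\<in>S. pairing v u \<ge> 0"
  then have "S \<subseteq> {v. pairing v u \<ge> 0}"
    by auto
  from cone_gen_least[OF closed_cone_halfspace this] show "u \<in> dual_cone (cone_gen S)"
    unfolding dual_cone_def by auto
qed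

lemma closed_cone_orthogonal: "closed_cone {v. pairing v u = 0}"
  unfolding closed_cone_def by (simp add: pairing_simps)

lemma orthogonal_cone_gen: "(\<forall>v\<in>cone_gen S. pairing v u = 0) \<longleftrightarrow> (\<forall>v\<in>S. pairing v u = 0)"
proof
  show "\<forall>v\<in>cone_gen S. pairing v u = 0 \<Longrightarrow> \<forall>v\<in>S. pairing v u = 0"
    using cone_gen_superset[of S] by auto
next
  assume "\<forall>v\<in>S. pairing v u = 0"
  then have "S \<subseteq> {v. pairing v u = 0}"
    by auto
  from cone_gen_least[OF closed_cone_orthogonal this] show "\<forall>v\<in>cone_gen S. pairing v u = 0"
    by auto
qed

text \<open>
  A nonnegative functional vanishes on a nonnegative combination only if it vanishes on every
  generator that occurs with a positive coefficient.
\<close>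
lemma cone_gen_face:
  assumes "finite V" "\<forall>v\<in>V. pairing v u \<ge> 0"
  shows "{x\<in>cone_gen V. pairing x u = 0} = cone_gen {v\<in>V. pairing v u = 0}"
proof (intro equalityI subsetI)
  fix x assume x: "x \<in> {x\<in>cone_gen V. pairing x u = 0}"
  then obtain c where c: "x = (\<Sum>v\<in>V. c v *s v)" "\<forall>v. c v \<ge> 0"
    using cone_gen_coefficients[OF assms(1)] by blast
  have "(\<Sum>v\<in>V. c v * pairing v u) = 0"
    using x by (simp add: c pairing_sum_left pairing_scale_left)
  then have z: "\<forall>v\<in>V. c v * pairing v u = 0"
    using assms c(2) by (subst (asm) sum_nonneg_eq_0_iff) auto
  have "x = (\<Sum>v\<in>{v\<in>V. pairing v u = 0}. c v *s v)"
    unfolding c using assms(1) z by (intro sum.mono_neutral_right) auto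
  then show "x \<in> cone_gen {v\<in>V. pairing v u = 0}"
    unfolding cone_gen_def using assms(1) c(2)
    by (intro CollectI exI[of _ "{v\<in>V. pairing v u = 0}"] exI[of _ c]) auto
next
  fix x assume x: "x \<in> cone_gen {v\<in>V. pairing v u = 0}"
  then show "x \<in> {x\<in>cone_gen V. pairing x u = 0}"
    using cone_gen_mono[of "{v\<in>V. pairing v u = 0}" V]
      orthogonal_cone_gen[of "{v\<in>V. pairing v u = 0}" u] by auto
qed

section \<open>Strongly convex cones are generated by their rays\<close>

text \<open>
  Farkas' lemma by induction on the number of generators (Bartl's argument). If dropping the
  generator \<open>a j\<close> destroys the hypothesis, some \<open>x\<close> is nonnegative on the other generators and
  negative on \<open>b\<close>, hence negative on \<open>a j\<close>. Projecting along \<open>a j\<close> onto the hyperplane on which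
  \<open>x\<close> vanishes gives a situation with one generator less; the signs of the values of \<open>x\<close> make
  the coefficient of \<open>a j\<close> nonnegative when the projection is undone. The induction changes the
  generators, and two of them may become equal, which is why they are an indexed family and not
  a set.
\<close>
lemma farkas_family:
  fixes a :: "'i \<Rightarrow> rat ^ 'n::finite"
  assumes "finite I" "\<And>u. \<forall>i\<in>I. pairing (a i) u \<ge> 0 \<Longrightarrow> pairing b u \<ge> 0"
  shows "\<exists>c. (\<forall>i\<in>I. c i \<ge> 0) \<and> b = (\<Sum>i\<in>I. c i *s a i)"
  using assms
proof (induction I arbitrary: a b rule: finite_induct)
  case empty
  have "- (\<Sum>i\<in>UNIV. b $ i * b $ i) \<ge> 0"
    using empty[of "- b"] by (simp add: pairing_def sum_negf)
  moreover have "(\<Sum>i\<in>UNIV. b $ i * b $ i) \<ge> 0"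
    by (intro sum_nonneg) simp
  ultimately have "(\<Sum>i\<in>UNIV. b $ i * b $ i) = 0"
    by linarith
  then have "b = 0"
    by (simp add: sum_nonneg_eq_0_iff vec_eq_iff)
  then show ?case by simp
next
  case (insert j I)
  show ?case
  proof (cases "\<forall>u. (\<forall>i\<in>I. pairing (a i) u \<ge> 0) \<longrightarrow> pairing b u \<ge> 0")
    case True
    then obtain c where c: "\<forall>i\<in>I. c i \<ge> 0" "b = (\<Sum>i\<in>I. c i *s a i)"
      using insert.IH[of a b] by blast
    have "(\<Sum>i\<in>I. (c(j := 0)) i *s a i) = (\<Sum>i\<in>I. c i *s a i)"
      using insert.hyps by (intro sum.cong) auto
    with c insert.hyps show ?thesis
      by (intro exI[of _ "c(j := 0)"]) auto
  next
    case False
    then obtain x where x: "\<forall>i\<in>I. pairing (a i) x \<ge> 0" "pairing b x < 0"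
      by force
    define r where "r = pairing (a j) x"
    have r: "r < 0"
      using x insert.prems[of x] unfolding r_def by force
    \<comment> \<open>The projections of the generators and of the target along \<open>a j\<close>.\<close>
    define a' where "a' i = a i - (pairing (a i) x / r) *s a j" for i
    define b' where "b' = b - (pairing b x / r) *s a j"
    have "\<exists>c. (\<forall>i\<in>I. c i \<ge> 0) \<and> b' = (\<Sum>i\<in>I. c i *s a' i)"
    proof (rule insert.IH)
      fix u assume u: "\<forall>i\<in>I. pairing (a' i) u \<ge> 0"
      \<comment> \<open>The dual projection: testing \<open>u\<close> on the projected vectors is the same as testing \<open>y\<close>,
        which vanishes on \<open>a j\<close>, on the original ones.\<close>
      define y where "y = u - (pairing (a j) u / r) *s x"
      have "pairing (a i) y \<ge> 0" if "i \<in> I" for i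
        using u that by (auto simp: y_def a'_def pairing_simps mult.commute)
      moreover have "pairing (a j) y = 0"
        using r by (simp add: y_def pairing_simps flip: r_def)
      ultimately have "pairing b y \<ge> 0"
        by (intro insert.prems) auto
      then show "pairing b' u \<ge> 0"
        by (simp add: y_def b'_def pairing_simps mult.commute)
    qed
    then obtain c where c: "\<forall>i\<in>I. c i \<ge> 0" "b' = (\<Sum>i\<in>I. c i *s a' i)"
      by blast
    define d where "d = pairing b x / r - (\<Sum>i\<in>I. c i * (pairing (a i) x / r))"
    have "c i * (pairing (a i) x / r) \<le> 0" if "i \<in> I" for i
      using c(1) x(1) r that by (simp add: mult_nonneg_nonpos divide_nonneg_neg)
    then have "(\<Sum>i\<in>I. c i * (pairing (a i) x / r)) \<le> 0"
      by (rule sum_nonpos)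
    moreover have "pairing b x / r > 0"
      using x r by (simp add: divide_neg_neg)
    ultimately have d: "d \<ge> 0"
      unfolding d_def by linarith
    have "b = b' + (pairing b x / r) *s a j"
      by (simp add: b'_def)
    also have "b' = (\<Sum>i\<in>I. c i *s a i) - (\<Sum>i\<in>I. c i * (pairing (a i) x / r)) *s a j"
      by (simp add: c(2) a'_def vec.scale_right_diff_distrib sum_subtractf vec.scale_sum_left)
    finally have "b = (\<Sum>i\<in>I. c i *s a i) + d *s a j"
      by (simp add: d_def vec.scale_left_diff_distrib add.commute add_diff_eq diff_add_eq)
    also have "(\<Sum>i\<in>I. c i *s a i) = (\<Sum>i\<in>I. (c(j := d)) i *s a i)"
      using insert.hyps by (intro sum.cong) auto
    finally show ?thesis
      using c(1) d insert.hyps by (intro exI[of _ "c(j := d)"]) (auto simp: add.commute)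
  qed
qed

lemma farkas:
  assumes "finite V" "b \<notin> cone_gen V"
  obtains u where "\<forall>v\<in>V. pairing v u \<ge> 0" "pairing b u < 0"
proof -
  have "\<not> (\<exists>c. (\<forall>v\<in>V. c v \<ge> 0) \<and> b = (\<Sum>v\<in>V. c v *s v))"
    using assms unfolding cone_gen_def by blast
  then have "\<exists>u. (\<forall>v\<in>V. pairing v u \<ge> 0) \<and> \<not> pairing b u \<ge> 0"
    using farkas_family[OF assms(1), of "\<lambda>v. v" b] by blast
  then show ?thesis
    using that by force
qed

lemma strongly_convexD:
  assumes "strongly_convex \<sigma>" "v \<in> \<sigma>" "- v \<in> \<sigma>"
  shows "v = 0"
proof -
  have "v \<in> \<sigma> \<inter> uminus ` \<sigma>"
    using assms(2,3) by (auto intro!: image_eqI[of v uminus "- v"])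
  then show ?thesis
    using assms(1) unfolding strongly_convex_def by auto
qed

text \<open>
  In a generating set of least size no generator \<open>v\<close> is redundant. For each other generator \<open>w\<close>,
  Farkas' lemma yields a functional that is nonnegative on the cone, zero at \<open>v\<close> and positive at
  \<open>w\<close>: otherwise \<open>- w\<close> would be a nonnegative combination of the generators and \<open>- v\<close>, and this
  contradicts strong convexity or the irredundancy of \<open>v\<close>. The sum of these functionals cuts out
  the ray of \<open>v\<close>.
\<close>
lemma generators_spanning_faces:
  fixes \<sigma> :: "(rat ^ 'n::finite) set"
  assumes "polyhedral_cone \<sigma>" "strongly_convex \<sigma>"
  obtains V where "finite V" "\<sigma> = cone_gen V"
    "\<And>v. v \<in> V \<Longrightarrow> v \<noteq> 0" "\<And>v. v \<in> V \<Longrightarrow> cone_face (cone_gen {v}) \<sigma>"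
proof -
  obtain V0 where "finite V0 \<and> \<sigma> = cone_gen V0"
    using assms(1) unfolding polyhedral_cone_def ..
  from ex_has_least_nat[of "\<lambda>V. finite V \<and> \<sigma> = cone_gen V", OF this, of card] obtain V
    where V: "finite V" "\<sigma> = cone_gen V"
      and least: "\<And>W. finite W \<Longrightarrow> \<sigma> = cone_gen W \<Longrightarrow> card V \<le> card W"
    by (elim exE conjE) simp
  have irredundant: "v \<notin> cone_gen (V - {v})" if "v \<in> V" for v
  proof
    assume "v \<in> cone_gen (V - {v})"
    then have "V \<subseteq> cone_gen (V - {v})"
      using cone_gen_superset[of "V - {v}"] by blast
    then have "\<sigma> = cone_gen (V - {v})"
      using V(2) cone_gen_subset cone_gen_mono[of "V - {v}" V] by blast
    then have "card V \<le> card (V - {v})"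
      using V(1) by (intro least) auto
    then show False
      using card_Diff1_less[OF V(1) that] by linarith
  qed
  have nonzero: "v \<noteq> 0" if "v \<in> V" for v
    using irredundant[OF that] cone_gen_zero[of "V - {v}"] by metis
  have "cone_face (cone_gen {v}) \<sigma>" if v: "v \<in> V" for v
  proof -
    let ?W = "V - {v}"
    have "\<exists>u. (\<forall>x\<in>V. pairing x u \<ge> 0) \<and> pairing v u = 0 \<and> pairing w u > 0" if w: "w \<in> ?W" for w
    proof -
      have "- w \<notin> cone_gen (insert v (insert (- v) ?W))"
      proof
        assume "- w \<in> cone_gen (insert v (insert (- v) ?W))"
        then obtain y a where y: "y \<in> cone_gen (insert (- v) ?W)" "a \<ge> 0" "- w = y + a *s v"
          by (rule cone_gen_insert)
        from y(1) obtain x b where x: "x \<in> cone_gen ?W" "b \<ge> 0" "y = x + b *s (- v)"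
          by (rule cone_gen_insert)
        have eq: "- w = x + (a - b) *s v"
          by (simp add: y(3) x(3) vec.scale_left_diff_distrib)
        \<comment> \<open>If the coefficient of \<open>v\<close> is nonnegative, both \<open>w\<close> and \<open>- w\<close> lie in the cone; if it
          is negative, solving for \<open>v\<close> shows that \<open>v\<close> is redundant.\<close>
        show False
        proof (cases "a \<ge> b")
          case True
          have "x \<in> \<sigma>" "v \<in> \<sigma>" "w \<in> \<sigma>"
            using x(1) V(2) v w cone_gen_mono[of ?W V] cone_gen_superset[of V] by auto
          then have "- w \<in> \<sigma>"
            unfolding eq V(2) using True by (intro cone_gen_add cone_gen_scale) auto
          then have "w = 0"
            using strongly_convexD[OF assms(2)] \<open>w \<in> \<sigma>\<close> by blast
          then show False
            using nonzero[of w] w by blast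
        next
          case False
          have "(b - a) *s v = x + w"
            using eq by (simp add: vec.scale_left_diff_distrib algebra_simps) 
          moreover have "v = (1 / (b - a)) *s ((b - a) *s v)"
            using False by (subst vec.scale_scale) simp
          ultimately have "v = (1 / (b - a)) *s (x + w)"
            by metis
          moreover have "w \<in> cone_gen ?W"
            using w cone_gen_superset[of ?W] by blast
          then have "(1 / (b - a)) *s (x + w) \<in> cone_gen ?W"
            using x(1) False by (intro cone_gen_scale cone_gen_add) auto
          ultimately show False
            using irredundant[OF v] by simp
        qed
      qed
      then obtain u where u: "\<forall>x\<in>insert v (insert (- v) ?W). pairing x u \<ge> 0" "pairing (- w) u < 0"
        using farkas[of "insert v (insert (- v) ?W)"] V(1) by (metis finite_Diff finite_insert)
      then show ?thesis
        by (intro exI[of _ u]) (auto simp: pairing_minus_left)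
    qed
    then obtain U where U: "\<And>w x. w \<in> ?W \<Longrightarrow> x \<in> V \<Longrightarrow> pairing x (U w) \<ge> 0"
      "\<And>w. w \<in> ?W \<Longrightarrow> pairing v (U w) = 0" "\<And>w. w \<in> ?W \<Longrightarrow> pairing w (U w) > 0"
      by metis
    define u where "u = (\<Sum>w\<in>?W. U w)"
    have nonneg: "\<forall>x\<in>V. pairing x u \<ge> 0"
      unfolding u_def pairing_sum_right using U(1) by (intro ballI sum_nonneg) auto
    have zero: "pairing v u = 0"
      unfolding u_def pairing_sum_right using U(2) by simp
    have pos: "pairing w u > 0" if "w \<in> ?W" for w
      unfolding u_def pairing_sum_right using that V(1) U by (intro sum_pos2[of _ w]) auto
    have "{x\<in>V. pairing x u = 0} = {v}"
      using zero pos v by force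
    then have "{x\<in>\<sigma>. pairing x u = 0} = cone_gen {v}"
      unfolding V(2) using cone_gen_face[OF V(1) nonneg] by simp
    moreover have "u \<in> dual_cone \<sigma>"
      using nonneg by (simp add: V(2) dual_cone_cone_gen)
    ultimately show ?thesis
      unfolding cone_face_def by (intro bexI[of _ u]) auto
  qed
  with V nonzero that show ?thesis by blast
qed

lemma cone_gen_singleton: "x \<in> cone_gen {v} \<longleftrightarrow> (\<exists>a\<ge>0. x = a *s v)"
proof
  assume "x \<in> cone_gen {v}"
  then show "\<exists>a\<ge>0. x = a *s v"
    by (elim cone_gen_coefficients[rotated]) auto
next
  assume "\<exists>a\<ge>0. x = a *s v"
  then show "x \<in> cone_gen {v}"
    using cone_gen_scale[of v "{v}"] cone_gen_superset[of "{v}"] by blast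
qed

lemma dim_cone_gen_singleton:
  assumes "v \<noteq> 0"
  shows "vec.dim (cone_gen {v}) = 1"
proof -
  have "cone_gen {v} \<subseteq> vec.span {v}"
    by (auto simp: vec.span_singleton cone_gen_singleton intro!: rangeI)
  moreover have "vec.independent {v}"
    using assms by simp
  ultimately show ?thesis
    using vec.dim_unique[of "{v}" "cone_gen {v}" 1] cone_gen_superset[of "{v}"] by simp
qed

lemma primitive_multiple_exists:
  fixes b :: "rat ^ 'n::finite"
  assumes "b \<noteq> 0"
  obtains p r where "primitive p" "r > 0" "rat_vec p = r *s b"
proof -
  obtain d :: int and m where d: "d > 0" "rat_vec m = of_int d *s b"
    using rat_vec_multiple_exists by blast
  have "m \<noteq> 0"
  proof
    assume "m = 0"
    then show False
      using assms d(1) d(2)[symmetric] by simp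
  qed
  define g where "g = (GCD i. m $ i)"
  have "g \<noteq> 0"
    using \<open>m \<noteq> 0\<close> by (auto simp: g_def Gcd_0_iff vec_eq_iff)
  then have g: "g > 0"
    using Gcd_int_greater_eq_0[of "range (($) m)"] unfolding g_def by linarith
  have "g dvd m $ i" for i
    unfolding g_def by (intro Gcd_dvd) auto
  then have m: "m = g *s (\<chi> i. m $ i div g)"
    by (simp add: vec_eq_iff)
  define p where "p = (\<chi> i. m $ i div g)"
  have "primitive p"
    unfolding primitive_def
  proof (intro allI impI)
    fix k w assume "p = k *s w"
    then have "m = (g * k) *s w"
      using m by (simp add: p_def)
    then have "g * k dvd m $ i" for i
      by (metis dvd_triv_left vector_smult_component)
    then have "g * k dvd g"
      by (subst (2) g_def) (auto intro: Gcd_greatest)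
    then have "k dvd 1"
      using g by (simp add: dvd_mult_cancel_left)
    then show "k = 1 \<or> k = - 1"
      by auto
  qed
  moreover have "rat_vec p = (of_int d / of_int g) *s b"
  proof -
    have "of_int g *s rat_vec p = of_int d *s b"
      using d(2) m by (metis p_def rat_vec_scale)
    then show ?thesis
      using g by (auto simp: vec_eq_iff field_simps)
  qed
  ultimately show ?thesis
    using d g that[of p "of_int d / of_int g"] by simp
qed

text \<open>
  If \<open>r = a / b\<close> in lowest terms, then \<open>b\<close> divides \<open>p\<close> and \<open>a\<close> divides \<open>q\<close>, so that both are
  \<open>1\<close>.
\<close>
lemma primitive_proportional_eq:
  fixes p q :: "int ^ 'n::finite"
  assumes "primitive p" "primitive q" "rat_vec q = r *s rat_vec p" "r > 0"
  shows "q = p"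
proof -
  obtain a b where ab: "quotient_of r = (a, b)" by fastforce
  have r: "r = of_int a / of_int b" and b: "b > 0" and cop: "coprime a b"
    using ab quotient_of_div quotient_of_denom_pos quotient_of_coprime by blast+
  have a: "a > 0"
    using assms(4) b unfolding r by (simp add: zero_less_divide_iff)
  have eq: "b * q $ i = a * p $ i" for i
  proof -
    have "of_int b * of_int (q $ i) = of_int a * (of_int (p $ i) :: rat)"
      using assms(3) b unfolding r by (auto simp: rat_vec_def vec_eq_iff field_simps)
    then show ?thesis
      by (metis of_int_eq_iff of_int_mult)
  qed
  have "b dvd p $ i" for i
    using eq[of i] cop by (metis coprime_commute coprime_dvd_mult_right_iff dvd_triv_left)
  then have "p = b *s (\<chi> i. p $ i div b)"
    by (simp add: vec_eq_iff)
  then have "b = 1"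
    using assms(1) b unfolding primitive_def by fastforce
  have "a dvd q $ i" for i
    using eq[of i] cop by (metis coprime_dvd_mult_right_iff dvd_triv_left)
  then have "q = a *s (\<chi> i. q $ i div a)"
    by (simp add: vec_eq_iff)
  then have "a = 1"
    using assms(2) a unfolding primitive_def by fastforce
  show ?thesis
    using eq \<open>a = 1\<close> \<open>b = 1\<close> by (simp add: vec_eq_iff)
qed

text \<open>
  The vector \<open>ray_vec \<rho>\<close> is defined by a definite description; it exists because a point of the
  ray has a primitive multiple, and it is unique because the points of the ray are proportional
  with positive factors.
\<close>
lemma ray_generated_by_ray_vec:
  fixes \<rho> :: "(rat ^ 'n::finite) set"
  assumes "polyhedral_cone \<rho>" "strongly_convex \<rho>" "vec.dim \<rho> = 1"
  shows "\<rho> = cone_gen {rat_vec (ray_vec \<rho>)}"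
proof -
  obtain V where V: "\<rho> = cone_gen V"
    using assms(1) unfolding polyhedral_cone_def by blast
  obtain B where B: "B \<subseteq> \<rho>" "vec.independent B" "\<rho> \<subseteq> vec.span B" "card B = 1"
    using vec.basis_exists[of \<rho>] assms(3) by metis
  then obtain b where b: "B = {b}"
    by (auto simp: card_1_singleton_iff)
  have "b \<noteq> 0"
    using B(2) b by (auto simp: vec.dependent_single)
  have "b \<in> \<rho>"
    using B b by auto
  obtain p r where p: "primitive p" "r > 0" "rat_vec p = r *s b"
    using primitive_multiple_exists[OF \<open>b \<noteq> 0\<close>] .
  have p_in: "rat_vec p \<in> \<rho>"
    using \<open>b \<in> \<rho>\<close> p unfolding V by (simp add: cone_gen_scale)
  have pos: "\<exists>a\<ge>0. x = a *s rat_vec p" if x: "x \<in> \<rho>" for x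
  proof -
    obtain a where a: "x = a *s b"
      using B(3) x unfolding b by (auto simp: vec.span_singleton)
    have "a \<ge> 0"
    proof (rule ccontr)
      assume "\<not> a \<ge> 0"
      then have "- b = (- (1 / a)) *s x"
        by (simp add: a vec_eq_iff)
      also have "\<dots> \<in> \<rho>"
        using x \<open>\<not> a \<ge> 0\<close> unfolding V by (intro cone_gen_scale) auto
      finally show False
        using strongly_convexD[OF assms(2) \<open>b \<in> \<rho>\<close>] \<open>b \<noteq> 0\<close> by blast
    qed
    then show ?thesis
      using p by (intro exI[of _ "a / r"]) (auto simp: a vec_eq_iff)
  qed
  have unique: "q = p" if q: "primitive q \<and> rat_vec q \<in> \<rho>" for q
  proof -
    obtain a where a: "a \<ge> 0" "rat_vec q = a *s rat_vec p"
      using pos q by blast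
    have "q \<noteq> 0"
    proof
      assume "q = 0"
      then have "q = 0 *s 0" by simp
      then show False
        using q unfolding primitive_def by fastforce
    qed
    then have "rat_vec q \<noteq> 0"
      using rat_vec_eq_iff[of q 0] by simp
    then have "a \<noteq> 0"
      using a by auto
    then show ?thesis
      using primitive_proportional_eq[OF p(1) _ a(2)] q a(1) by auto
  qed
  have "ray_vec \<rho> = p"
    unfolding ray_vec_def by (rule the_equality) (use p(1) p_in in \<open>blast intro: unique\<close>)+
  then show ?thesis
    using pos p_in V cone_gen_scale[of "rat_vec p" V] cone_gen_singleton[of _ "rat_vec p"] by auto
qed

section \<open>Characters of the torus\<close>

lemma torus_carrier:
  "t \<in> carrier torus \<longleftrightarrow> t 0 = 1 \<and> (\<forall>m m'. t (m + m') = t m * t m')"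
  by (simp add: torus_def)

lemma torus_nonzero:
  assumes "t \<in> carrier torus"
  shows "t m \<noteq> 0"
proof
  assume "t m = 0"
  then have "t (m + - m) = 0"
    using assms by (simp only: torus_carrier mult_zero_left)
  then show False
    using assms by (simp add: torus_carrier)
qed

lemma torus_mult: "t \<in> carrier torus \<Longrightarrow> t' \<in> carrier torus \<Longrightarrow> (\<lambda>m. t m * t' m) \<in> carrier torus"
  by (simp add: torus_carrier)

lemma torus_divide: "t \<in> carrier torus \<Longrightarrow> t' \<in> carrier torus \<Longrightarrow> (\<lambda>m. t m / t' m) \<in> carrier torus"
  by (simp add: torus_carrier)

lemma torus_one: "(\<lambda>m. 1) \<in> carrier torus"
  by (simp add: torus_carrier)

lemma torus_scale:
  assumes "t \<in> carrier torus"
  shows "t (of_nat k *s m) = t m ^ k"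
proof (induction k)
  case 0
  then show ?case using assms by (simp add: torus_carrier)
next
  case (Suc k)
  have "of_nat (Suc k) *s m = m + of_nat k *s m"
    by (simp add: vec_eq_iff distrib_right)
  then show ?case
    using assms Suc by (simp add: torus_carrier)
qed

text \<open>
  A homomorphism from the subgroup \<open>H\<close> to the units of the field.
\<close>
definition partial_character :: "(int ^ 'n) set \<Rightarrow> (int ^ 'n \<Rightarrow> 'k::field) \<Rightarrow> bool" where
  "partial_character H g \<longleftrightarrow> 0 \<in> H \<and> (\<forall>a\<in>H. \<forall>b\<in>H. a - b \<in> H) \<and> (\<forall>a\<in>H. g a \<noteq> 0) \<and>
     (\<forall>a\<in>H. \<forall>b\<in>H. g (a + b) = g a * g b)"

lemma partial_character_zero:
  assumes "partial_character H g"
  shows "0 \<in> H" "g 0 = 1"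
proof -
  show *: "0 \<in> H"
    using assms unfolding partial_character_def by blast
  have "g (0 + 0) = g 0 * g 0" "g 0 \<noteq> 0"
    using assms * unfolding partial_character_def by blast+
  then show "g 0 = 1" by simp
qed

lemma partial_character_diff_mem:
  assumes "partial_character H g" "a \<in> H" "b \<in> H"
  shows "a - b \<in> H"
  using assms unfolding partial_character_def by blast

lemma partial_character_add:
  assumes "partial_character H g" "a \<in> H" "b \<in> H"
  shows "a + b \<in> H" "g (a + b) = g a * g b"
proof -
  have "0 - b \<in> H"
    using assms partial_character_zero partial_character_diff_mem by blast
  then have "a - (0 - b) \<in> H"
    using assms partial_character_diff_mem by blast
  then show "a + b \<in> H" by simp
  show "g (a + b) = g a * g b"
    using assms unfolding partial_character_def by blast
qed

lemma partial_character_nonzero: "partial_character H g \<Longrightarrow> a \<in> H \<Longrightarrow> g a \<noteq> 0"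
  unfolding partial_character_def by blast

lemma partial_character_scale:
  assumes g: "partial_character H g" and a: "a \<in> H"
  shows "k *s a \<in> H \<and> g (k *s a) = g a powi k"
proof (induction k rule: int_induct[where k = 0])
  case base
  then show ?case
    using partial_character_zero[OF g] by simp
next
  case (step1 i)
  have "(i + 1) *s a = i *s a + a"
    by (simp add: vec_eq_iff distrib_right)
  then show ?case
    using partial_character_add[OF g _ a, of "i *s a"] step1 partial_character_nonzero[OF g a]
    by (simp add: power_int_add)
next
  case (step2 i)
  have "i *s a - a \<in> H"
    using partial_character_diff_mem[OF g] step2 a by blast
  moreover have "(i - 1) *s a = i *s a - a"
    by (simp add: vec_eq_iff left_diff_distrib)
  ultimately have "(i - 1) *s a \<in> H" "g ((i - 1) *s a) * g a = g a powi i"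
    using partial_character_add[OF g _ a, of "i *s a - a"] step2 by simp_all
  then show ?case
    using partial_character_nonzero[OF g a] by (simp add: power_int_diff field_simps)
qed

text \<open>
  The multiples \<open>j *s w\<close> that lie in \<open>H\<close> are those with \<open>j\<close> divisible by some \<open>d\<close>. The value \<open>c\<close>
  of the extension at \<open>w\<close> has to be a \<open>d\<close>-th root of the value at \<open>d *s w\<close>, which exists as the
  field is algebraically closed; if \<open>d = 0\<close>, any nonzero \<open>c\<close> will do.
\<close>
lemma partial_character_extend_by_one:
  fixes g :: "int ^ 'n \<Rightarrow> 'k::alg_closed_field"
  assumes g: "partial_character H g"
  obtains H' g' where "partial_character H' g'" "H \<subseteq> H'" "w \<in> H'" "\<And>a. a \<in> H \<Longrightarrow> g' a = g a"
proof -
  have "\<exists>c. c \<noteq> 0 \<and> (\<forall>j. j *s w \<in> H \<longrightarrow> c powi j = g (j *s w))"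
  proof (cases "\<exists>d>0. int d *s w \<in> H")
    case True
    define d where "d = (LEAST d. d > 0 \<and> int d *s w \<in> H)"
    have d: "d > 0" "int d *s w \<in> H"
      using LeastI_ex[OF True] unfolding d_def by blast+
    have least: "d \<le> k" if "k > 0" "int k *s w \<in> H" for k
      unfolding d_def using that by (intro Least_le) blast
    obtain c where c: "c ^ d = g (int d *s w)"
      using nth_root_exists[OF d(1)] by blast
    then have "c \<noteq> 0"
      using partial_character_nonzero[OF g d(2)] d(1) by (metis zero_power)
    moreover have "c powi j = g (j *s w)" if j: "j *s w \<in> H" for j
    proof -
      let ?q = "j div int d"
      have q: "?q *s (int d *s w) \<in> H" "g (?q *s (int d *s w)) = g (int d *s w) powi ?q"
        using partial_character_scale[OF g d(2)] by blast+
      have "(j mod int d) *s w = j *s w - ?q *s (int d *s w)"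
        by (simp add: vec_eq_iff mult.assoc[symmetric] flip: left_diff_distrib minus_div_mult_eq_mod)
      then have "(j mod int d) *s w \<in> H"
        using partial_character_diff_mem[OF g j q(1)] by simp
      then have "int (nat (j mod int d)) *s w \<in> H"
        using d(1) by simp
      then have "nat (j mod int d) = 0"
        using least[of "nat (j mod int d)"] d(1) by (metis gr0I leD nat_less_iff of_nat_0_less_iff pos_mod_bound pos_mod_sign)
      then have "j mod int d = 0"
        using d(1) by (simp add: order_antisym)
      then have j_eq: "j = int d * ?q"
        by (simp add: mult.commute flip: dvd_eq_mod_eq_0)
      have "c powi j = (c ^ d) powi ?q"
        by (subst j_eq) (simp add: power_int_mult)
      also have "\<dots> = g (?q *s (int d *s w))"
        using c q by simp
      also have "?q *s (int d *s w) = j *s w"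
        by (subst (2) j_eq) (simp add: mult.commute)
      finally show ?thesis .
    qed
    ultimately show ?thesis by blast
  next
    case False
    have "j = 0" if j: "j *s w \<in> H" for j
    proof (rule ccontr)
      assume "j \<noteq> 0"
      moreover have "0 - j *s w = (- j) *s w"
        by (simp add: vec_eq_iff)
      then have "(- j) *s w \<in> H"
        using partial_character_diff_mem[OF g partial_character_zero(1)[OF g] j] by (simp only:)
      ultimately have "int (nat \<bar>j\<bar>) *s w \<in> H" "nat \<bar>j\<bar> > 0"
        using j by (auto simp: abs_if)
      then show False
        using False by blast
    qed
    then have "\<forall>j. j *s w \<in> H \<longrightarrow> 1 powi j = g (j *s w)"
      using partial_character_zero(2)[OF g] by fastforce
    then show ?thesis
      using zero_neq_one by metis
  qed
  then obtain c where c: "c \<noteq> 0" "\<And>j. j *s w \<in> H \<Longrightarrow> c powi j = g (j *s w)"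
    by blast
  define H' where "H' = {a. \<exists>k. a - k *s w \<in> H}"
  define K where "K a = (SOME k. a - k *s w \<in> H)" for a
  define g' where "g' a = g (a - K a *s w) * c powi K a" for a
  have g': "g' a = g (a - k *s w) * c powi k" if k: "a - k *s w \<in> H" for a k
  proof -
    have K: "a - K a *s w \<in> H"
      unfolding K_def using k by (rule someI)
    have eq: "a - k *s w = (a - K a *s w) + (K a - k) *s w"
      by (simp add: vec_eq_iff left_diff_distrib)
    have "(a - k *s w) - (a - K a *s w) = (K a - k) *s w"
      by (simp add: vec_eq_iff left_diff_distrib)
    then have mem: "(K a - k) *s w \<in> H"
      using partial_character_diff_mem[OF g k K] by (simp only:)
    have "g (a - k *s w) * c powi k = g (a - K a *s w) * (c powi (K a - k) * c powi k)"
      by (simp only: eq partial_character_add(2)[OF g K mem] c(2)[OF mem] mult.assoc)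
    also have "c powi (K a - k) * c powi k = c powi K a"
      using c(1) by (simp flip: power_int_add)
    finally show ?thesis
      unfolding g'_def by simp
  qed
  have "partial_character H' g'"
    unfolding partial_character_def
  proof (intro conjI ballI)
    show "0 \<in> H'"
      using partial_character_zero(1)[OF g] by (auto simp: H'_def intro: exI[of _ 0])
  next
    fix a b assume "a \<in> H'" "b \<in> H'"
    then obtain k l where k: "a - k *s w \<in> H" and l: "b - l *s w \<in> H"
      by (auto simp: H'_def)
    have "(a - b) - (k - l) *s w = (a - k *s w) - (b - l *s w)"
      by (simp add: vec_eq_iff left_diff_distrib)
    then have "(a - b) - (k - l) *s w \<in> H"
      using partial_character_diff_mem[OF g k l] by (simp only:)
    then show "a - b \<in> H'"
      unfolding H'_def by blast
    have eq: "(a + b) - (k + l) *s w = (a - k *s w) + (b - l *s w)"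
      by (simp add: vec_eq_iff distrib_right)
    then have mem: "(a + b) - (k + l) *s w \<in> H"
      using partial_character_add(1)[OF g k l] by (simp only:)
    have "g' (a + b) = g ((a + b) - (k + l) *s w) * c powi (k + l)"
      by (rule g'[OF mem])
    also have "g ((a + b) - (k + l) *s w) = g (a - k *s w) * g (b - l *s w)"
      by (simp only: eq partial_character_add(2)[OF g k l])
    also have "c powi (k + l) = c powi k * c powi l"
      using c(1) by (simp add: power_int_add)
    finally show "g' (a + b) = g' a * g' b"
      by (simp add: g'[OF k] g'[OF l])
  next
    fix a assume "a \<in> H'"
    then obtain k where k: "a - k *s w \<in> H"
      by (auto simp: H'_def)
    then show "g' a \<noteq> 0"
      using c(1) partial_character_nonzero[OF g k] by (simp add: g'[OF k])
  qed
  moreover have "H \<subseteq> H'"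
    by (auto simp: H'_def intro: exI[of _ 0])
  moreover have "w \<in> H'"
    using partial_character_zero(1)[OF g] by (auto simp: H'_def intro: exI[of _ 1])
  moreover have "g' a = g a" if "a \<in> H" for a
    using g'[of a 0] that by simp
  ultimately show ?thesis
    using that by blast
qed

text \<open>
  Adjoin the standard basis vectors one after the other.
\<close>
lemma partial_character_extend:
  fixes g :: "int ^ 'n::finite \<Rightarrow> 'k::alg_closed_field"
  assumes "partial_character H g"
  obtains t where "t \<in> carrier torus" "\<And>a. a \<in> H \<Longrightarrow> t a = g a"
proof -
  have "\<exists>H' g'. partial_character H' g' \<and> H \<subseteq> H' \<and> W \<subseteq> H' \<and> (\<forall>a\<in>H. g' a = g a)"
    if "finite W" for W
    using that
  proof (induction W rule: finite_induct)
    case empty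
    then show ?case using assms by blast
  next
    case (insert w W)
    then obtain H1 g1 where 1: "partial_character H1 g1" "H \<subseteq> H1" "W \<subseteq> H1" "\<forall>a\<in>H. g1 a = g a"
      by blast
    obtain H2 g2 where "partial_character H2 g2" "H1 \<subseteq> H2" "w \<in> H2" "\<And>a. a \<in> H1 \<Longrightarrow> g2 a = g1 a"
      using partial_character_extend_by_one[OF 1(1)] by metis
    with 1 show ?case
      by (intro exI[of _ H2] exI[of _ g2]) auto
  qed
  from this[of "range (\<lambda>i. axis i 1)"] obtain H' g' where
    g': "partial_character H' g'" "range (\<lambda>i. axis i 1) \<subseteq> H'" "\<forall>a\<in>H. g' a = g a"
    by auto
  have mem: "a \<in> H'" for a
  proof -
    have "(\<Sum>i\<in>I. (a $ i) *s axis i 1) \<in> H'" for I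
    proof (induction I rule: infinite_finite_induct)
      case (insert i I)
      have "(a $ i) *s axis i 1 \<in> H'"
        using partial_character_scale[OF g'(1), of "axis i 1"] g'(2) by blast
      with insert show ?case
        using partial_character_add(1)[OF g'(1)] by simp
    qed (use partial_character_zero[OF g'(1)] in auto)
    from this[of UNIV] show ?thesis
      by (simp add: basis_expansion)
  qed
  have "g' \<in> carrier torus"
    unfolding torus_carrier
    using partial_character_zero(2)[OF g'(1)] partial_character_add(2)[OF g'(1) mem mem] by blast
  with g'(3) show ?thesis
    using that by blast
qed

text \<open>
  A character of a submonoid extends to the differences of its elements by taking quotients, and
  from there to the lattice.
\<close>
lemma monoid_character_extend:
  fixes h :: "int ^ 'n::finite \<Rightarrow> 'k::alg_closed_field"
  assumes zero: "0 \<in> F" and add: "\<And>a b. a \<in> F \<Longrightarrow> b \<in> F \<Longrightarrow> a + b \<in> F"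
    and nonzero: "\<And>a. a \<in> F \<Longrightarrow> h a \<noteq> 0"
    and mult: "\<And>a b. a \<in> F \<Longrightarrow> b \<in> F \<Longrightarrow> h (a + b) = h a * h b"
  obtains t where "t \<in> carrier torus" "\<And>a. a \<in> F \<Longrightarrow> t a = h a"
proof -
  define H where "H = {a - b | a b. a \<in> F \<and> b \<in> F}"
  define g where "g x = (let p = SOME p. fst p \<in> F \<and> snd p \<in> F \<and> x = fst p - snd p
                         in h (fst p) / h (snd p))" for x
  have g: "g (a - b) = h a / h b" if "a \<in> F" "b \<in> F" for a b
  proof -
    define p where "p = (SOME p. fst p \<in> F \<and> snd p \<in> F \<and> a - b = fst p - snd p)"
    have p: "fst p \<in> F \<and> snd p \<in> F \<and> a - b = fst p - snd p"
      unfolding p_def by (rule someI[of _ "(a, b)"]) (use that in simp)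
    then have "a + snd p = fst p + b"
      by (simp add: algebra_simps)
    then have "h a * h (snd p) = h (fst p) * h b"
      using mult p that by metis
    then have "h (fst p) / h (snd p) = h a / h b"
      using nonzero p that by (simp add: frac_eq_eq mult.commute)
    then show ?thesis
      unfolding g_def p_def Let_def .
  qed
  have one: "h 0 = 1"
    using mult[OF zero zero] nonzero[OF zero] by simp
  have "partial_character H g"
    unfolding partial_character_def
  proof (intro conjI ballI)
    show "0 \<in> H"
      unfolding H_def using zero by (intro CollectI exI[of _ 0]) auto
  next
    fix x y assume "x \<in> H" "y \<in> H"
    then obtain a b c d where ab: "x = a - b" "a \<in> F" "b \<in> F" and cd: "y = c - d" "c \<in> F" "d \<in> F"
      unfolding H_def by blast
    have "x - y = (a + d) - (b + c)"
      using ab(1) cd(1) by simp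
    then show "x - y \<in> H"
      unfolding H_def using add ab cd by blast
    have "x + y = (a + c) - (b + d)"
      using ab(1) cd(1) by simp
    then have "g (x + y) = h (a + c) / h (b + d)"
      by (simp only: g add ab(2,3) cd(2,3))
    then show "g (x + y) = g x * g y"
      using g mult ab cd by simp
  next
    fix x assume "x \<in> H"
    then show "g x \<noteq> 0"
      unfolding H_def using g nonzero by auto
  qed
  then obtain t where t: "t \<in> carrier torus" "\<And>a. a \<in> H \<Longrightarrow> t a = g a"
    by (rule partial_character_extend) blast
  have "t a = h a" if a: "a \<in> F" for a
  proof -
    have "a - 0 \<in> H"
      unfolding H_def using a zero by blast
    then have "t (a - 0) = h a / h 0"
      using t(2) g[OF a zero] by simp
    then show ?thesis
      by (simp add: one)
  qed
  then show ?thesis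
    using that t(1) by blast
qed

section \<open>Evaluating elements of the group algebra\<close>

definition pm_eval :: "('a \<Rightarrow> 'k) \<Rightarrow> ('a \<Rightarrow>\<^sub>0 'k::field) \<Rightarrow> 'k" where
  "pm_eval \<phi> f = (\<Sum>m\<in>Poly_Mapping.keys f. Poly_Mapping.lookup f m * \<phi> m)"

lemma pm_eval_superset:
  assumes "finite A" "Poly_Mapping.keys f \<subseteq> A"
  shows "pm_eval \<phi> f = (\<Sum>m\<in>A. Poly_Mapping.lookup f m * \<phi> m)"
  unfolding pm_eval_def using assms
  by (intro sum.mono_neutral_left) (auto simp: in_keys_iff)

lemma pm_eval_zero [simp]: "pm_eval \<phi> 0 = 0"
  by (simp add: pm_eval_def)

lemma pm_eval_add: "pm_eval \<phi> (f + g) = pm_eval \<phi> f + pm_eval \<phi> g"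
proof -
  let ?A = "Poly_Mapping.keys f \<union> Poly_Mapping.keys g"
  show ?thesis
    using Poly_Mapping.keys_add[of f g]
    by (simp add: pm_eval_superset[of ?A] lookup_add distrib_right sum.distrib)
qed

lemma pm_eval_sum: "pm_eval \<phi> (\<Sum>i\<in>I. f i) = (\<Sum>i\<in>I. pm_eval \<phi> (f i))"
  by (induction I rule: infinite_finite_induct) (simp_all add: pm_eval_add)

lemma pm_eval_single [simp]: "pm_eval \<phi> (Poly_Mapping.single m c) = c * \<phi> m"
  by (simp add: pm_eval_superset[of "{m}"])

lemma pm_eval_cong:
  "(\<And>m. m \<in> Poly_Mapping.keys f \<Longrightarrow> \<phi> m = \<psi> m) \<Longrightarrow> pm_eval \<phi> f = pm_eval \<psi> f"
  unfolding pm_eval_def by (intro sum.cong) auto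

lemma poly_mapping_sum_singles:
  "f = (\<Sum>m\<in>Poly_Mapping.keys f. Poly_Mapping.single m (Poly_Mapping.lookup f m))"
  by (rule poly_mapping_eqI)
    (simp add: lookup_sum lookup_single when_def sum.delta in_keys_iff)

lemma pm_eval_mult:
  fixes f g :: "'a::monoid_add \<Rightarrow>\<^sub>0 'k::field"
  assumes "\<And>a b. a \<in> Poly_Mapping.keys f \<Longrightarrow> b \<in> Poly_Mapping.keys g \<Longrightarrow> \<phi> (a + b) = \<phi> a * \<phi> b"
  shows "pm_eval \<phi> (f * g) = pm_eval \<phi> f * pm_eval \<phi> g"
proof -
  let ?s = "\<lambda>f m. Poly_Mapping.single m (Poly_Mapping.lookup f m)"
  have "f * g = (\<Sum>a\<in>Poly_Mapping.keys f. ?s f a) * (\<Sum>b\<in>Poly_Mapping.keys g. ?s g b)"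
    using poly_mapping_sum_singles[of f] poly_mapping_sum_singles[of g] by simp
  also have "\<dots> = (\<Sum>a\<in>Poly_Mapping.keys f. \<Sum>b\<in>Poly_Mapping.keys g.
      Poly_Mapping.single (a + b) (Poly_Mapping.lookup f a * Poly_Mapping.lookup g b))"
    by (simp add: sum_product mult_single)
  finally have "pm_eval \<phi> (f * g) = (\<Sum>a\<in>Poly_Mapping.keys f. \<Sum>b\<in>Poly_Mapping.keys g.
      (Poly_Mapping.lookup f a * \<phi> a) * (Poly_Mapping.lookup g b * \<phi> b))"
    using assms by (simp add: pm_eval_sum mult_ac cong: sum.cong)
  then show ?thesis
    by (simp add: pm_eval_def sum_product)
qed

section \<open>Points of a toric chart\<close>

lemma dual_cone_zero [simp]: "0 \<in> dual_cone \<sigma>"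
  by (simp add: dual_cone_def)

lemma dual_cone_add: "u \<in> dual_cone \<sigma> \<Longrightarrow> v \<in> dual_cone \<sigma> \<Longrightarrow> u + v \<in> dual_cone \<sigma>"
  by (simp add: dual_cone_def pairing_simps)

lemma dual_cone_scale: "u \<in> dual_cone \<sigma> \<Longrightarrow> a \<ge> 0 \<Longrightarrow> a *s u \<in> dual_cone \<sigma>"
  by (simp add: dual_cone_def pairing_simps)

lemma dual_cone_antimono: "\<sigma> \<subseteq> \<tau> \<Longrightarrow> dual_cone \<tau> \<subseteq> dual_cone \<sigma>"
  by (auto simp: dual_cone_def)

lemma chart_ring_antimono: "\<sigma> \<subseteq> \<tau> \<Longrightarrow> chart_ring \<tau> \<subseteq> chart_ring \<sigma>"
  using dual_cone_antimono[of \<sigma> \<tau>] by (auto simp: chart_ring_def)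

lemma chart_ring_single: "rat_vec m \<in> dual_cone \<sigma> \<Longrightarrow> Poly_Mapping.single m c \<in> chart_ring \<sigma>"
  by (simp add: chart_ring_def)

lemma chart_ring_add: "f \<in> chart_ring \<sigma> \<Longrightarrow> g \<in> chart_ring \<sigma> \<Longrightarrow> f + g \<in> chart_ring \<sigma>"
  using Poly_Mapping.keys_add[of f g] by (auto simp: chart_ring_def)

lemma chart_ring_sum: "(\<And>i. i \<in> I \<Longrightarrow> f i \<in> chart_ring \<sigma>) \<Longrightarrow> (\<Sum>i\<in>I. f i) \<in> chart_ring \<sigma>"
proof (induction I rule: infinite_finite_induct)
  case (insert i I)
  then show ?case by (simp add: chart_ring_add)
qed (simp_all add: chart_ring_def)

lemma chartD:
  assumes "x \<in> chart \<sigma>"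
  shows "x \<in> extensional (chart_ring \<sigma>)" "x (Poly_Mapping.single 0 c) = c"
    "f \<in> chart_ring \<sigma> \<Longrightarrow> g \<in> chart_ring \<sigma> \<Longrightarrow> x (f + g) = x f + x g"
    "f \<in> chart_ring \<sigma> \<Longrightarrow> g \<in> chart_ring \<sigma> \<Longrightarrow> x (f * g) = x f * x g"
  using assms unfolding chart_def by auto

text \<open>
  By linearity a point of a chart is determined by its values on the monomials.
\<close>
lemma chart_eq_pm_eval:
  assumes x: "x \<in> chart \<sigma>" and f: "f \<in> chart_ring \<sigma>"
  shows "x f = pm_eval (\<lambda>m. x (Poly_Mapping.single m 1)) f"
proof -
  let ?s = "\<lambda>m. Poly_Mapping.single m (Poly_Mapping.lookup f m)"
  have single: "?s m \<in> chart_ring \<sigma>" "x (?s m) = Poly_Mapping.lookup f m * x (Poly_Mapping.single m 1)"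
    if "m \<in> Poly_Mapping.keys f" for m
  proof -
    have m: "rat_vec m \<in> dual_cone \<sigma>"
      using f that unfolding chart_ring_def by blast
    then show "?s m \<in> chart_ring \<sigma>"
      by (rule chart_ring_single)
    have "?s m = Poly_Mapping.single 0 (Poly_Mapping.lookup f m) * Poly_Mapping.single m 1"
      by (simp add: mult_single)
    then show "x (?s m) = Poly_Mapping.lookup f m * x (Poly_Mapping.single m 1)"
      using chartD(4)[OF x, of "Poly_Mapping.single 0 _" "Poly_Mapping.single m 1"] m
      by (simp add: chartD(2)[OF x] chart_ring_single)
  qed
  have "x (\<Sum>m\<in>I. ?s m) = (\<Sum>m\<in>I. Poly_Mapping.lookup f m * x (Poly_Mapping.single m 1))"
    if "I \<subseteq> Poly_Mapping.keys f" for I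
    using finite_subset[OF that finite_keys] that
  proof (induction I rule: finite_induct)
    case empty
    show ?case
      using chartD(2)[OF x, of 0] by simp
  next
    case (insert m I)
    have "(\<Sum>m\<in>I. ?s m) \<in> chart_ring \<sigma>"
      using insert.prems by (intro chart_ring_sum single(1)) auto
    then have "x (?s m + (\<Sum>m\<in>I. ?s m)) = x (?s m) + x (\<Sum>m\<in>I. ?s m)"
      using insert.prems by (intro chartD(3)[OF x] single(1)) auto
    with insert show ?case
      by (simp add: single(2))
  qed
  from this[OF subset_refl] show ?thesis
    by (simp add: pm_eval_def flip: poly_mapping_sum_singles)
qed

definition annihilator :: "(rat ^ 'n) set \<Rightarrow> (int ^ 'n) set" where
  "annihilator \<sigma> = {m. \<forall>v\<in>\<sigma>. pairing v (rat_vec m) = 0}"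

text \<open>
  The values on monomials of a point in the torus orbit of \<open>\<sigma>\<close>: the point that \<open>t\<close> moves the
  distinguished point of the orbit to. Extending \<open>t\<close> by zero is multiplicative on \<open>dual_cone \<sigma>\<close>,
  where the annihilator of \<open>\<sigma>\<close> is a face.
\<close>
definition face_character ::
    "(rat ^ 'n) set \<Rightarrow> (int ^ 'n \<Rightarrow> 'k::field) \<Rightarrow> int ^ 'n \<Rightarrow> 'k" where
  "face_character \<sigma> t m = (if m \<in> annihilator \<sigma> then t m else 0)"

definition chart_eval ::
    "(rat ^ 'n) set \<Rightarrow> (int ^ 'n \<Rightarrow> 'k::field) \<Rightarrow> (((int ^ 'n) \<Rightarrow>\<^sub>0 'k) \<Rightarrow> 'k)" where
  "chart_eval \<tau> \<phi> = restrict (pm_eval \<phi>) (chart_ring \<tau>)"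

lemma zero_annihilator [simp]: "0 \<in> annihilator \<sigma>"
  by (simp add: annihilator_def)

lemma face_character_zero: "t \<in> carrier torus \<Longrightarrow> face_character \<sigma> t 0 = 1"
  by (simp add: face_character_def torus_carrier)

lemma face_character_add:
  assumes "t \<in> carrier torus" "rat_vec a \<in> dual_cone \<sigma>" "rat_vec b \<in> dual_cone \<sigma>"
  shows "face_character \<sigma> t (a + b) = face_character \<sigma> t a * face_character \<sigma> t b"
proof -
  have "a + b \<in> annihilator \<sigma> \<longleftrightarrow> a \<in> annihilator \<sigma> \<and> b \<in> annihilator \<sigma>"
    using assms(2,3) by (auto simp: annihilator_def dual_cone_def rat_vec_add pairing_simps add_nonneg_eq_0_iff)
  then show ?thesis
    using assms(1) by (simp add: face_character_def torus_carrier)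
qed

lemma face_character_eq_iff:
  assumes "t \<in> carrier torus" "t' \<in> carrier torus"
  shows "face_character \<sigma> t = face_character \<sigma> t' \<longleftrightarrow> (\<forall>m\<in>annihilator \<sigma>. t m = t' m)"
  by (auto simp: face_character_def fun_eq_iff)

lemma chart_eval_in_chart:
  assumes t: "t \<in> carrier torus" and "\<sigma> \<subseteq> \<tau>"
  shows "chart_eval \<tau> (face_character \<sigma> t) \<in> chart \<tau>"
proof -
  have mult: "pm_eval (face_character \<sigma> t) (f * g) =
      pm_eval (face_character \<sigma> t) f * pm_eval (face_character \<sigma> t) g"
    if "f \<in> chart_ring \<tau>" "g \<in> chart_ring \<tau>" for f g
  proof (rule pm_eval_mult)
    fix a b assume "a \<in> Poly_Mapping.keys f" "b \<in> Poly_Mapping.keys g"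
    then have "rat_vec a \<in> dual_cone \<sigma>" "rat_vec b \<in> dual_cone \<sigma>"
      using that dual_cone_antimono[OF assms(2)] unfolding chart_ring_def by blast+
    then show "face_character \<sigma> t (a + b) = face_character \<sigma> t a * face_character \<sigma> t b"
      by (rule face_character_add[OF t])
  qed
  show ?thesis
    unfolding chart_def chart_eval_def
    using mult by (simp add: chart_ring_add chart_ring_mult chart_ring_single pm_eval_add face_character_zero[OF t])
qed

lemma face_integral_functional:
  assumes "cone_face \<sigma> \<tau>"
  obtains u where "rat_vec u \<in> dual_cone \<tau>" "\<sigma> = {v\<in>\<tau>. pairing v (rat_vec u) = 0}"
proof -
  obtain w where w: "w \<in> dual_cone \<tau>" "\<sigma> = {v\<in>\<tau>. pairing v w = 0}"
    using assms unfolding cone_face_def by blast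
  obtain d u where d: "d > 0" "rat_vec u = of_int d *s w"
    using rat_vec_multiple_exists .
  show thesis
  proof (rule that[of u])
    show "rat_vec u \<in> dual_cone \<tau>"
      unfolding d(2) using w d by (intro dual_cone_scale) auto
    show "\<sigma> = {v\<in>\<tau>. pairing v (rat_vec u) = 0}"
      unfolding d(2) using w d by (simp add: pairing_simps)
  qed
qed

lemma face_subset: "cone_face \<sigma> \<tau> \<Longrightarrow> \<sigma> \<subseteq> \<tau>"
  unfolding cone_face_def by blast

text \<open>
  The chart ring of a face \<open>\<sigma>\<close> of \<open>\<tau>\<close> arises from that of \<open>\<tau>\<close> by inverting the monomial of a
  functional \<open>u\<close> that cuts out \<open>\<sigma>\<close>. On a generator where \<open>u\<close> vanishes \<open>m\<close> vanishes too, and on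
  the finitely many others a large multiple of \<open>u\<close> dominates \<open>m\<close>.
\<close>
lemma large_multiple_in_dual_cone:
  assumes "polyhedral_cone \<tau>" "rat_vec u \<in> dual_cone \<tau>"
    "m \<in> annihilator {v\<in>\<tau>. pairing v (rat_vec u) = 0}"
  obtains k where "rat_vec (of_nat k *s u + m) \<in> dual_cone \<tau>"
proof -
  obtain V where V: "finite V" "\<tau> = cone_gen V"
    using assms(1) unfolding polyhedral_cone_def by blast
  have "\<exists>k. of_nat k * pairing v (rat_vec u) + pairing v (rat_vec m) \<ge> 0" if v: "v \<in> V" for v
  proof (cases "pairing v (rat_vec u) = 0")
    case True
    then have "pairing v (rat_vec m) = 0"
      using assms(3) v V(2) cone_gen_superset[of V] unfolding annihilator_def by blast
    then show ?thesis by (intro exI[of _ 0]) simp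
  next
    case False
    then have pos: "pairing v (rat_vec u) > 0"
      using assms(2) v unfolding V(2) dual_cone_cone_gen by force
    obtain k where "of_nat k \<ge> - pairing v (rat_vec m) / pairing v (rat_vec u)"
      using real_arch_simple by blast
    then show ?thesis
      using pos by (intro exI[of _ k]) (simp add: field_simps)
  qed
  then obtain k where k: "\<And>v. v \<in> V \<Longrightarrow> of_nat (k v) * pairing v (rat_vec u) + pairing v (rat_vec m) \<ge> 0"
    by metis
  define K where "K = (\<Sum>v\<in>V. k v)"
  have "pairing v (rat_vec (of_nat K *s u + m)) \<ge> 0" if v: "v \<in> V" for v
  proof -
    have "k v \<le> K"
      unfolding K_def using v V(1) by (intro member_le_sum) auto
    moreover have "pairing v (rat_vec u) \<ge> 0"
      using assms(2) v unfolding V(2) dual_cone_cone_gen by blast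
    ultimately have "of_nat (k v) * pairing v (rat_vec u) \<le> of_nat K * pairing v (rat_vec u)"
      by (intro mult_right_mono) auto
    then show ?thesis
      using k[OF v] by (simp add: rat_vec_add rat_vec_scale pairing_simps)
  qed
  then show ?thesis
    using that[of K] unfolding V(2) dual_cone_cone_gen by blast
qed

text \<open>
  The orbit-cone correspondence within a chart. Let \<open>F\<close> consist of the monomials that do not
  vanish at \<open>x\<close>. It is a submonoid, on which \<open>x\<close> is a character that extends to an element \<open>t\<close>
  of the torus. Let \<open>u\<close> be a sum of elements of \<open>F\<close>, positive on each generator of \<open>\<tau>\<close> on which
  some element of \<open>F\<close> is nonzero, and let \<open>\<sigma>\<close> be the face cut out by \<open>u\<close>. By construction \<open>F\<close>
  annihilates \<open>\<sigma>\<close>. Conversely, a monomial of the chart that annihilates \<open>\<sigma>\<close> divides a power of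
  the monomial of \<open>u\<close>, hence belongs to \<open>F\<close>.
\<close>
lemma chart_point_from_face:
  fixes x :: "((int ^ 'n::finite) \<Rightarrow>\<^sub>0 'k::alg_closed_field) \<Rightarrow> 'k"
  assumes \<tau>: "polyhedral_cone \<tau>" and x: "x \<in> chart \<tau>"
  obtains \<sigma> t where "cone_face \<sigma> \<tau>" "t \<in> carrier torus" "x = chart_eval \<tau> (face_character \<sigma> t)"
proof -
  obtain V where V: "finite V" "\<tau> = cone_gen V"
    using \<tau> unfolding polyhedral_cone_def by blast
  define h where "h m = x (Poly_Mapping.single m 1)" for m
  define D where "D = {m. rat_vec m \<in> dual_cone \<tau>}"
  define F where "F = {m\<in>D. h m \<noteq> 0}"
  have D0: "0 \<in> D"
    by (simp add: D_def)
  have D_add: "a + b \<in> D" if "a \<in> D" "b \<in> D" for a b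
    using that by (simp add: D_def rat_vec_add dual_cone_add)
  have h0: "h 0 = 1"
    unfolding h_def by (rule chartD(2)[OF x])
  have h_add: "h (a + b) = h a * h b" if "a \<in> D" "b \<in> D" for a b
    using that chartD(4)[OF x, of "Poly_Mapping.single a 1" "Poly_Mapping.single b 1"]
    by (simp add: h_def D_def mult_single chart_ring_single)
  have F0: "0 \<in> F"
    using D0 h0 by (simp add: F_def)
  have F_add: "a + b \<in> F" if "a \<in> F" "b \<in> F" for a b
    using that D_add h_add by (simp add: F_def)
  have F_sum: "(\<Sum>i\<in>I. f i) \<in> F" if "\<And>i. i \<in> I \<Longrightarrow> f i \<in> F" for I and f :: "rat ^ 'n \<Rightarrow> int ^ 'n"
    using that by (induction I rule: infinite_finite_induct) (simp_all add: F0 F_add)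
  obtain t where t: "t \<in> carrier torus" "\<And>a. a \<in> F \<Longrightarrow> t a = h a"
    using monoid_character_extend[of F h] F0 F_add h_add unfolding F_def by blast
  define W where "W = {v\<in>V. \<exists>m\<in>F. pairing v (rat_vec m) \<noteq> 0}"
  have "\<forall>v\<in>W. \<exists>m. m \<in> F \<and> pairing v (rat_vec m) \<noteq> 0"
    unfolding W_def by blast
  from bchoice[OF this] obtain w where w: "\<And>v. v \<in> W \<Longrightarrow> w v \<in> F \<and> pairing v (rat_vec (w v)) \<noteq> 0"
    by blast
  define u where "u = (\<Sum>v\<in>W. w v)"
  have u: "u \<in> F"
    unfolding u_def using w by (intro F_sum) blast
  have nonneg: "pairing v (rat_vec m) \<ge> 0" if "v \<in> V" "m \<in> F" for v m
    using that unfolding F_def D_def V(2) dual_cone_cone_gen by blast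
  have rat_vec_u: "rat_vec u = (\<Sum>v\<in>W. rat_vec (w v))"
    unfolding u_def by (induction W rule: infinite_finite_induct) (simp_all add: rat_vec_add)
  have u_pos: "pairing v (rat_vec u) > 0" if v: "v \<in> W" for v
  proof -
    have vV: "v \<in> V" and "finite W"
      using v V(1) by (auto simp: W_def)
    then show ?thesis
      unfolding rat_vec_u pairing_sum_right
      using v w nonneg[OF vV] by (intro sum_pos2[of _ v]) (auto simp: order_less_le)
  qed
  define \<sigma> where "\<sigma> = {v\<in>\<tau>. pairing v (rat_vec u) = 0}"
  have uD: "rat_vec u \<in> dual_cone \<tau>"
    using u by (simp add: F_def D_def)
  then have face: "cone_face \<sigma> \<tau>"
    unfolding cone_face_def \<sigma>_def by blast
  have \<sigma>: "\<sigma> = cone_gen {v\<in>V. pairing v (rat_vec u) = 0}"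
    unfolding \<sigma>_def V(2) using uD cone_gen_face[OF V(1)] unfolding V(2) dual_cone_cone_gen by blast
  have F_iff: "m \<in> F \<longleftrightarrow> m \<in> annihilator \<sigma>" if m: "m \<in> D" for m
  proof
    assume mF: "m \<in> F"
    have "pairing v (rat_vec m) = 0" if "v \<in> V" "pairing v (rat_vec u) = 0" for v
      using that u_pos[of v] mF unfolding W_def by force
    then show "m \<in> annihilator \<sigma>"
      unfolding annihilator_def \<sigma> by (simp only: mem_Collect_eq orthogonal_cone_gen) blast
  next
    assume "m \<in> annihilator \<sigma>"
    moreover have "rat_vec (- m) = - rat_vec m"
      using rat_vec_diff[of 0 m] by simp
    ultimately have "- m \<in> annihilator \<sigma>"
      by (simp add: annihilator_def pairing_minus_right)
    then obtain k where k: "rat_vec (of_nat k *s u + - m) \<in> dual_cone \<tau>"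
      using large_multiple_in_dual_cone[OF \<tau> uD] unfolding \<sigma>_def by blast
    have multiple: "of_nat k *s u \<in> F" for k
    proof (induction k)
      case (Suc k)
      have "of_nat (Suc k) *s u = u + of_nat k *s u"
        by (simp add: vec_eq_iff distrib_right)
      with Suc u F_add show ?case by simp
    qed (use F0 in simp)
    have "of_nat k *s u = m + (of_nat k *s u + - m)"
      by simp
    then have "h (of_nat k *s u) = h m * h (of_nat k *s u + - m)"
      using h_add[OF m, of "of_nat k *s u + - m"] k by (simp only: D_def mem_Collect_eq)
    then have "h m \<noteq> 0"
      using multiple[of k] by (auto simp: F_def)
    then show "m \<in> F"
      using m by (simp add: F_def)
  qed
  have h_eq: "h m = face_character \<sigma> t m" if m: "m \<in> D" for m
    using F_iff[OF m] t(2)[of m] m by (auto simp: face_character_def F_def)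
  have "x f = chart_eval \<tau> (face_character \<sigma> t) f" for f
  proof (cases "f \<in> chart_ring \<tau>")
    case True
    then have "x f = pm_eval h f"
      using chart_eq_pm_eval[OF x] unfolding h_def by blast
    also have "\<dots> = pm_eval (face_character \<sigma> t) f"
      using True h_eq by (intro pm_eval_cong) (simp add: chart_ring_def D_def)
    finally show ?thesis
      using True by (simp add: chart_eval_def)
  next
    case False
    then show ?thesis
      using chartD(1)[OF x] by (simp add: chart_eval_def extensional_def)
  qed
  then show ?thesis
    using that face t(1) by blast
qed

lemma chart_eval_character:
  "rat_vec m \<in> dual_cone \<tau> \<Longrightarrow> chart_eval \<tau> \<phi> (Poly_Mapping.single m 1) = \<phi> m"
  by (simp add: chart_eval_def chart_ring_single)

lemma chart_eval_cong:
  assumes "\<And>m. rat_vec m \<in> dual_cone \<tau> \<Longrightarrow> \<phi> m = \<psi> m"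
  shows "chart_eval \<tau> \<phi> = chart_eval \<tau> \<psi>"
  unfolding chart_eval_def
  using assms by (intro restrict_ext pm_eval_cong) (auto simp: chart_ring_def)

text \<open>
  The face is determined by the monomials that do not vanish at the point. The values of \<open>t\<close> on
  all of the annihilator are determined as well, since each of its elements is a quotient of two
  that occur as monomials on the chart.
\<close>
lemma chart_eval_face_inject:
  fixes t t' :: "int ^ 'n::finite \<Rightarrow> 'k::field"
  assumes \<tau>: "polyhedral_cone \<tau>" and faces: "cone_face \<sigma> \<tau>" "cone_face \<sigma>' \<tau>"
    and t: "t \<in> carrier torus" "t' \<in> carrier torus"
    and eq: "chart_eval \<tau> (face_character \<sigma> t) = chart_eval \<tau> (face_character \<sigma>' t')"
  shows "\<sigma> = \<sigma>' \<and> face_character \<sigma> t = face_character \<sigma>' t'"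
proof -
  have eq': "face_character \<sigma> t m = face_character \<sigma>' t' m" if "rat_vec m \<in> dual_cone \<tau>" for m
    using chart_eval_character[OF that] eq by metis
  have ann: "m \<in> annihilator \<sigma> \<longleftrightarrow> m \<in> annihilator \<sigma>'" if "rat_vec m \<in> dual_cone \<tau>" for m
    using eq'[OF that] torus_nonzero[OF t(1)] torus_nonzero[OF t(2)]
    by (auto simp: face_character_def split: if_splits)
  obtain u where u: "rat_vec u \<in> dual_cone \<tau>" "\<sigma> = {v\<in>\<tau>. pairing v (rat_vec u) = 0}"
    using face_integral_functional[OF faces(1)] .
  obtain u' where u': "rat_vec u' \<in> dual_cone \<tau>" "\<sigma>' = {v\<in>\<tau>. pairing v (rat_vec u') = 0}"
    using face_integral_functional[OF faces(2)] .
  have "u \<in> annihilator \<sigma>" "u' \<in> annihilator \<sigma>'"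
    using u u' by (auto simp: annihilator_def)
  then have "u \<in> annihilator \<sigma>'" "u' \<in> annihilator \<sigma>"
    using ann u u' by auto
  then have \<sigma>_eq: "\<sigma> = \<sigma>'"
    using face_subset[OF faces(1)] face_subset[OF faces(2)] unfolding annihilator_def
    by (subst (asm) u(2), subst (asm) u'(2)) (use u u' in blast)
  moreover have "t m = t' m" if m: "m \<in> annihilator \<sigma>" for m
  proof -
    obtain k where k: "rat_vec (of_nat k *s u + m) \<in> dual_cone \<tau>"
      using large_multiple_in_dual_cone[OF \<tau> u(1)] m u(2) by blast
    have "of_nat k *s u + m \<in> annihilator \<sigma>"
      using m \<open>u \<in> annihilator \<sigma>\<close>
      by (simp add: annihilator_def rat_vec_add rat_vec_scale pairing_simps)
    then have "t (of_nat k *s u + m) = t' (of_nat k *s u + m)"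
      using eq'[OF k] \<sigma>_eq by (simp add: face_character_def)
    moreover have "t u = t' u"
      using eq'[OF u(1)] \<sigma>_eq \<open>u \<in> annihilator \<sigma>\<close> by (simp add: face_character_def)
    ultimately show ?thesis
      using t torus_nonzero[OF t(1), of u] by (simp add: torus_carrier torus_scale)
  qed
  ultimately show ?thesis
    using face_character_eq_iff[OF t] by blast
qed

section \<open>Points of a toric variety\<close>

text \<open>
  All representatives of the point of the orbit of \<open>\<sigma>\<close> that \<open>t\<close> gives: it lies in the charts of
  exactly those cones that contain \<open>\<sigma>\<close>, and in all of them it has the same values on monomials.
\<close>
definition toric_pt ::
    "(rat ^ 'n) set set \<Rightarrow> (rat ^ 'n) set \<Rightarrow> (int ^ 'n \<Rightarrow> 'k::field) \<Rightarrow> ('k, 'n) toric_point" where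
  "toric_pt \<Sigma> \<sigma> t = {(\<tau>, chart_eval \<tau> (face_character \<sigma> t)) | \<tau>. \<tau> \<in> \<Sigma> \<and> \<sigma> \<subseteq> \<tau>}"

lemma fan_polyhedral: "fan \<Sigma> \<Longrightarrow> \<sigma> \<in> \<Sigma> \<Longrightarrow> polyhedral_cone \<sigma>"
  and fan_strongly_convex: "fan \<Sigma> \<Longrightarrow> \<sigma> \<in> \<Sigma> \<Longrightarrow> strongly_convex \<sigma>"
  and fan_face: "fan \<Sigma> \<Longrightarrow> \<sigma> \<in> \<Sigma> \<Longrightarrow> cone_face \<tau> \<sigma> \<Longrightarrow> \<tau> \<in> \<Sigma>"
  and fan_Int: "fan \<Sigma> \<Longrightarrow> \<sigma> \<in> \<Sigma> \<Longrightarrow> \<tau> \<in> \<Sigma> \<Longrightarrow> cone_face (\<sigma> \<inter> \<tau>) \<sigma>"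
  and fan_finite: "fan \<Sigma> \<Longrightarrow> finite \<Sigma>"
  unfolding fan_def by blast+

lemma fan_subset_face: "fan \<Sigma> \<Longrightarrow> \<sigma> \<in> \<Sigma> \<Longrightarrow> \<tau> \<in> \<Sigma> \<Longrightarrow> \<sigma> \<subseteq> \<tau> \<Longrightarrow> cone_face \<sigma> \<tau>"
  using fan_Int[of \<Sigma> \<tau> \<sigma>] by (simp add: inf.absorb2)

text \<open>
  If two representatives are glued by a point \<open>z\<close> of the chart of \<open>\<tau> \<inter> \<upsilon>\<close>, then \<open>z\<close> has the form
  given by \<open>chart_point_from_face\<close>, and by injectivity its face and character are those of the
  point one started from. So the classes are computed without showing first that gluing is an
  equivalence relation.
\<close>
lemma glue_class:
  fixes t :: "int ^ 'n::finite \<Rightarrow> 'k::alg_closed_field"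
  assumes fan: "fan \<Sigma>" and \<sigma>: "\<sigma> \<in> \<Sigma>" and \<tau>: "\<tau> \<in> \<Sigma>" and sub: "\<sigma> \<subseteq> \<tau>" and t: "t \<in> carrier torus"
  shows "glue \<Sigma> `` {(\<tau>, chart_eval \<tau> (face_character \<sigma> t))} = toric_pt \<Sigma> \<sigma> t"
proof (intro equalityI subsetI)
  fix p assume "p \<in> glue \<Sigma> `` {(\<tau>, chart_eval \<tau> (face_character \<sigma> t))}"
  then obtain \<upsilon> y z where p: "p = (\<upsilon>, y)" and \<upsilon>: "\<upsilon> \<in> \<Sigma>" and z: "z \<in> chart (\<tau> \<inter> \<upsilon>)"
    and x: "chart_eval \<tau> (face_character \<sigma> t) = restrict z (chart_ring \<tau>)"
    and y: "y = restrict z (chart_ring \<upsilon>)"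
    unfolding glue_def by auto
  have \<tau>\<upsilon>: "\<tau> \<inter> \<upsilon> \<in> \<Sigma>"
    using fan_face[OF fan \<tau> fan_Int[OF fan \<tau> \<upsilon>]] .
  obtain \<sigma>' t' where \<sigma>': "cone_face \<sigma>' (\<tau> \<inter> \<upsilon>)" and t': "t' \<in> carrier torus"
    and z_eq: "z = chart_eval (\<tau> \<inter> \<upsilon>) (face_character \<sigma>' t')"
    using chart_point_from_face[OF fan_polyhedral[OF fan \<tau>\<upsilon>] z] .
  have restr: "restrict z (chart_ring \<kappa>) = chart_eval \<kappa> (face_character \<sigma>' t')"
    if "\<tau> \<inter> \<upsilon> \<subseteq> \<kappa>" for \<kappa>
    unfolding z_eq chart_eval_def using chart_ring_antimono[OF that]
    by (intro restrict_ext) (auto simp: subset_iff)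
  have "\<sigma>' \<in> \<Sigma>" and "\<sigma>' \<subseteq> \<tau> \<inter> \<upsilon>"
    using fan_face[OF fan \<tau>\<upsilon> \<sigma>'] face_subset[OF \<sigma>'] by auto
  then have "\<sigma> = \<sigma>' \<and> face_character \<sigma> t = face_character \<sigma>' t'"
    using x restr[of \<tau>] fan_subset_face[OF fan] \<sigma> \<tau> sub t t'
    by (intro chart_eval_face_inject[OF fan_polyhedral[OF fan \<tau>]]) auto
  then show "p \<in> toric_pt \<Sigma> \<sigma> t"
    using restr[of \<upsilon>] \<upsilon> \<open>\<sigma>' \<subseteq> \<tau> \<inter> \<upsilon>\<close> unfolding p y toric_pt_def by auto
next
  fix p assume "p \<in> toric_pt \<Sigma> \<sigma> t"
  then obtain \<upsilon> where p: "p = (\<upsilon>, chart_eval \<upsilon> (face_character \<sigma> t))" and \<upsilon>: "\<upsilon> \<in> \<Sigma>" "\<sigma> \<subseteq> \<upsilon>"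
    unfolding toric_pt_def by blast
  let ?z = "chart_eval (\<tau> \<inter> \<upsilon>) (face_character \<sigma> t)"
  have restr: "restrict ?z (chart_ring \<kappa>) = chart_eval \<kappa> (face_character \<sigma> t)"
    if "\<tau> \<inter> \<upsilon> \<subseteq> \<kappa>" for \<kappa>
    unfolding chart_eval_def using chart_ring_antimono[OF that]
    by (intro restrict_ext) (auto simp: subset_iff)
  have "?z \<in> chart (\<tau> \<inter> \<upsilon>)"
    using sub \<upsilon> by (intro chart_eval_in_chart[OF t]) auto
  then show "p \<in> glue \<Sigma> `` {(\<tau>, chart_eval \<tau> (face_character \<sigma> t))}"
    unfolding p glue_def using restr[of \<tau>] restr[of \<upsilon>] \<tau> \<upsilon> by (auto intro!: bexI[of _ ?z])
qed

lemma toric_variety_eq: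
  assumes fan: "fan \<Sigma>"
  shows "(toric_variety \<Sigma> :: ('k::alg_closed_field, 'n::finite) toric_point set) =
    {toric_pt \<Sigma> \<sigma> t | \<sigma> t. \<sigma> \<in> \<Sigma> \<and> t \<in> carrier torus}"
proof (intro equalityI subsetI)
  fix P :: "('k, 'n) toric_point" assume "P \<in> toric_variety \<Sigma>"
  then obtain \<tau> x where \<tau>: "\<tau> \<in> \<Sigma>" and x: "x \<in> chart \<tau>" and P: "P = glue \<Sigma> `` {(\<tau>, x)}"
    unfolding toric_variety_def quotient_def by auto
  obtain \<sigma> t where \<sigma>: "cone_face \<sigma> \<tau>" and t: "t \<in> carrier torus"
    and eq: "x = chart_eval \<tau> (face_character \<sigma> t)"
    using chart_point_from_face[OF fan_polyhedral[OF fan \<tau>] x] .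
  have "P = toric_pt \<Sigma> \<sigma> t"
    unfolding P eq using fan_face[OF fan \<tau> \<sigma>] face_subset[OF \<sigma>] by (intro glue_class[OF fan _ \<tau> _ t])
  then show "P \<in> {toric_pt \<Sigma> \<sigma> t | \<sigma> t. \<sigma> \<in> \<Sigma> \<and> t \<in> carrier torus}"
    using fan_face[OF fan \<tau> \<sigma>] t by blast
next
  fix P :: "('k, 'n) toric_point"
  assume "P \<in> {toric_pt \<Sigma> \<sigma> t | \<sigma> t. \<sigma> \<in> \<Sigma> \<and> t \<in> carrier torus}"
  then obtain \<sigma> t where \<sigma>: "\<sigma> \<in> \<Sigma>" and t: "t \<in> carrier torus" and P: "P = toric_pt \<Sigma> \<sigma> t"
    by blast
  have "P = glue \<Sigma> `` {(\<sigma>, chart_eval \<sigma> (face_character \<sigma> t))}"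
    unfolding P using glue_class[OF fan \<sigma> \<sigma> subset_refl t] by simp
  moreover have "(\<sigma>, chart_eval \<sigma> (face_character \<sigma> t)) \<in> (SIGMA \<sigma>:\<Sigma>. chart \<sigma>)"
    using \<sigma> chart_eval_in_chart[OF t subset_refl[of \<sigma>]] by blast
  ultimately show "P \<in> toric_variety \<Sigma>"
    unfolding toric_variety_def using quotientI by metis
qed

lemma toric_pt_eq_iff:
  fixes t t' :: "int ^ 'n::finite \<Rightarrow> 'k::alg_closed_field"
  assumes fan: "fan \<Sigma>" and \<sigma>: "\<sigma> \<in> \<Sigma>" "\<sigma>' \<in> \<Sigma>" and t: "t \<in> carrier torus" "t' \<in> carrier torus"
  shows "toric_pt \<Sigma> \<sigma> t = toric_pt \<Sigma> \<sigma>' t' \<longleftrightarrow> \<sigma> = \<sigma>' \<and> (\<forall>m\<in>annihilator \<sigma>. t m = t' m)"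
proof
  assume eq: "toric_pt \<Sigma> \<sigma> t = toric_pt \<Sigma> \<sigma>' t'"
  have "(\<sigma>, chart_eval \<sigma> (face_character \<sigma> t)) \<in> toric_pt \<Sigma> \<sigma> t"
    unfolding toric_pt_def using \<sigma> by blast
  then have "(\<sigma>, chart_eval \<sigma> (face_character \<sigma> t)) \<in> toric_pt \<Sigma> \<sigma>' t'"
    by (simp only: eq)
  then have 1: "\<sigma>' \<subseteq> \<sigma>" "chart_eval \<sigma> (face_character \<sigma> t) = chart_eval \<sigma> (face_character \<sigma>' t')"
    unfolding toric_pt_def by auto
  then have "\<sigma> = \<sigma>' \<and> face_character \<sigma> t = face_character \<sigma>' t'"
    using fan_subset_face[OF fan] \<sigma> t
    by (intro chart_eval_face_inject[OF fan_polyhedral[OF fan \<sigma>(1)]]) auto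
  then show "\<sigma> = \<sigma>' \<and> (\<forall>m\<in>annihilator \<sigma>. t m = t' m)"
    using face_character_eq_iff[OF t, of \<sigma>] by auto
next
  assume "\<sigma> = \<sigma>' \<and> (\<forall>m\<in>annihilator \<sigma>. t m = t' m)"
  then show "toric_pt \<Sigma> \<sigma> t = toric_pt \<Sigma> \<sigma>' t'"
    using face_character_eq_iff[OF t, of \<sigma>] by (simp add: toric_pt_def)
qed

definition cone_orbit ::
    "(rat ^ 'n) set set \<Rightarrow> (rat ^ 'n) set \<Rightarrow> ('k::field, 'n) toric_point set" where
  "cone_orbit \<Sigma> \<sigma> = toric_pt \<Sigma> \<sigma> ` carrier torus"

lemma pm_eval_torus_comorphism:
  "pm_eval \<phi> (torus_comorphism t f) = pm_eval (\<lambda>m. t m * \<phi> m) f"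
  by (simp add: torus_comorphism_def pm_eval_sum)
    (simp add: pm_eval_def mult_ac)

lemma torus_comorphism_in_chart_ring:
  "f \<in> chart_ring \<tau> \<Longrightarrow> torus_comorphism t f \<in> chart_ring \<tau>"
  unfolding torus_comorphism_def
  by (intro chart_ring_sum chart_ring_single) (simp add: chart_ring_def)

lemma torus_action_toric_pt:
  fixes t :: "int ^ 'n::finite \<Rightarrow> 'k::alg_closed_field"
  assumes fan: "fan \<Sigma>" and \<sigma>: "\<sigma> \<in> \<Sigma>" and t: "t \<in> carrier torus"
  shows "torus_action \<Sigma> t' (toric_pt \<Sigma> \<sigma> t) = toric_pt \<Sigma> \<sigma> (\<lambda>m. t' m * t m)"
proof -
  have "(\<lambda>f\<in>chart_ring \<tau>. chart_eval \<tau> (face_character \<sigma> t) (torus_comorphism t' f)) =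
      chart_eval \<tau> (face_character \<sigma> (\<lambda>m. t' m * t m))" for \<tau>
  proof -
    have "(\<lambda>m. t' m * face_character \<sigma> t m) = face_character \<sigma> (\<lambda>m. t' m * t m)"
      by (auto simp: face_character_def)
    then show ?thesis
      unfolding chart_eval_def
      by (intro restrict_ext) (simp add: torus_comorphism_in_chart_ring pm_eval_torus_comorphism)
  qed
  then have "(\<lambda>(\<tau>, x). (\<tau>, \<lambda>f\<in>chart_ring \<tau>. x (torus_comorphism t' f))) ` toric_pt \<Sigma> \<sigma> t =
      toric_pt \<Sigma> \<sigma> (\<lambda>m. t' m * t m)"
    unfolding toric_pt_def by (auto simp: image_iff)
  moreover have "toric_pt \<Sigma> \<sigma> t \<in> toric_variety \<Sigma>"
    unfolding toric_variety_eq[OF fan] using \<sigma> t by blast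
  ultimately show ?thesis
    unfolding torus_action_def by simp
qed

lemma torus_orbit_eq:
  fixes t :: "int ^ 'n::finite \<Rightarrow> 'k::alg_closed_field"
  assumes fan: "fan \<Sigma>" and \<sigma>: "\<sigma> \<in> \<Sigma>" and t: "t \<in> carrier torus"
  shows "orbit torus (torus_action \<Sigma>) (toric_pt \<Sigma> \<sigma> t) =
    (cone_orbit \<Sigma> \<sigma> :: ('k, 'n) toric_point set)"
proof (intro equalityI subsetI)
  fix P assume "P \<in> orbit torus (torus_action \<Sigma>) (toric_pt \<Sigma> \<sigma> t)"
  then show "P \<in> cone_orbit \<Sigma> \<sigma>"
    unfolding orbit_def cone_orbit_def
    using torus_action_toric_pt[OF fan \<sigma> t] torus_mult[OF _ t] by blast
next
  fix P :: "('k, 'n) toric_point" assume "P \<in> cone_orbit \<Sigma> \<sigma>"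
  then obtain t' where t': "t' \<in> carrier torus" "P = toric_pt \<Sigma> \<sigma> t'"
    unfolding cone_orbit_def by blast
  then have "P = torus_action \<Sigma> (\<lambda>m. t' m / t m) (toric_pt \<Sigma> \<sigma> t)"
    using torus_action_toric_pt[OF fan \<sigma> t, of "\<lambda>m. t' m / t m"] torus_nonzero[OF t] by simp
  then show "P \<in> orbit torus (torus_action \<Sigma>) (toric_pt \<Sigma> \<sigma> t)"
    unfolding orbit_def using torus_divide[OF t'(1) t] by blast
qed

lemma torus_orbits_eq:
  assumes fan: "fan \<Sigma>"
  shows "(torus_orbits \<Sigma> :: ('k::alg_closed_field, 'n::finite) toric_point set set) =
    cone_orbit \<Sigma> ` \<Sigma>"
proof (intro equalityI subsetI)
  fix Y :: "('k, 'n) toric_point set" assume "Y \<in> torus_orbits \<Sigma>"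
  then show "Y \<in> cone_orbit \<Sigma> ` \<Sigma>"
    unfolding torus_orbits_def orbits_def toric_variety_eq[OF fan]
    using torus_orbit_eq[OF fan] by blast
next
  fix Y :: "('k, 'n) toric_point set" assume "Y \<in> cone_orbit \<Sigma> ` \<Sigma>"
  then obtain \<sigma> where \<sigma>: "\<sigma> \<in> \<Sigma>" "Y = cone_orbit \<Sigma> \<sigma>"
    by blast
  have "Y = orbit torus (torus_action \<Sigma>) (toric_pt \<Sigma> \<sigma> (\<lambda>_. 1 :: 'k))"
    unfolding \<sigma>(2) by (rule torus_orbit_eq[OF fan \<sigma>(1) torus_one, symmetric])
  then show "Y \<in> torus_orbits \<Sigma>"
    unfolding torus_orbits_def orbits_def toric_variety_eq[OF fan]
    using \<sigma>(1) torus_one by blast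
qed

lemma cone_orbit_disjoint:
  assumes fan: "fan \<Sigma>" and "\<sigma> \<in> \<Sigma>" "\<sigma>' \<in> \<Sigma>"
    and "P \<in> (cone_orbit \<Sigma> \<sigma> :: ('k::alg_closed_field, 'n::finite) toric_point set)"
    and "P \<in> cone_orbit \<Sigma> \<sigma>'"
  shows "\<sigma> = \<sigma>'"
  using assms toric_pt_eq_iff[OF fan] unfolding cone_orbit_def by blast

lemma cone_orbit_nonempty: "cone_orbit \<Sigma> \<sigma> \<noteq> {}"
  unfolding cone_orbit_def using torus_one by blast

section \<open>The root subgroup in coordinates\<close>

text \<open>
  A fan with a Demazure root; \<open>n\<close> is the primitive vector on the distinguished ray \<open>\<rho>\<close>.
\<close>
locale rooted_fan =
  fixes \<Sigma> :: "(rat ^ 'n::finite) set set" and \<rho> :: "(rat ^ 'n) set" and e n :: "int ^ 'n"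
  assumes fan: "fan \<Sigma>" and root: "demazure_root_at \<Sigma> \<rho> e" and n_def: "n = ray_vec \<rho>"
begin

lemma rho_in: "\<rho> \<in> \<Sigma>" and n_e: "pairing n e = - 1"
  using root unfolding demazure_root_at_def rays_def n_def by auto

lemma distinguished_ray_eq: "distinguished_ray \<Sigma> e = \<rho>"
  unfolding distinguished_ray_def
proof (rule the_equality)
  show "demazure_root_at \<Sigma> \<rho> e"
    by (rule root)
next
  fix \<rho>' assume "demazure_root_at \<Sigma> \<rho>' e"
  then show "\<rho>' = \<rho>"
    using root unfolding demazure_root_at_def by force
qed

lemma rho_generated: "\<rho> = cone_gen {rat_vec n}"
  using root fan_polyhedral[OF fan rho_in] fan_strongly_convex[OF fan rho_in]
  unfolding n_def demazure_root_at_def rays_def by (intro ray_generated_by_ray_vec) auto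

text \<open>
  The definition of a Demazure root controls \<open>e\<close> only on the rays of the fan. As its cones are
  generated by their rays, \<open>e\<close> is nonnegative on generators outside \<open>\<rho>\<close>.
\<close>
lemma cone_generators:
  assumes \<sigma>: "\<sigma> \<in> \<Sigma>"
  obtains V where "finite V" "\<sigma> = cone_gen V"
    "\<And>v. v \<in> V \<Longrightarrow> v \<in> \<rho> \<or> pairing v (rat_vec e) \<ge> 0"
proof -
  obtain V where V: "finite V" "\<sigma> = cone_gen V" "\<And>v. v \<in> V \<Longrightarrow> v \<noteq> 0"
    "\<And>v. v \<in> V \<Longrightarrow> cone_face (cone_gen {v}) \<sigma>"
    using generators_spanning_faces[OF fan_polyhedral[OF fan \<sigma>] fan_strongly_convex[OF fan \<sigma>]]
    by blast
  have "v \<in> \<rho> \<or> pairing v (rat_vec e) \<ge> 0" if v: "v \<in> V" for v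
  proof (cases "cone_gen {v} = \<rho>")
    case True
    then show ?thesis
      using cone_gen_superset[of "{v}"] by auto
  next
    case False
    let ?\<rho> = "cone_gen {v}"
    have in_\<Sigma>: "?\<rho> \<in> \<Sigma>"
      using fan_face[OF fan \<sigma> V(4)[OF v]] .
    have dim: "vec.dim ?\<rho> = 1"
      using dim_cone_gen_singleton[OF V(3)[OF v]] .
    then have "pairing (ray_vec ?\<rho>) e \<ge> 0"
      using root False in_\<Sigma> unfolding demazure_root_at_def rays_def by blast
    moreover have "v \<in> cone_gen {rat_vec (ray_vec ?\<rho>)}"
      using ray_generated_by_ray_vec[OF fan_polyhedral[OF fan in_\<Sigma>] fan_strongly_convex[OF fan in_\<Sigma>] dim]
        cone_gen_superset[of "{v}"] by blast
    then obtain a where "a \<ge> 0" "v = a *s rat_vec (ray_vec ?\<rho>)"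
      unfolding cone_gen_singleton by blast
    then have "pairing v (rat_vec e) = a * of_int (pairing (ray_vec ?\<rho>) e)"
      by (metis pairing_rat_vec pairing_scale_left)
    ultimately show ?thesis
      using \<open>a \<ge> 0\<close> by simp
  qed
  with V that show thesis by blast
qed

lemma pairing_n_nonneg:
  assumes "\<rho> \<subseteq> \<tau>" "rat_vec m \<in> dual_cone \<tau>"
  shows "pairing n m \<ge> 0"
proof -
  have "rat_vec n \<in> \<tau>"
    using assms(1) cone_gen_superset[of "{rat_vec n}"] unfolding rho_generated by blast
  then have "pairing (rat_vec n) (rat_vec m) \<ge> 0"
    using assms(2) unfolding dual_cone_def by blast
  then show ?thesis
    by (simp add: pairing_rat_vec)
qed

text \<open>
  So the derivation of the root preserves the charts: it either kills a monomial or multiplies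
  it by that of \<open>e\<close>, up to a scalar.
\<close>
lemma dual_cone_add_root:
  assumes \<tau>: "\<tau> \<in> \<Sigma>" and m: "rat_vec m \<in> dual_cone \<tau>" and k: "int k \<le> pairing n m"
  shows "rat_vec (m + of_nat k *s e) \<in> dual_cone \<tau>"
proof -
  obtain V where V: "finite V" "\<tau> = cone_gen V"
    "\<And>v. v \<in> V \<Longrightarrow> v \<in> \<rho> \<or> pairing v (rat_vec e) \<ge> 0"
    using cone_generators[OF \<tau>] by blast
  have "pairing v (rat_vec (m + of_nat k *s e)) \<ge> 0" if v: "v \<in> V" for v
  proof -
    have eq: "pairing v (rat_vec (m + of_nat k *s e)) =
        pairing v (rat_vec m) + of_nat k * pairing v (rat_vec e)"
      by (simp add: rat_vec_add rat_vec_scale pairing_simps)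
    show ?thesis
    proof (cases "v \<in> \<rho>")
      case True
      then obtain a where a: "a \<ge> 0" "v = a *s rat_vec n"
        unfolding rho_generated cone_gen_singleton by blast
      have "pairing v (rat_vec (m + of_nat k *s e)) = a * of_int (pairing n m - int k)"
        unfolding eq by (simp add: a pairing_simps pairing_rat_vec n_e algebra_simps)
      then show ?thesis
        using a(1) k by simp
    next
      case False
      then have "pairing v (rat_vec e) \<ge> 0"
        using V(3)[OF v] by blast
      moreover have "pairing v (rat_vec m) \<ge> 0"
        using m v unfolding V(2) dual_cone_cone_gen by blast
      ultimately show ?thesis
        unfolding eq by simp
    qed
  qed
  then show ?thesis
    unfolding V(2) dual_cone_cone_gen by blast
qed

lemma root_derivation_superset:
  assumes "finite A" "Poly_Mapping.keys f \<subseteq> A"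
  shows "root_derivation \<Sigma> e f =
    (\<Sum>m\<in>A. Poly_Mapping.single (m + e) (of_int (pairing n m) * Poly_Mapping.lookup f m))"
  unfolding root_derivation_def distinguished_ray_eq n_def using assms
  by (intro sum.mono_neutral_left) (auto simp: in_keys_iff)

lemma root_derivation_single:
  "root_derivation \<Sigma> e (Poly_Mapping.single m c) =
    Poly_Mapping.single (m + e) (of_int (pairing n m) * c)"
  by (simp add: root_derivation_superset[of "{m}"])

lemma root_derivation_add:
  "root_derivation \<Sigma> e (f + g) = root_derivation \<Sigma> e f + root_derivation \<Sigma> e g"
proof -
  let ?A = "Poly_Mapping.keys f \<union> Poly_Mapping.keys g"
  show ?thesis
    using Poly_Mapping.keys_add[of f g]
    by (simp add: root_derivation_superset[of ?A] lookup_add distrib_left single_add sum.distrib)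
qed

lemma root_derivation_sum:
  "root_derivation \<Sigma> e (\<Sum>i\<in>I. f i) = (\<Sum>i\<in>I. root_derivation \<Sigma> e (f i))"
  by (induction I rule: infinite_finite_induct)
    (simp_all add: root_derivation_add root_derivation_superset[of "{}" 0])

text \<open>
  Since \<open>e\<close> pairs to \<open>- 1\<close> with \<open>n\<close>, each application lowers the factor by one, which produces
  falling factorials.
\<close>
lemma root_derivation_power:
  fixes f :: "(int ^ 'n) \<Rightarrow>\<^sub>0 'k::field_char_0"
  shows "(root_derivation \<Sigma> e ^^ k) f = (\<Sum>m\<in>Poly_Mapping.keys f.
    Poly_Mapping.single (m + of_nat k *s e)
      ((\<Prod>i<k. of_int (pairing n m) - of_nat i) * Poly_Mapping.lookup f m))"
proof (induction k)
  case 0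
  then show ?case
    by (simp flip: poly_mapping_sum_singles)
next
  case (Suc k)
  have exponent: "m + of_nat k *s e + e = m + of_nat (Suc k) *s e" for m
    by (simp add: vec_eq_iff distrib_right)
  have "pairing n (m + of_nat k *s e) = pairing n m - int k" for m
    by (simp add: pairing_simps n_e)
  then show ?case
    by (simp add: Suc root_derivation_sum root_derivation_single exponent mult_ac del: of_nat_Suc)
qed

text \<open>
  Falling factorials divided by factorials are binomial coefficients: on a monomial \<open>\<chi>\<^sup>m\<close> the
  exponential is \<open>\<chi>\<^sup>m (1 + s \<chi>\<^sup>e)\<^sup>j\<close> with \<open>j\<close> the pairing of \<open>n\<close> and \<open>m\<close>.
\<close>
lemma root_exp_expand:
  fixes f :: "(int ^ 'n) \<Rightarrow>\<^sub>0 'k::field_char_0"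
  assumes nonneg: "\<And>m. m \<in> Poly_Mapping.keys f \<Longrightarrow> pairing n m \<ge> 0"
  shows "root_exp \<Sigma> e s f = (\<Sum>m\<in>Poly_Mapping.keys f. \<Sum>k\<le>nat (pairing n m).
    Poly_Mapping.single (m + of_nat k *s e)
      (of_nat (nat (pairing n m) choose k) * s ^ k * Poly_Mapping.lookup f m))"
proof -
  let ?c = "\<lambda>m k. of_nat (nat (pairing n m) choose k) * s ^ k * Poly_Mapping.lookup f m"
  let ?g = "\<lambda>m k. Poly_Mapping.single (m + of_nat k *s e) (?c m k)"
  \<comment> \<open>A common bound for the degrees of nilpotency on the monomials of \<open>f\<close>.\<close>
  define J where "J = (\<Sum>m\<in>Poly_Mapping.keys f. nat (pairing n m))"
  have J: "nat (pairing n m) \<le> J" if "m \<in> Poly_Mapping.keys f" for m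
    unfolding J_def using that by (intro member_le_sum) auto
  have coeff: "s ^ k / fact k * ((\<Prod>i<k. of_int (pairing n m) - of_nat i) * Poly_Mapping.lookup f m) = ?c m k"
    if "m \<in> Poly_Mapping.keys f" for m k
  proof -
    have "of_nat (nat (pairing n m) choose k) = (of_int (pairing n m) gchoose k :: 'k)"
      using nonneg[OF that] by (simp add: binomial_gbinomial)
    also have "\<dots> = (\<Prod>i<k. of_int (pairing n m) - of_nat i) / fact k"
      by (simp add: gbinomial_prod_rev atLeast0LessThan)
    finally show ?thesis
      by simp
  qed
  have summand: "Poly_Mapping.single 0 (s ^ k / fact k) * (root_derivation \<Sigma> e ^^ k) f =
      (\<Sum>m\<in>Poly_Mapping.keys f. ?g m k)" for k
    unfolding root_derivation_power sum_distrib_left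
    by (intro sum.cong refl) (simp add: mult_single coeff[symmetric])
  have "{k. (\<Sum>m\<in>Poly_Mapping.keys f. ?g m k) \<noteq> 0} \<subseteq> {..J}"
  proof (intro subsetI CollectI, elim CollectE)
    fix k assume "(\<Sum>m\<in>Poly_Mapping.keys f. ?g m k) \<noteq> 0"
    then obtain m where m: "m \<in> Poly_Mapping.keys f" "?g m k \<noteq> 0"
      by (meson sum.not_neutral_contains_not_neutral)
    have "k \<le> nat (pairing n m)"
    proof (rule ccontr)
      assume "\<not> k \<le> nat (pairing n m)"
      then have "?g m k = 0"
        by (simp add: binomial_eq_0)
      then show False
        using m(2) by contradiction
    qed
    then show "k \<in> {..J}"
      using J[OF m(1)] by simp
  qed
  then have "root_exp \<Sigma> e s f = (\<Sum>k\<le>J. \<Sum>m\<in>Poly_Mapping.keys f. ?g m k)"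
    unfolding root_exp_def summand by (intro Sum_any.expand_superset) auto
  also have "\<dots> = (\<Sum>m\<in>Poly_Mapping.keys f. \<Sum>k\<le>J. ?g m k)"
    by (rule sum.swap)
  also have "\<dots> = (\<Sum>m\<in>Poly_Mapping.keys f. \<Sum>k\<le>nat (pairing n m). ?g m k)"
  proof (rule sum.cong[OF refl], rule sum.mono_neutral_right)
    fix m assume m: "m \<in> Poly_Mapping.keys f"
    show "{..nat (pairing n m)} \<subseteq> {..J}"
      using J[OF m] by simp
    show "\<forall>k\<in>{..J} - {..nat (pairing n m)}. ?g m k = 0"
      by (simp add: binomial_eq_0)
  qed simp
  finally show ?thesis .
qed

text \<open>
  The values on monomials of the image under \<open>s\<close> of a point whose values on monomials are \<open>\<phi>\<close>.
\<close>
definition shifted_character :: "'k::field_char_0 \<Rightarrow> (int ^ 'n \<Rightarrow> 'k) \<Rightarrow> int ^ 'n \<Rightarrow> 'k" where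
  "shifted_character s \<phi> m = (\<Sum>k\<le>nat (pairing n m).
     of_nat (nat (pairing n m) choose k) * s ^ k * \<phi> (m + of_nat k *s e))"

lemma chart_ring_pairing_nonneg:
  assumes "f \<in> chart_ring \<tau>" "\<rho> \<subseteq> \<tau>" "m \<in> Poly_Mapping.keys f"
  shows "pairing n m \<ge> 0"
  using assms pairing_n_nonneg unfolding chart_ring_def by blast

lemma pm_eval_root_exp:
  assumes "f \<in> chart_ring \<tau>" "\<rho> \<subseteq> \<tau>"
  shows "pm_eval \<phi> (root_exp \<Sigma> e s f) = pm_eval (shifted_character s \<phi>) f"
  using chart_ring_pairing_nonneg[OF assms]
  by (simp add: root_exp_expand pm_eval_sum)
    (simp add: pm_eval_def shifted_character_def sum_distrib_left mult_ac)

lemma root_exp_in_chart_ring: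
  fixes f :: "(int ^ 'n) \<Rightarrow>\<^sub>0 'k::field_char_0"
  assumes f: "f \<in> chart_ring \<tau>" and \<tau>: "\<rho> \<subseteq> \<tau>" "\<tau> \<in> \<Sigma>"
  shows "root_exp \<Sigma> e s f \<in> chart_ring \<tau>"
proof -
  have nonneg: "pairing n m \<ge> 0" if "m \<in> Poly_Mapping.keys f" for m
    using chart_ring_pairing_nonneg[OF f \<tau>(1) that] .
  have "Poly_Mapping.single (m + of_nat k *s e) c \<in> chart_ring \<tau>"
    if m: "m \<in> Poly_Mapping.keys f" and k: "k \<le> nat (pairing n m)" for m k and c :: 'k
  proof (intro chart_ring_single dual_cone_add_root \<tau>(2))
    show "rat_vec m \<in> dual_cone \<tau>"
      using f m unfolding chart_ring_def by blast
    show "int k \<le> pairing n m"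
      using k nonneg[OF m] by auto
  qed
  then show ?thesis
    by (subst root_exp_expand) (auto intro!: chart_ring_sum simp: nonneg)
qed

text \<open>
  It suffices to compare values on monomials in every chart that contains both the point and the
  distinguished ray; then all members of the union in the definition of the action are the same
  class.
\<close>
lemma root_action_toric_pt:
  fixes t t' :: "int ^ 'n \<Rightarrow> 'k::{alg_closed_field, field_char_0}"
  assumes \<sigma>: "\<sigma> \<in> \<Sigma>" and t: "t \<in> carrier torus" and \<sigma>': "\<sigma>' \<in> \<Sigma>" and t': "t' \<in> carrier torus"
    and ex: "\<exists>\<tau>\<in>\<Sigma>. \<sigma> \<subseteq> \<tau> \<and> \<rho> \<subseteq> \<tau>"
    and sub: "\<And>\<tau>. \<tau> \<in> \<Sigma> \<Longrightarrow> \<sigma> \<subseteq> \<tau> \<Longrightarrow> \<rho> \<subseteq> \<tau> \<Longrightarrow> \<sigma>' \<subseteq> \<tau>"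
    and eq: "\<And>\<tau> m. \<tau> \<in> \<Sigma> \<Longrightarrow> \<sigma> \<subseteq> \<tau> \<Longrightarrow> \<rho> \<subseteq> \<tau> \<Longrightarrow> rat_vec m \<in> dual_cone \<tau> \<Longrightarrow>
      shifted_character s (face_character \<sigma> t) m = face_character \<sigma>' t' m"
  shows "root_action \<Sigma> e s (toric_pt \<Sigma> \<sigma> t) = toric_pt \<Sigma> \<sigma>' t'"
proof -
  let ?P = "toric_pt \<Sigma> \<sigma> t"
  let ?A = "{(\<tau>, x). (\<tau>, x) \<in> ?P \<and> \<rho> \<subseteq> \<tau>}"
  let ?g = "\<lambda>(\<tau>, x). glue \<Sigma> `` {(\<tau>, \<lambda>f\<in>chart_ring \<tau>. x (root_exp \<Sigma> e s f))}"
  have "?g p = toric_pt \<Sigma> \<sigma>' t'" if p_in: "p \<in> ?A" for p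
  proof -
    obtain \<tau> where p: "p = (\<tau>, chart_eval \<tau> (face_character \<sigma> t))"
      and \<tau>: "\<tau> \<in> \<Sigma>" "\<sigma> \<subseteq> \<tau>" "\<rho> \<subseteq> \<tau>"
      using p_in unfolding toric_pt_def by auto
    have "(\<lambda>f\<in>chart_ring \<tau>. chart_eval \<tau> (face_character \<sigma> t) (root_exp \<Sigma> e s f)) =
        chart_eval \<tau> (shifted_character s (face_character \<sigma> t))"
      unfolding chart_eval_def using \<tau>
      by (intro restrict_ext) (simp add: root_exp_in_chart_ring pm_eval_root_exp)
    also have "\<dots> = chart_eval \<tau> (face_character \<sigma>' t')"
      using eq[OF \<tau>] by (rule chart_eval_cong)
    finally show ?thesis
      using glue_class[OF fan \<sigma>' \<tau>(1) sub[OF \<tau>] t'] by (simp add: p)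
  qed
  moreover have ne: "?A \<noteq> {}"
    using ex unfolding toric_pt_def by auto
  ultimately have "(\<Union>p\<in>?A. ?g p) = toric_pt \<Sigma> \<sigma>' t'"
    by auto
  moreover have "?P \<in> toric_variety \<Sigma>"
    unfolding toric_variety_eq[OF fan] using \<sigma> t by blast
  moreover have "\<exists>(\<tau>, x)\<in>?P. \<rho> \<subseteq> \<tau>"
    using ne by auto
  ultimately show ?thesis
    unfolding root_action_def distinguished_ray_eq by simp
qed

lemma root_action_outside:
  fixes t :: "int ^ 'n \<Rightarrow> 'k::{alg_closed_field, field_char_0}"
  assumes \<sigma>: "\<sigma> \<in> \<Sigma>" and t: "t \<in> carrier torus" and "\<not> (\<exists>\<tau>\<in>\<Sigma>. \<sigma> \<subseteq> \<tau> \<and> \<rho> \<subseteq> \<tau>)"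
  shows "root_action \<Sigma> e s (toric_pt \<Sigma> \<sigma> t) = toric_pt \<Sigma> \<sigma> t"
proof -
  have "toric_pt \<Sigma> \<sigma> t \<in> toric_variety \<Sigma>"
    unfolding toric_variety_eq[OF fan] using \<sigma> t by blast
  moreover have "\<not> (\<exists>(\<tau>, x)\<in>toric_pt \<Sigma> \<sigma> t. \<rho> \<subseteq> \<tau>)"
    using assms(3) unfolding toric_pt_def by auto
  ultimately show ?thesis
    unfolding root_action_def distinguished_ray_eq by simp
qed

section \<open>The root subgroup on torus orbits\<close>

text \<open>
  The orbits that the root subgroup moves come in pairs: that of a cone on which \<open>e\<close> vanishes,
  and that of the cone obtained by adding the distinguished ray, which is in the fan by the
  second condition on a Demazure root.
\<close>
definition orthogonal_cones :: "(rat ^ 'n) set set" where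
  "orthogonal_cones = {\<sigma>\<in>\<Sigma>. e \<in> annihilator \<sigma>}"

definition join_ray :: "(rat ^ 'n) set \<Rightarrow> (rat ^ 'n) set" where
  "join_ray \<sigma> = cone_gen (\<sigma> \<union> \<rho>)"

lemma orthogonal_cones_subset: "\<sigma> \<in> orthogonal_cones \<Longrightarrow> \<sigma> \<in> \<Sigma>"
  by (simp add: orthogonal_cones_def)

lemma join_ray_in: "\<sigma> \<in> orthogonal_cones \<Longrightarrow> join_ray \<sigma> \<in> \<Sigma>"
  using root unfolding orthogonal_cones_def join_ray_def annihilator_def demazure_root_at_def by blast

lemma subset_join_ray: "\<sigma> \<subseteq> join_ray \<sigma>" "\<rho> \<subseteq> join_ray \<sigma>"
  using cone_gen_superset[of "\<sigma> \<union> \<rho>"] unfolding join_ray_def by auto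

lemma join_ray_least:
  assumes "\<tau> \<in> \<Sigma>" "\<sigma> \<subseteq> \<tau>" "\<rho> \<subseteq> \<tau>"
  shows "join_ray \<sigma> \<subseteq> \<tau>"
proof -
  obtain V where "\<tau> = cone_gen V"
    using fan_polyhedral[OF fan assms(1)] unfolding polyhedral_cone_def by blast
  then show ?thesis
    unfolding join_ray_def using assms by (simp add: cone_gen_subset)
qed

lemma annihilator_join_ray:
  "m \<in> annihilator (join_ray \<sigma>) \<longleftrightarrow> m \<in> annihilator \<sigma> \<and> pairing n m = 0"
proof -
  have "(\<forall>v\<in>\<rho>. pairing v (rat_vec m) = 0) \<longleftrightarrow> pairing n m = 0"
    unfolding rho_generated orthogonal_cone_gen by (simp add: pairing_rat_vec)
  then show ?thesis
    unfolding annihilator_def join_ray_def by (simp only: mem_Collect_eq orthogonal_cone_gen) blast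
qed

lemma annihilator_add_root:
  assumes "\<sigma> \<in> orthogonal_cones"
  shows "m + of_nat k *s e \<in> annihilator \<sigma> \<longleftrightarrow> m \<in> annihilator \<sigma>"
  using assms by (simp add: orthogonal_cones_def annihilator_def rat_vec_add rat_vec_scale pairing_simps)

text \<open>
  On the distinguished ray \<open>e\<close> does not vanish, so no cone is in both roles.
\<close>
lemma join_ray_not_orthogonal: "join_ray \<sigma> \<notin> orthogonal_cones"
proof
  assume "join_ray \<sigma> \<in> orthogonal_cones"
  then have "pairing n e = 0"
    using annihilator_join_ray unfolding orthogonal_cones_def by blast
  then show False
    by (simp add: n_e)
qed

text \<open>
  The value at \<open>c\<close> of the one-parameter subgroup \<open>n\<close> of the torus.
\<close>
definition ray_cocharacter :: "'k::field \<Rightarrow> int ^ 'n \<Rightarrow> 'k" where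
  "ray_cocharacter c m = c powi pairing n m"

lemma ray_cocharacter_torus: "c \<noteq> 0 \<Longrightarrow> ray_cocharacter c \<in> carrier torus"
  by (simp add: torus_carrier ray_cocharacter_def pairing_add_right power_int_add)

lemma ray_cocharacter_root: "ray_cocharacter c e = inverse c"
  by (simp add: ray_cocharacter_def n_e power_int_minus)

lemma ray_cocharacter_nonneg: "pairing n m \<ge> 0 \<Longrightarrow> ray_cocharacter c m = c ^ nat (pairing n m)"
  by (simp add: ray_cocharacter_def power_int_def)

lemma torus_add_root:
  assumes "t \<in> carrier torus"
  shows "t (m + of_nat k *s e) = t m * t e ^ k"
  using assms by (simp add: torus_carrier torus_scale[OF assms])

text \<open>
  Here \<open>e\<close> annihilates \<open>\<sigma>\<close>, so all terms of the binomial expansion survive together or vanish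
  together.
\<close>
lemma shifted_character_orthogonal:
  assumes \<sigma>: "\<sigma> \<in> orthogonal_cones" and t: "t \<in> carrier torus" and m: "pairing n m \<ge> 0"
  shows "shifted_character s (face_character \<sigma> t) m =
    (if m \<in> annihilator \<sigma> then t m * (1 + s * t e) ^ nat (pairing n m) else 0)"
proof (cases "m \<in> annihilator \<sigma>")
  case True
  let ?j = "nat (pairing n m)"
  have "shifted_character s (face_character \<sigma> t) m =
      (\<Sum>k\<le>?j. t m * (of_nat (?j choose k) * (s * t e) ^ k * 1 ^ (?j - k)))"
    using True unfolding shifted_character_def
    by (intro sum.cong refl)
      (simp add: face_character_def annihilator_add_root[OF \<sigma>] torus_add_root[OF t] power_mult_distrib mult_ac)
  also have "\<dots> = t m * (s * t e + 1) ^ ?j"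
    by (simp add: binomial_ring sum_distrib_left)
  finally show ?thesis
    using True by (simp add: add.commute)
next
  case False
  then show ?thesis
    by (simp add: shifted_character_def face_character_def annihilator_add_root[OF \<sigma>])
qed

text \<open>
  The factor \<open>(1 + s * t e)\<^sup>j\<close> found above is a one-parameter subgroup if its base is nonzero.
  If the base is zero, the factor is \<open>1\<close> for \<open>j = 0\<close> and \<open>0\<close> otherwise: the nonvanishing
  monomials are cut down to those that annihilate \<open>\<rho>\<close>, and the point falls into the smaller
  orbit.
\<close>
lemma root_action_orthogonal:
  fixes t :: "int ^ 'n \<Rightarrow> 'k::{alg_closed_field, field_char_0}"
  assumes \<sigma>: "\<sigma> \<in> orthogonal_cones" and t: "t \<in> carrier torus"
  shows "root_action \<Sigma> e s (toric_pt \<Sigma> \<sigma> t) =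
    (if 1 + s * t e = 0 then toric_pt \<Sigma> (join_ray \<sigma>) t
     else toric_pt \<Sigma> \<sigma> (\<lambda>m. t m * ray_cocharacter (1 + s * t e) m))"
proof -
  have ex: "\<exists>\<tau>\<in>\<Sigma>. \<sigma> \<subseteq> \<tau> \<and> \<rho> \<subseteq> \<tau>"
    using join_ray_in[OF \<sigma>] subset_join_ray[of \<sigma>] by blast
  show ?thesis
  proof (cases "1 + s * t e = 0")
    case True
    have "root_action \<Sigma> e s (toric_pt \<Sigma> \<sigma> t) = toric_pt \<Sigma> (join_ray \<sigma>) t"
    proof (rule root_action_toric_pt[OF orthogonal_cones_subset[OF \<sigma>] t join_ray_in[OF \<sigma>] t ex])
      fix \<tau> assume \<tau>: "\<tau> \<in> \<Sigma>" "\<sigma> \<subseteq> \<tau>" "\<rho> \<subseteq> \<tau>"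
      then show "join_ray \<sigma> \<subseteq> \<tau>"
        by (rule join_ray_least)
      fix m assume "rat_vec m \<in> dual_cone \<tau>"
      then have "pairing n m \<ge> 0"
        using pairing_n_nonneg \<tau>(3) by blast
      then show "shifted_character s (face_character \<sigma> t) m = face_character (join_ray \<sigma>) t m"
        by (simp add: shifted_character_orthogonal[OF \<sigma> t] True face_character_def annihilator_join_ray)
    qed
    then show ?thesis
      using True by simp
  next
    case False
    have "root_action \<Sigma> e s (toric_pt \<Sigma> \<sigma> t) =
        toric_pt \<Sigma> \<sigma> (\<lambda>m. t m * ray_cocharacter (1 + s * t e) m)"
    proof (rule root_action_toric_pt[OF orthogonal_cones_subset[OF \<sigma>] t orthogonal_cones_subset[OF \<sigma>] _ ex])
      show "(\<lambda>m. t m * ray_cocharacter (1 + s * t e) m) \<in> carrier torus"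
        by (intro torus_mult t ray_cocharacter_torus False)
    next
      fix \<tau> m assume "\<rho> \<subseteq> \<tau>" "rat_vec m \<in> dual_cone \<tau>"
      then have "pairing n m \<ge> 0"
        by (rule pairing_n_nonneg)
      then show "shifted_character s (face_character \<sigma> t) m =
          face_character \<sigma> (\<lambda>m. t m * ray_cocharacter (1 + s * t e) m) m"
        by (simp add: shifted_character_orthogonal[OF \<sigma> t] face_character_def ray_cocharacter_nonneg)
    qed
    then show ?thesis
      using False by simp
  qed
qed

text \<open>
  A monomial \<open>m + k *s e\<close> annihilates \<open>n\<close> for \<open>k = j\<close> only, so that the leading term of the
  binomial expansion is the only one left.
\<close>
lemma shifted_character_join_ray:
  assumes \<sigma>: "\<sigma> \<in> orthogonal_cones" and t: "t \<in> carrier torus" and m: "pairing n m \<ge> 0"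
  shows "shifted_character s (face_character (join_ray \<sigma>) t) m =
    (if m \<in> annihilator \<sigma> then t m * (s * t e) ^ nat (pairing n m) else 0)"
proof -
  let ?j = "nat (pairing n m)"
  have ann: "m + of_nat k *s e \<in> annihilator (join_ray \<sigma>) \<longleftrightarrow> m \<in> annihilator \<sigma> \<and> k = ?j" for k
    using m unfolding annihilator_join_ray annihilator_add_root[OF \<sigma>]
    by (auto simp: pairing_simps n_e)
  have t_eq: "t (m + pairing n m *s e) = t m * t e ^ ?j"
    using torus_add_root[OF t, of m ?j] m by simp
  have "shifted_character s (face_character (join_ray \<sigma>) t) m =
      (\<Sum>k\<le>?j. if k = ?j then (if m \<in> annihilator \<sigma> then t m * (s * t e) ^ ?j else 0) else 0)"
    unfolding shifted_character_def
    by (intro sum.cong refl)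
      (use m in \<open>auto simp: face_character_def ann t_eq power_mult_distrib\<close>)
  then show ?thesis
    by (simp add: sum.delta)
qed

lemma root_action_join_ray:
  fixes t :: "int ^ 'n \<Rightarrow> 'k::{alg_closed_field, field_char_0}"
  assumes \<sigma>: "\<sigma> \<in> orthogonal_cones" and t: "t \<in> carrier torus"
  shows "root_action \<Sigma> e s (toric_pt \<Sigma> (join_ray \<sigma>) t) =
    (if s = 0 then toric_pt \<Sigma> (join_ray \<sigma>) t
     else toric_pt \<Sigma> \<sigma> (\<lambda>m. t m * ray_cocharacter (s * t e) m))"
proof -
  have ex: "\<exists>\<tau>\<in>\<Sigma>. join_ray \<sigma> \<subseteq> \<tau> \<and> \<rho> \<subseteq> \<tau>"
    using join_ray_in[OF \<sigma>] subset_join_ray[of \<sigma>] by blast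
  show ?thesis
  proof (cases "s = 0")
    case True
    have "root_action \<Sigma> e s (toric_pt \<Sigma> (join_ray \<sigma>) t) = toric_pt \<Sigma> (join_ray \<sigma>) t"
    proof (rule root_action_toric_pt[OF join_ray_in[OF \<sigma>] t join_ray_in[OF \<sigma>] t ex])
      fix \<tau> m assume "\<rho> \<subseteq> \<tau>" "rat_vec m \<in> dual_cone \<tau>"
      then have "pairing n m \<ge> 0"
        by (rule pairing_n_nonneg)
      then show "shifted_character s (face_character (join_ray \<sigma>) t) m =
          face_character (join_ray \<sigma>) t m"
        by (simp add: shifted_character_join_ray[OF \<sigma> t] True face_character_def annihilator_join_ray)
    qed
    then show ?thesis
      using True by simp
  next
    case False
    have "root_action \<Sigma> e s (toric_pt \<Sigma> (join_ray \<sigma>) t) =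
        toric_pt \<Sigma> \<sigma> (\<lambda>m. t m * ray_cocharacter (s * t e) m)"
    proof (rule root_action_toric_pt[OF join_ray_in[OF \<sigma>] t orthogonal_cones_subset[OF \<sigma>] _ ex])
      show "(\<lambda>m. t m * ray_cocharacter (s * t e) m) \<in> carrier torus"
        using False torus_nonzero[OF t] by (intro torus_mult t ray_cocharacter_torus) simp
    next
      fix \<tau> assume "join_ray \<sigma> \<subseteq> \<tau>"
      then show "\<sigma> \<subseteq> \<tau>"
        using subset_join_ray(1) by blast
    next
      fix \<tau> m assume "\<rho> \<subseteq> \<tau>" "rat_vec m \<in> dual_cone \<tau>"
      then have "pairing n m \<ge> 0"
        by (rule pairing_n_nonneg)
      then show "shifted_character s (face_character (join_ray \<sigma>) t) m =
          face_character \<sigma> (\<lambda>m. t m * ray_cocharacter (s * t e) m) m"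
        by (simp add: shifted_character_join_ray[OF \<sigma> t] face_character_def ray_cocharacter_nonneg)
    qed
    then show ?thesis
      using False by simp
  qed
qed

text \<open>
  If \<open>e\<close> is nowhere positive on \<open>\<sigma>\<close>, it vanishes on the generators of \<open>\<sigma>\<close> outside \<open>\<rho>\<close>. If it
  vanishes on \<open>\<sigma>\<close>, then \<open>\<sigma>\<close> is the smaller cone of a pair. Otherwise \<open>\<sigma>\<close> contains \<open>\<rho>\<close>, and \<open>\<sigma>\<close>
  is the larger cone of the pair of its face on which \<open>e\<close> vanishes.
\<close>
lemma root_positive_on_unpaired_cone:
  assumes \<sigma>: "\<sigma> \<in> \<Sigma>" and unpaired: "\<sigma> \<notin> orthogonal_cones" "\<sigma> \<notin> join_ray ` orthogonal_cones"
  obtains v where "v \<in> \<sigma>" "pairing v (rat_vec e) > 0"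
proof (rule ccontr)
  assume "\<not> thesis"
  then have nonpos: "pairing v (rat_vec e) \<le> 0" if "v \<in> \<sigma>" for v
    using that \<open>\<And>v. v \<in> \<sigma> \<Longrightarrow> pairing v (rat_vec e) > 0 \<Longrightarrow> thesis\<close> by force
  obtain V where V: "finite V" "\<sigma> = cone_gen V"
    "\<And>v. v \<in> V \<Longrightarrow> v \<in> \<rho> \<or> pairing v (rat_vec e) \<ge> 0"
    using cone_generators[OF \<sigma>] by blast
  have V_sub: "V \<subseteq> \<sigma>"
    unfolding V(2) by (rule cone_gen_superset)
  have "\<exists>v\<in>V. pairing v (rat_vec e) \<noteq> 0"
    using unpaired(1) \<sigma> unfolding orthogonal_cones_def annihilator_def
    by (simp only: V(2) mem_Collect_eq orthogonal_cone_gen) blast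
  then obtain v where v: "v \<in> V" "pairing v (rat_vec e) < 0"
    using nonpos V_sub by force
  then have "v \<in> \<rho>"
    using V(3) by force
  then obtain a where a: "a \<ge> 0" "v = a *s rat_vec n"
    unfolding rho_generated cone_gen_singleton by blast
  have "a > 0"
    using v(2) a by (cases "a = 0") auto
  have "rat_vec n = (1 / a) *s v"
    using \<open>a > 0\<close> by (simp add: a(2))
  also have "\<dots> \<in> \<sigma>"
    using v(1) V_sub \<open>a > 0\<close> unfolding V(2) by (intro cone_gen_scale) auto
  finally have \<rho>_sub: "\<rho> \<subseteq> \<sigma>"
    unfolding rho_generated V(2) by (simp add: cone_gen_subset)
  define \<sigma>0 where "\<sigma>0 = {x\<in>\<sigma>. pairing x (- rat_vec e) = 0}"
  have "- rat_vec e \<in> dual_cone \<sigma>"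
    using nonpos by (simp add: dual_cone_def pairing_minus_right)
  then have "cone_face \<sigma>0 \<sigma>"
    unfolding cone_face_def \<sigma>0_def by blast
  then have "\<sigma>0 \<in> orthogonal_cones"
    using fan_face[OF fan \<sigma>] by (auto simp: orthogonal_cones_def annihilator_def \<sigma>0_def pairing_minus_right)
  moreover have "join_ray \<sigma>0 = \<sigma>"
  proof (rule antisym)
    show "join_ray \<sigma>0 \<subseteq> \<sigma>"
      using \<rho>_sub by (intro join_ray_least \<sigma>) (auto simp: \<sigma>0_def)
    have "V \<subseteq> \<sigma>0 \<union> \<rho>"
      using V(3) V_sub nonpos by (force simp: \<sigma>0_def pairing_minus_right)
    then show "\<sigma> \<subseteq> join_ray \<sigma>0"
      unfolding V(2) join_ray_def by (rule cone_gen_mono)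
  qed
  ultimately show False
    using unpaired(2) by blast
qed

text \<open>
  At a vector of \<open>\<sigma>\<close> where \<open>e\<close> is positive, adding \<open>e\<close> to a monomial of the chart gives a
  positive value, so that only the constant term of the binomial expansion is nonzero at the
  point.
\<close>
lemma root_action_unpaired:
  fixes t :: "int ^ 'n \<Rightarrow> 'k::{alg_closed_field, field_char_0}"
  assumes \<sigma>: "\<sigma> \<in> \<Sigma>" and unpaired: "\<sigma> \<notin> orthogonal_cones" "\<sigma> \<notin> join_ray ` orthogonal_cones"
    and t: "t \<in> carrier torus"
  shows "root_action \<Sigma> e s (toric_pt \<Sigma> \<sigma> t) = toric_pt \<Sigma> \<sigma> t"
proof (cases "\<exists>\<tau>\<in>\<Sigma>. \<sigma> \<subseteq> \<tau> \<and> \<rho> \<subseteq> \<tau>")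
  case True
  obtain v where v: "v \<in> \<sigma>" "pairing v (rat_vec e) > 0"
    using root_positive_on_unpaired_cone[OF \<sigma> unpaired] .
  show ?thesis
  proof (rule root_action_toric_pt[OF \<sigma> t \<sigma> t True])
    fix \<tau> m assume \<tau>: "\<sigma> \<subseteq> \<tau>" and m: "rat_vec m \<in> dual_cone \<tau>"
    have "k = 0" if "m + of_nat k *s e \<in> annihilator \<sigma>" for k
    proof -
      have "pairing v (rat_vec m) + of_nat k * pairing v (rat_vec e) = 0"
        using that v(1) by (auto simp: annihilator_def rat_vec_add rat_vec_scale pairing_simps)
      moreover have "pairing v (rat_vec m) \<ge> 0"
        using m v(1) \<tau> unfolding dual_cone_def by blast
      ultimately have "of_nat k * pairing v (rat_vec e) \<le> 0"
        by linarith
      then show ?thesis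
        using v(2) by (simp add: mult_le_0_iff)
    qed
    then have zero: "face_character \<sigma> t (m + of_nat k *s e) = 0" if "k \<noteq> 0" for k
      using that by (auto simp: face_character_def)
    let ?j = "nat (pairing n m)"
    have "shifted_character s (face_character \<sigma> t) m =
        (\<Sum>k\<le>?j. if k = 0 then face_character \<sigma> t m else 0)"
      unfolding shifted_character_def using zero by (intro sum.cong refl) auto
    then show "shifted_character s (face_character \<sigma> t) m = face_character \<sigma> t m"
      by (simp add: sum.delta)
  qed
next
  case False
  then show ?thesis
    by (rule root_action_outside[OF \<sigma> t])
qed

end

section \<open>Closures of torus orbits\<close>

lemma openin_zariski: "openin (zariski \<Sigma>) U \<longleftrightarrow> zariski_open \<Sigma> U"
  unfolding zariski_def using topology_inverse'[OF istopology_zariski_open] by metis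

lemma topspace_zariski: "topspace (zariski \<Sigma> :: ('k::field, 'n::finite) toric_point topology) = toric_variety \<Sigma>"
proof -
  have "zariski_open \<Sigma> (toric_variety \<Sigma> :: ('k, 'n) toric_point set)"
    unfolding zariski_open_def
  proof (intro conjI ballI subset_refl)
    fix \<sigma> assume \<sigma>: "\<sigma> \<in> \<Sigma>"
    have "glue \<Sigma> `` {(\<sigma>, x)} \<in> toric_variety \<Sigma>" if "x \<in> chart \<sigma>" for x :: "((int ^ 'n) \<Rightarrow>\<^sub>0 'k) \<Rightarrow> 'k"
      unfolding toric_variety_def using \<sigma> that by (intro quotientI) blast
    moreover have "x (Poly_Mapping.single 0 1) \<noteq> 0" if "x \<in> chart \<sigma>" for x :: "((int ^ 'n) \<Rightarrow>\<^sub>0 'k) \<Rightarrow> 'k"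
      using chartD(2)[OF that, of 1] by simp
    ultimately have "{x\<in>chart \<sigma>. glue \<Sigma> `` {(\<sigma>, x)} \<in> (toric_variety \<Sigma> :: ('k, 'n) toric_point set)} =
        {x\<in>chart \<sigma>. \<exists>f\<in>{Poly_Mapping.single 0 1}. x f \<noteq> 0}"
      by blast
    moreover have "{Poly_Mapping.single 0 1} \<subseteq> (chart_ring \<sigma> :: ((int ^ 'n) \<Rightarrow>\<^sub>0 'k) set)"
      using chart_ring_single[of 0 \<sigma> "1 :: 'k"] by simp
    ultimately show "chart_open \<sigma> {x\<in>chart \<sigma>. glue \<Sigma> `` {(\<sigma>, x)} \<in> (toric_variety \<Sigma> :: ('k, 'n) toric_point set)}"
      unfolding chart_open_def by blast
  qed
  moreover have "U \<subseteq> toric_variety \<Sigma>" if "zariski_open \<Sigma> U" for U :: "('k, 'n) toric_point set"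
    using that unfolding zariski_open_def by blast
  ultimately show ?thesis
    unfolding topspace_def openin_zariski by blast
qed

context rooted_fan
begin

text \<open>
  Moving a point of the larger orbit by the one-parameter subgroup \<open>n\<close> at \<open>c\<close> and letting \<open>c\<close>
  tend to \<open>0\<close> leads to the smaller orbit. Algebraically, the value of a regular function along
  this curve is a polynomial in \<open>c\<close>; if it is nonzero at \<open>0\<close>, it is nonzero at some \<open>c \<noteq> 0\<close>, as
  the field is infinite.
\<close>
lemma join_ray_orbit_in_closure:
  assumes \<sigma>: "\<sigma> \<in> orthogonal_cones"
  shows "(cone_orbit \<Sigma> (join_ray \<sigma>) :: ('k::{alg_closed_field, field_char_0}, 'n) toric_point set) \<subseteq>
    (zariski \<Sigma>) closure_of (cone_orbit \<Sigma> \<sigma>)"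
proof
  fix P :: "('k, 'n) toric_point" assume "P \<in> cone_orbit \<Sigma> (join_ray \<sigma>)"
  then obtain t where t: "t \<in> carrier torus" and P: "P = toric_pt \<Sigma> (join_ray \<sigma>) t"
    unfolding cone_orbit_def by blast
  let ?\<tau> = "join_ray \<sigma>"
  note \<tau> = join_ray_in[OF \<sigma>]
  have "\<exists>Q. Q \<in> cone_orbit \<Sigma> \<sigma> \<and> Q \<in> U" if U: "P \<in> U" "zariski_open \<Sigma> U" for U
  proof -
    obtain I where I: "I \<subseteq> chart_ring ?\<tau>"
      "{x\<in>chart ?\<tau>. glue \<Sigma> `` {(?\<tau>, x)} \<in> U} = {x\<in>chart ?\<tau>. \<exists>f\<in>I. x f \<noteq> 0}"
      using U(2) \<tau> unfolding zariski_open_def chart_open_def by blast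
    have "chart_eval ?\<tau> (face_character ?\<tau> t) \<in> {x\<in>chart ?\<tau>. glue \<Sigma> `` {(?\<tau>, x)} \<in> U}"
      using U(1) chart_eval_in_chart[OF t subset_refl[of ?\<tau>]] glue_class[OF fan \<tau> \<tau> subset_refl t]
      by (simp add: P)
    then obtain f where f: "f \<in> I" "chart_eval ?\<tau> (face_character ?\<tau> t) f \<noteq> 0"
      unfolding I(2) by blast
    then have f_in: "f \<in> chart_ring ?\<tau>"
      using I(1) by blast
    have nonneg: "pairing n m \<ge> 0" if "m \<in> Poly_Mapping.keys f" for m
      using chart_ring_pairing_nonneg[OF f_in subset_join_ray(2) that] .
    define p where "p = (\<Sum>m\<in>Poly_Mapping.keys f.
      monom (Poly_Mapping.lookup f m * face_character \<sigma> t m) (nat (pairing n m)))"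
    have poly_p: "poly p c = pm_eval (\<lambda>m. face_character \<sigma> t m * c ^ nat (pairing n m)) f" for c
      unfolding p_def pm_eval_def by (simp add: poly_sum poly_monom mult.assoc)
    \<comment> \<open>At \<open>c = 0\<close> the monomials that pair to \<open>0\<close> with \<open>n\<close> remain.\<close>
    have "poly p 0 = pm_eval (face_character ?\<tau> t) f"
      unfolding poly_p using nonneg
      by (intro pm_eval_cong) (force simp: face_character_def annihilator_join_ray power_0_left)
    also have "\<dots> \<noteq> 0"
      using f f_in by (simp add: chart_eval_def)
    finally have "p \<noteq> 0"
      by auto
    then have "finite (insert 0 {c. poly p c = 0})"
      by (simp add: poly_roots_finite)
    then obtain c where c: "c \<noteq> 0" "poly p c \<noteq> 0"
      using ex_new_if_finite[OF infinite_UNIV_char_0] by blast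
    define t' where "t' = (\<lambda>m. t m * ray_cocharacter c m)"
    have t': "t' \<in> carrier torus"
      unfolding t'_def by (intro torus_mult t ray_cocharacter_torus c(1))
    have "poly p c = pm_eval (face_character \<sigma> t') f"
      unfolding poly_p t'_def using nonneg
      by (intro pm_eval_cong) (simp add: face_character_def ray_cocharacter_nonneg)
    then have "chart_eval ?\<tau> (face_character \<sigma> t') f \<noteq> 0"
      using c(2) f_in by (simp add: chart_eval_def)
    then have "chart_eval ?\<tau> (face_character \<sigma> t') \<in> {x\<in>chart ?\<tau>. \<exists>f\<in>I. x f \<noteq> 0}"
      using f(1) chart_eval_in_chart[OF t' subset_join_ray(1)] by blast
    then have "toric_pt \<Sigma> \<sigma> t' \<in> U"
      unfolding I(2)[symmetric]
      using glue_class[OF fan orthogonal_cones_subset[OF \<sigma>] \<tau> subset_join_ray(1) t'] by simp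
    then show ?thesis
      unfolding cone_orbit_def using t' by blast
  qed
  moreover have "P \<in> toric_variety \<Sigma>"
    unfolding toric_variety_eq[OF fan] P using \<tau> t by blast
  ultimately show "P \<in> (zariski \<Sigma>) closure_of (cone_orbit \<Sigma> \<sigma>)"
    unfolding in_closure_of topspace_zariski openin_zariski by blast
qed

section \<open>Orbits of the extended group\<close>

lemma embedding_orbit_iff:
  fixes t :: "int ^ 'n \<Rightarrow> 'k::{alg_closed_field, field_char_0}"
  assumes \<sigma>: "\<sigma> \<in> \<Sigma>" and t: "t \<in> carrier torus"
  shows "Q \<in> orbit (embedding_group e) (embedding_action \<Sigma> e) (toric_pt \<Sigma> \<sigma> t) \<longleftrightarrow>
    (\<exists>t' s. t' \<in> carrier torus \<and> t' e = 1 \<and>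
      Q = torus_action \<Sigma> t' (root_action \<Sigma> e s (toric_pt \<Sigma> \<sigma> t)))"
proof -
  have "toric_pt \<Sigma> \<sigma> t \<in> toric_variety \<Sigma>"
    unfolding toric_variety_eq[OF fan] using \<sigma> t by blast
  moreover have "g \<in> carrier (embedding_group e) \<longleftrightarrow> fst g \<in> carrier torus \<and> fst g e = 1"
    for g :: "(int ^ 'n \<Rightarrow> 'k) \<times> 'k"
    by (cases g) (simp add: embedding_group_def root_kernel_def additive_group_def DirProd_def)
  ultimately show ?thesis
    unfolding orbit_def embedding_action_def by auto
qed

text \<open>
  The kernel of \<open>e\<close> is already transitive on the torus orbit: a torus element can be corrected,
  without changing its effect on the orbit, by a one-parameter subgroup in the span of \<open>\<sigma>\<close> on
  which \<open>e\<close> is not zero, and this adjusts its value at \<open>e\<close> to \<open>1\<close>.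
\<close>
lemma embedding_orbit_unpaired:
  fixes t :: "int ^ 'n \<Rightarrow> 'k::{alg_closed_field, field_char_0}"
  assumes \<sigma>: "\<sigma> \<in> \<Sigma>" and unpaired: "\<sigma> \<notin> orthogonal_cones" "\<sigma> \<notin> join_ray ` orthogonal_cones"
    and t: "t \<in> carrier torus"
  shows "orbit (embedding_group e) (embedding_action \<Sigma> e) (toric_pt \<Sigma> \<sigma> t) = cone_orbit \<Sigma> \<sigma>"
proof (intro Set.set_eqI iffI)
  fix Q assume "Q \<in> orbit (embedding_group e) (embedding_action \<Sigma> e) (toric_pt \<Sigma> \<sigma> t)"
  then obtain t' where "t' \<in> carrier torus" "Q = toric_pt \<Sigma> \<sigma> (\<lambda>m. t' m * t m)"
    unfolding embedding_orbit_iff[OF \<sigma> t] root_action_unpaired[OF \<sigma> unpaired t]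
      torus_action_toric_pt[OF fan \<sigma> t] by blast
  then show "Q \<in> cone_orbit \<Sigma> \<sigma>"
    unfolding cone_orbit_def using torus_mult[OF _ t] by blast
next
  fix Q :: "('k, 'n) toric_point" assume "Q \<in> cone_orbit \<Sigma> \<sigma>"
  then obtain t1 where t1: "t1 \<in> carrier torus" and Q: "Q = toric_pt \<Sigma> \<sigma> t1"
    unfolding cone_orbit_def by blast
  obtain v where v: "v \<in> \<sigma>" "pairing v (rat_vec e) > 0"
    using root_positive_on_unpaired_cone[OF \<sigma> unpaired] .
  obtain q :: int and w where q: "q > 0" "rat_vec w = of_int q *s v"
    using rat_vec_multiple_exists .
  have "of_int (pairing w e) = of_int q * pairing v (rat_vec e)"
    using q(2) by (metis pairing_rat_vec pairing_scale_left)
  then have pos: "pairing w e > 0"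
    using q(1) v(2) by (metis of_int_0_less_iff zero_less_mult_iff)
  have ann: "pairing w m = 0" if "m \<in> annihilator \<sigma>" for m
  proof -
    have "of_int (pairing w m) = of_int q * pairing v (rat_vec m)"
      using q(2) by (metis pairing_rat_vec pairing_scale_left)
    also have "pairing v (rat_vec m) = 0"
      using that v(1) unfolding annihilator_def by blast
    finally show ?thesis by simp
  qed
  obtain c where c: "c ^ nat (pairing w e) = t e / t1 e"
    using nth_root_exists[of "nat (pairing w e)" "t e / t1 e"] pos by auto
  have "c \<noteq> 0"
    using c torus_nonzero[OF t] torus_nonzero[OF t1] pos by (auto simp: power_0_left)
  define l where "l m = c powi pairing w m" for m
  have l: "l \<in> carrier torus"
    unfolding l_def torus_carrier using \<open>c \<noteq> 0\<close> by (simp add: pairing_add_right power_int_add)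
  define t' where "t' m = t1 m / t m * l m" for m
  have t': "t' \<in> carrier torus"
    unfolding t'_def by (intro torus_mult torus_divide t t1 l)
  have "l e = t e / t1 e"
    using c pos by (simp add: l_def power_int_def)
  then have "t' e = 1"
    using torus_nonzero[OF t] torus_nonzero[OF t1] by (simp add: t'_def)
  moreover have "toric_pt \<Sigma> \<sigma> (\<lambda>m. t' m * t m) = Q"
    unfolding Q toric_pt_eq_iff[OF fan \<sigma> \<sigma> torus_mult[OF t' t] t1]
    using torus_nonzero[OF t] by (simp add: t'_def l_def ann)
  ultimately show "Q \<in> orbit (embedding_group e) (embedding_action \<Sigma> e) (toric_pt \<Sigma> \<sigma> t)"
    unfolding embedding_orbit_iff[OF \<sigma> t] root_action_unpaired[OF \<sigma> unpaired t]
      torus_action_toric_pt[OF fan \<sigma> t] using t' by blast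
qed

lemma root_action_in_paired_orbits:
  fixes t :: "int ^ 'n \<Rightarrow> 'k::{alg_closed_field, field_char_0}"
  assumes \<sigma>: "\<sigma> \<in> orthogonal_cones" and \<tau>: "\<tau> = \<sigma> \<or> \<tau> = join_ray \<sigma>" and t: "t \<in> carrier torus"
  shows "root_action \<Sigma> e s (toric_pt \<Sigma> \<tau> t) \<in> cone_orbit \<Sigma> \<sigma> \<union> cone_orbit \<Sigma> (join_ray \<sigma>)"
proof -
  have "(\<lambda>m. t m * ray_cocharacter (1 + s * t e) m) \<in> carrier torus" if "1 + s * t e \<noteq> 0"
    using that by (intro torus_mult t ray_cocharacter_torus)
  moreover have "(\<lambda>m. t m * ray_cocharacter (s * t e) m) \<in> carrier torus" if "s \<noteq> 0"
    using that torus_nonzero[OF t] by (intro torus_mult t ray_cocharacter_torus) simp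
  ultimately show ?thesis
    using \<tau> t by (auto simp: root_action_orthogonal[OF \<sigma> t] root_action_join_ray[OF \<sigma> t] cone_orbit_def)
qed

lemma cone_orbit_torus_action:
  fixes t' :: "int ^ 'n \<Rightarrow> 'k::{alg_closed_field, field_char_0}"
  assumes "\<sigma> \<in> \<Sigma>" "P \<in> cone_orbit \<Sigma> \<sigma>" "t' \<in> carrier torus"
  shows "torus_action \<Sigma> t' P \<in> cone_orbit \<Sigma> \<sigma>"
proof -
  obtain t where t: "t \<in> carrier torus" "P = toric_pt \<Sigma> \<sigma> t"
    using assms(2) unfolding cone_orbit_def by blast
  show ?thesis
    unfolding t(2) torus_action_toric_pt[OF fan assms(1) t(1)] cone_orbit_def
    by (intro imageI torus_mult assms(3) t(1))
qed

text \<open>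
  Both orbits of a pair are reached from any point of either one. On the larger orbit the kernel
  of \<open>e\<close> preserves the value of \<open>t\<close> at \<open>e\<close>, but the root subgroup takes it to any other nonzero
  value. On the smaller orbit the one-parameter subgroup \<open>n\<close> acts trivially and can be used to
  correct the value at \<open>e\<close>.
\<close>
lemma embedding_orbit_paired:
  fixes t :: "int ^ 'n \<Rightarrow> 'k::{alg_closed_field, field_char_0}"
  assumes \<sigma>: "\<sigma> \<in> orthogonal_cones" and \<tau>: "\<tau> = \<sigma> \<or> \<tau> = join_ray \<sigma>" and t: "t \<in> carrier torus"
  shows "orbit (embedding_group e) (embedding_action \<Sigma> e) (toric_pt \<Sigma> \<tau> t) =
    cone_orbit \<Sigma> \<sigma> \<union> cone_orbit \<Sigma> (join_ray \<sigma>)" (is "?orbit = _")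
proof (rule antisym)
  note in_\<Sigma> = orthogonal_cones_subset[OF \<sigma>] join_ray_in[OF \<sigma>]
  have \<tau>_in: "\<tau> \<in> \<Sigma>"
    using \<tau> in_\<Sigma> by blast
  note orbit_iff = embedding_orbit_iff[OF \<tau>_in t]
  have te: "t e \<noteq> 0"
    by (rule torus_nonzero[OF t])
  show "?orbit \<subseteq> cone_orbit \<Sigma> \<sigma> \<union> cone_orbit \<Sigma> (join_ray \<sigma>)"
  proof
    fix Q assume "Q \<in> ?orbit"
    then obtain t' s where "t' \<in> carrier torus"
      "Q = torus_action \<Sigma> t' (root_action \<Sigma> e s (toric_pt \<Sigma> \<tau> t))"
      unfolding orbit_iff by blast
    then show "Q \<in> cone_orbit \<Sigma> \<sigma> \<union> cone_orbit \<Sigma> (join_ray \<sigma>)"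
      using root_action_in_paired_orbits[OF \<sigma> \<tau> t, of s] cone_orbit_torus_action in_\<Sigma> by blast
  qed
  have hits_orthogonal: "toric_pt \<Sigma> \<sigma> t1 \<in> ?orbit" if t1: "t1 \<in> carrier torus" for t1
  proof -
    have t1e: "t1 e \<noteq> 0"
      by (rule torus_nonzero[OF t1])
    \<comment> \<open>The value of \<open>ray_cocharacter c\<close> at \<open>e\<close> is \<open>1 / c\<close>, so this \<open>c\<close> takes the value \<open>t e\<close> to
      \<open>t1 e\<close>; the witness \<open>s\<close> solves \<open>1 + s * t e = c\<close> or \<open>s * t e = c\<close>.\<close>
    have "\<exists>s c. c \<noteq> 0 \<and> c = t e / t1 e \<and>
        root_action \<Sigma> e s (toric_pt \<Sigma> \<tau> t) = toric_pt \<Sigma> \<sigma> (\<lambda>m. t m * ray_cocharacter c m)"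
      using \<tau>
    proof
      assume "\<tau> = \<sigma>"
      then show ?thesis
        using te t1e root_action_orthogonal[OF \<sigma> t, of "1 / t1 e - 1 / t e"]
        by (intro exI[of _ "1 / t1 e - 1 / t e"] exI[of _ "t e / t1 e"]) (simp add: field_simps)
    next
      assume "\<tau> = join_ray \<sigma>"
      then show ?thesis
        using te t1e root_action_join_ray[OF \<sigma> t, of "1 / t1 e"]
        by (intro exI[of _ "1 / t1 e"] exI[of _ "t e / t1 e"]) (simp add: field_simps)
    qed
    then obtain s c where c: "c \<noteq> 0" "c = t e / t1 e"
      and s: "root_action \<Sigma> e s (toric_pt \<Sigma> \<tau> t) = toric_pt \<Sigma> \<sigma> (\<lambda>m. t m * ray_cocharacter c m)"
      by blast
    define t2 where "t2 = (\<lambda>m. t m * ray_cocharacter c m)"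
    have t2: "t2 \<in> carrier torus"
      unfolding t2_def by (intro torus_mult t ray_cocharacter_torus c(1))
    have t2e: "t2 e = t1 e"
      using te by (simp add: t2_def ray_cocharacter_root c(2))
    have "toric_pt \<Sigma> \<sigma> t1 = torus_action \<Sigma> (\<lambda>m. t1 m / t2 m) (root_action \<Sigma> e s (toric_pt \<Sigma> \<tau> t))"
      using torus_action_toric_pt[OF fan in_\<Sigma>(1) t2, of "\<lambda>m. t1 m / t2 m"] torus_nonzero[OF t2]
      unfolding s t2_def[symmetric] by simp
    moreover have "t1 e / t2 e = 1"
      using t2e t1e by simp
    ultimately show ?thesis
      unfolding orbit_iff using torus_divide[OF t1 t2] by blast
  qed
  have hits_join: "toric_pt \<Sigma> (join_ray \<sigma>) t1 \<in> ?orbit" if t1: "t1 \<in> carrier torus" for t1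
  proof -
    have t1e: "t1 e \<noteq> 0"
      by (rule torus_nonzero[OF t1])
    have "\<exists>s. root_action \<Sigma> e s (toric_pt \<Sigma> \<tau> t) = toric_pt \<Sigma> (join_ray \<sigma>) t"
      using \<tau>
    proof
      assume "\<tau> = \<sigma>"
      then show ?thesis
        using te root_action_orthogonal[OF \<sigma> t, of "- 1 / t e"] by auto
    next
      assume "\<tau> = join_ray \<sigma>"
      then show ?thesis
        using root_action_join_ray[OF \<sigma> t, of 0] by auto
    qed
    then obtain s where s: "root_action \<Sigma> e s (toric_pt \<Sigma> \<tau> t) = toric_pt \<Sigma> (join_ray \<sigma>) t" ..
    define c where "c = t1 e / t e"
    have "c \<noteq> 0"
      using te t1e by (simp add: c_def)
    define t' where "t' = (\<lambda>m. t1 m / t m * ray_cocharacter c m)"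
    have t': "t' \<in> carrier torus"
      unfolding t'_def by (intro torus_mult torus_divide t t1 ray_cocharacter_torus \<open>c \<noteq> 0\<close>)
    have "t' e = 1"
      using te t1e by (simp add: t'_def ray_cocharacter_root c_def)
    moreover have "toric_pt \<Sigma> (join_ray \<sigma>) t1 = torus_action \<Sigma> t' (toric_pt \<Sigma> (join_ray \<sigma>) t)"
      unfolding torus_action_toric_pt[OF fan in_\<Sigma>(2) t]
        toric_pt_eq_iff[OF fan in_\<Sigma>(2) in_\<Sigma>(2) t1 torus_mult[OF t' t]]
      using torus_nonzero[OF t] by (simp add: t'_def ray_cocharacter_def annihilator_join_ray)
    ultimately show ?thesis
      unfolding orbit_iff using t' s by metis
  qed
  show "cone_orbit \<Sigma> \<sigma> \<union> cone_orbit \<Sigma> (join_ray \<sigma>) \<subseteq> ?orbit"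
    unfolding cone_orbit_def using hits_orthogonal hits_join by blast
qed

lemma embedding_orbits_eq:
  "(embedding_orbits \<Sigma> e :: ('k::{alg_closed_field, field_char_0}, 'n) toric_point set set) =
    (\<lambda>\<sigma>. cone_orbit \<Sigma> \<sigma> \<union> cone_orbit \<Sigma> (join_ray \<sigma>)) ` orthogonal_cones \<union>
    cone_orbit \<Sigma> ` (\<Sigma> - orthogonal_cones - join_ray ` orthogonal_cones)"
  (is "_ = ?pairs \<union> ?singles")
proof (intro equalityI subsetI)
  fix Y :: "('k, 'n) toric_point set" assume "Y \<in> embedding_orbits \<Sigma> e"
  then obtain \<tau> t where \<tau>: "\<tau> \<in> \<Sigma>" and t: "t \<in> carrier torus"
    and Y: "Y = orbit (embedding_group e) (embedding_action \<Sigma> e) (toric_pt \<Sigma> \<tau> t)"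
    unfolding embedding_orbits_def orbits_def toric_variety_eq[OF fan] by blast
  show "Y \<in> ?pairs \<union> ?singles"
  proof (cases "\<tau> \<in> orthogonal_cones \<or> \<tau> \<in> join_ray ` orthogonal_cones")
    case True
    then obtain \<sigma> where "\<sigma> \<in> orthogonal_cones" "\<tau> = \<sigma> \<or> \<tau> = join_ray \<sigma>"
      by blast
    then show ?thesis
      unfolding Y using embedding_orbit_paired[OF _ _ t] by blast
  next
    case False
    then show ?thesis
      unfolding Y using embedding_orbit_unpaired[OF \<tau> _ _ t] \<tau> by blast
  qed
next
  have orbit_in: "orbit (embedding_group e) (embedding_action \<Sigma> e) (toric_pt \<Sigma> \<tau> (\<lambda>_. 1 :: 'k))
      \<in> embedding_orbits \<Sigma> e" if "\<tau> \<in> \<Sigma>" for \<tau>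
    unfolding embedding_orbits_def orbits_def toric_variety_eq[OF fan] using that torus_one by blast
  fix Y :: "('k, 'n) toric_point set" assume "Y \<in> ?pairs \<union> ?singles"
  then show "Y \<in> embedding_orbits \<Sigma> e"
  proof
    assume "Y \<in> ?pairs"
    then obtain \<sigma> where \<sigma>: "\<sigma> \<in> orthogonal_cones" and Y: "Y = cone_orbit \<Sigma> \<sigma> \<union> cone_orbit \<Sigma> (join_ray \<sigma>)"
      by blast
    have "orbit (embedding_group e) (embedding_action \<Sigma> e) (toric_pt \<Sigma> \<sigma> (\<lambda>_. 1 :: 'k)) = Y"
      unfolding Y by (rule embedding_orbit_paired[OF \<sigma> _ torus_one]) simp
    then show ?thesis
      using orbit_in[OF orthogonal_cones_subset[OF \<sigma>]] by simp
  next
    assume "Y \<in> ?singles"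
    then obtain \<sigma> where \<sigma>: "\<sigma> \<in> \<Sigma>" "\<sigma> \<notin> orthogonal_cones" "\<sigma> \<notin> join_ray ` orthogonal_cones"
      and Y: "Y = cone_orbit \<Sigma> \<sigma>"
      by blast
    have "orbit (embedding_group e) (embedding_action \<Sigma> e) (toric_pt \<Sigma> \<sigma> (\<lambda>_. 1 :: 'k)) = Y"
      unfolding Y by (rule embedding_orbit_unpaired[OF \<sigma> torus_one])
    then show ?thesis
      using orbit_in[OF \<sigma>(1)] by simp
  qed
qed

lemma root_orbit_eq:
  "orbit additive_group (root_action \<Sigma> e) P = range (\<lambda>s. root_action \<Sigma> e s P)"
  by (auto simp: orbit_def additive_group_def)

text \<open>
  So the root subgroup orbits that are not points determine the pair of cones.
\<close>
lemma root_orbit_meets_both: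
  fixes t :: "int ^ 'n \<Rightarrow> 'k::{alg_closed_field, field_char_0}"
  assumes \<sigma>: "\<sigma> \<in> orthogonal_cones" and \<tau>: "\<tau> = \<sigma> \<or> \<tau> = join_ray \<sigma>" and t: "t \<in> carrier torus"
  shows "\<exists>s. root_action \<Sigma> e s (toric_pt \<Sigma> \<tau> t) \<in> cone_orbit \<Sigma> \<sigma>"
    and "\<exists>s. root_action \<Sigma> e s (toric_pt \<Sigma> \<tau> t) \<in> cone_orbit \<Sigma> (join_ray \<sigma>)"
proof -
  have te: "t e \<noteq> 0"
    by (rule torus_nonzero[OF t])
  have cochar: "toric_pt \<Sigma> \<sigma> (\<lambda>m. t m * ray_cocharacter c m) \<in> cone_orbit \<Sigma> \<sigma>" if "c \<noteq> 0" for c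
    unfolding cone_orbit_def by (intro imageI torus_mult t ray_cocharacter_torus that)
  have self: "toric_pt \<Sigma> (join_ray \<sigma>) t \<in> cone_orbit \<Sigma> (join_ray \<sigma>)"
    unfolding cone_orbit_def using t by blast
  have *: "root_action \<Sigma> e 0 (toric_pt \<Sigma> \<sigma> t) \<in> cone_orbit \<Sigma> \<sigma>"
    using cochar[of 1] by (simp add: root_action_orthogonal[OF \<sigma> t])
  have **: "root_action \<Sigma> e 1 (toric_pt \<Sigma> (join_ray \<sigma>) t) \<in> cone_orbit \<Sigma> \<sigma>"
    using cochar[of "t e"] te by (simp add: root_action_join_ray[OF \<sigma> t])
  show "\<exists>s. root_action \<Sigma> e s (toric_pt \<Sigma> \<tau> t) \<in> cone_orbit \<Sigma> \<sigma>"
    using \<tau> * ** by blast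
  have *: "root_action \<Sigma> e (- 1 / t e) (toric_pt \<Sigma> \<sigma> t) \<in> cone_orbit \<Sigma> (join_ray \<sigma>)"
    using self te by (simp add: root_action_orthogonal[OF \<sigma> t])
  have **: "root_action \<Sigma> e 0 (toric_pt \<Sigma> (join_ray \<sigma>) t) \<in> cone_orbit \<Sigma> (join_ray \<sigma>)"
    using self by (simp add: root_action_join_ray[OF \<sigma> t])
  show "\<exists>s. root_action \<Sigma> e s (toric_pt \<Sigma> \<tau> t) \<in> cone_orbit \<Sigma> (join_ray \<sigma>)"
    using \<tau> * ** by blast
qed

lemma root_connected_join_ray:
  assumes \<sigma>: "\<sigma> \<in> orthogonal_cones"
  shows "root_connected \<Sigma> e
    (cone_orbit \<Sigma> \<sigma> :: ('k::{alg_closed_field, field_char_0}, 'n) toric_point set) (cone_orbit \<Sigma> (join_ray \<sigma>))"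
  unfolding root_connected_def torus_orbits_eq[OF fan]
proof (intro conjI bexI)
  note in_\<Sigma> = orthogonal_cones_subset[OF \<sigma>] join_ray_in[OF \<sigma>]
  show "cone_orbit \<Sigma> \<sigma> \<in> cone_orbit \<Sigma> ` \<Sigma>" "cone_orbit \<Sigma> (join_ray \<sigma>) \<in> cone_orbit \<Sigma> ` \<Sigma>"
    using in_\<Sigma> by blast+
  have ne: "\<sigma> \<noteq> join_ray \<sigma>"
    using \<sigma> join_ray_not_orthogonal by metis
  then show "(cone_orbit \<Sigma> \<sigma> :: ('k, 'n) toric_point set) \<noteq> cone_orbit \<Sigma> (join_ray \<sigma>)"
    using cone_orbit_disjoint[OF fan in_\<Sigma>] cone_orbit_nonempty[of \<Sigma> \<sigma>] by blast
  show "(cone_orbit \<Sigma> (join_ray \<sigma>) :: ('k, 'n) toric_point set) \<subseteq> (zariski \<Sigma>) closure_of (cone_orbit \<Sigma> \<sigma>)"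
    by (rule join_ray_orbit_in_closure[OF \<sigma>])
  let ?P = "toric_pt \<Sigma> \<sigma> (\<lambda>_. 1 :: 'k)"
  show "orbit additive_group (root_action \<Sigma> e) ?P \<subseteq> cone_orbit \<Sigma> \<sigma> \<union> cone_orbit \<Sigma> (join_ray \<sigma>)"
    unfolding root_orbit_eq using root_action_in_paired_orbits[OF \<sigma> _ torus_one, of \<sigma>] by blast
  obtain s where s: "root_action \<Sigma> e s ?P \<in> cone_orbit \<Sigma> (join_ray \<sigma>)"
    using root_orbit_meets_both(2)[OF \<sigma> _ torus_one] by blast
  have P: "?P \<in> cone_orbit \<Sigma> \<sigma>"
    unfolding cone_orbit_def using torus_one by blast
  have "root_action \<Sigma> e s ?P \<noteq> ?P"
    using s P ne cone_orbit_disjoint[OF fan in_\<Sigma>] by metis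
  moreover have "?P \<in> toric_variety \<Sigma>"
    unfolding toric_variety_eq[OF fan] using in_\<Sigma>(1) torus_one by blast
  ultimately show "?P \<in> toric_variety \<Sigma> - root_fixed_points \<Sigma> e"
    unfolding root_fixed_points_def by blast
qed

lemma cone_orbit_subset_Un:
  assumes \<sigma>: "\<sigma> \<in> \<Sigma>" "\<sigma>1 \<in> \<Sigma>" "\<sigma>2 \<in> \<Sigma>"
    and "P \<in> (cone_orbit \<Sigma> \<sigma> :: ('k::{alg_closed_field, field_char_0}, 'n) toric_point set)"
    and "P \<in> cone_orbit \<Sigma> \<sigma>1 \<union> cone_orbit \<Sigma> \<sigma>2"
  shows "\<sigma> = \<sigma>1 \<or> \<sigma> = \<sigma>2"
  using assms cone_orbit_disjoint[OF fan] by blast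

lemma root_connected_imp_paired:
  assumes \<sigma>: "\<sigma>1 \<in> \<Sigma>" "\<sigma>2 \<in> \<Sigma>"
    and con: "root_connected \<Sigma> e
      (cone_orbit \<Sigma> \<sigma>1 :: ('k::{alg_closed_field, field_char_0}, 'n) toric_point set) (cone_orbit \<Sigma> \<sigma>2)"
  shows "\<exists>\<sigma>\<in>orthogonal_cones. {\<sigma>1, \<sigma>2} = {\<sigma>, join_ray \<sigma>}"
proof -
  obtain P :: "('k, 'n) toric_point" where P: "P \<in> toric_variety \<Sigma>" "P \<notin> root_fixed_points \<Sigma> e"
    and sub: "\<And>s. root_action \<Sigma> e s P \<in> cone_orbit \<Sigma> \<sigma>1 \<union> cone_orbit \<Sigma> \<sigma>2"
    using con unfolding root_connected_def root_orbit_eq by blast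
  obtain \<tau> t where \<tau>: "\<tau> \<in> \<Sigma>" and t: "t \<in> carrier torus" and P_eq: "P = toric_pt \<Sigma> \<tau> t"
    using P(1) unfolding toric_variety_eq[OF fan] by blast
  have "\<tau> \<in> orthogonal_cones \<or> \<tau> \<in> join_ray ` orthogonal_cones"
    using P root_action_unpaired[OF \<tau> _ _ t] unfolding root_fixed_points_def P_eq by blast
  then obtain \<sigma> where \<sigma>0: "\<sigma> \<in> orthogonal_cones" "\<tau> = \<sigma> \<or> \<tau> = join_ray \<sigma>"
    by blast
  have "\<sigma> = \<sigma>1 \<or> \<sigma> = \<sigma>2"
    using root_orbit_meets_both(1)[OF \<sigma>0 t] sub cone_orbit_subset_Un[OF orthogonal_cones_subset[OF \<sigma>0(1)] \<sigma>]
    unfolding P_eq by blast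
  moreover have "join_ray \<sigma> = \<sigma>1 \<or> join_ray \<sigma> = \<sigma>2"
    using root_orbit_meets_both(2)[OF \<sigma>0 t] sub cone_orbit_subset_Un[OF join_ray_in[OF \<sigma>0(1)] \<sigma>]
    unfolding P_eq by blast
  moreover have "\<sigma> \<noteq> join_ray \<sigma>"
    using \<sigma>0(1) join_ray_not_orthogonal by metis
  ultimately have "{\<sigma>1, \<sigma>2} = {\<sigma>, join_ray \<sigma>}"
    by auto
  then show ?thesis
    using \<sigma>0(1) by blast
qed

lemma cone_orbit_Un_eq:
  assumes \<sigma>: "\<sigma>1 \<in> \<Sigma>" "\<sigma>2 \<in> \<Sigma>" "\<sigma>3 \<in> \<Sigma>" "\<sigma>4 \<in> \<Sigma>"
    and eq: "(cone_orbit \<Sigma> \<sigma>1 \<union> cone_orbit \<Sigma> \<sigma>2 :: ('k::{alg_closed_field, field_char_0}, 'n) toric_point set) =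
      cone_orbit \<Sigma> \<sigma>3 \<union> cone_orbit \<Sigma> \<sigma>4"
  shows "{\<sigma>1, \<sigma>2} = {\<sigma>3, \<sigma>4}"
proof -
  have mem: "\<sigma> = \<sigma>' \<or> \<sigma> = \<sigma>''"
    if "\<sigma> \<in> \<Sigma>" "\<sigma>' \<in> \<Sigma>" "\<sigma>'' \<in> \<Sigma>"
      "(cone_orbit \<Sigma> \<sigma> :: ('k, 'n) toric_point set) \<subseteq> cone_orbit \<Sigma> \<sigma>' \<union> cone_orbit \<Sigma> \<sigma>''"
    for \<sigma> \<sigma>' \<sigma>''
    using cone_orbit_subset_Un[OF that(1-3)] that(4) cone_orbit_nonempty[of \<Sigma> \<sigma>] by blast
  have "\<sigma>1 = \<sigma>3 \<or> \<sigma>1 = \<sigma>4" "\<sigma>2 = \<sigma>3 \<or> \<sigma>2 = \<sigma>4"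
    using mem \<sigma> eq by blast+
  moreover have "\<sigma>3 = \<sigma>1 \<or> \<sigma>3 = \<sigma>2" "\<sigma>4 = \<sigma>1 \<or> \<sigma>4 = \<sigma>2"
    using mem \<sigma> eq by blast+
  ultimately show ?thesis by auto
qed

end

theorem proposition7:
  fixes \<Sigma> :: "(rat ^ 'n::finite) set set" and e :: "int ^ 'n"
    and torb gorb :: "('k::{alg_closed_field, field_char_0}, 'n) toric_point set set"
  assumes "fan \<Sigma>" and "demazure_root \<Sigma> e"
    and "torb = torus_orbits \<Sigma>" and "gorb = embedding_orbits \<Sigma> e"
  shows "(\<forall>Y\<in>gorb.
            ((\<exists>O1\<in>torb. \<exists>O2\<in>torb. O1 \<noteq> O2 \<and> Y = O1 \<union> O2) \<or> Y \<in> torb) \<and>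
            \<not> ((\<exists>O1\<in>torb. \<exists>O2\<in>torb. O1 \<noteq> O2 \<and> Y = O1 \<union> O2) \<and> Y \<in> torb)) \<and>
         (\<forall>O1\<in>torb. \<forall>O2\<in>torb. O1 \<noteq> O2 \<longrightarrow>
            (O1 \<union> O2 \<in> gorb \<longleftrightarrow> root_connected \<Sigma> e O1 O2 \<or> root_connected \<Sigma> e O2 O1)) \<and>
         finite gorb"
proof -
  obtain \<rho> where "demazure_root_at \<Sigma> \<rho> e"
    using assms(2) unfolding demazure_root_def by blast
  then interpret rooted_fan \<Sigma> \<rho> e "ray_vec \<rho>"
    using assms(1) by unfold_locales auto
  let ?O = "cone_orbit \<Sigma> :: _ \<Rightarrow> ('k, 'n) toric_point set"
  have torb: "torb = ?O ` \<Sigma>"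
    using assms(3) torus_orbits_eq[OF fan] by simp
  have gorb: "gorb = (\<lambda>\<sigma>. ?O \<sigma> \<union> ?O (join_ray \<sigma>)) ` orthogonal_cones \<union>
      ?O ` (\<Sigma> - orthogonal_cones - join_ray ` orthogonal_cones)"
    using assms(4) embedding_orbits_eq by simp
  have ne: "?O \<sigma> \<noteq> ?O (join_ray \<sigma>)" if "\<sigma> \<in> orthogonal_cones" for \<sigma>
    using root_connected_join_ray[OF that] unfolding root_connected_def by blast
  have pair_or_single: "(\<exists>O1\<in>torb. \<exists>O2\<in>torb. O1 \<noteq> O2 \<and> Y = O1 \<union> O2) \<or> Y \<in> torb" if Y: "Y \<in> gorb" for Y
  proof -
    consider \<sigma> where "\<sigma> \<in> orthogonal_cones" "Y = ?O \<sigma> \<union> ?O (join_ray \<sigma>)" | \<sigma> where "\<sigma> \<in> \<Sigma>" "Y = ?O \<sigma>"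
      using Y unfolding gorb by blast
    then show ?thesis
    proof cases
      case 1
      then have "?O \<sigma> \<in> torb" "?O (join_ray \<sigma>) \<in> torb"
        unfolding torb using orthogonal_cones_subset join_ray_in by blast+
      then show ?thesis
        using 1 ne by blast
    next
      case 2
      then show ?thesis
        unfolding torb by blast
    qed
  qed
  have not_both: "O1 \<union> O2 \<notin> torb" if "O1 \<in> torb" "O2 \<in> torb" "O1 \<noteq> O2" for O1 O2
  proof
    assume "O1 \<union> O2 \<in> torb"
    then obtain \<sigma>1 \<sigma>2 \<sigma> where \<sigma>: "\<sigma>1 \<in> \<Sigma>" "\<sigma>2 \<in> \<Sigma>" "\<sigma> \<in> \<Sigma>"
      and O: "O1 = ?O \<sigma>1" "O2 = ?O \<sigma>2" "O1 \<union> O2 = ?O \<sigma>"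
      using \<open>O1 \<in> torb\<close> \<open>O2 \<in> torb\<close> unfolding torb by blast
    then have "{\<sigma>1, \<sigma>2} = {\<sigma>, \<sigma>}"
      by (intro cone_orbit_Un_eq[where 'k = 'k]) auto
    then show False
      using O \<open>O1 \<noteq> O2\<close> by auto
  qed
  have pair_iff: "O1 \<union> O2 \<in> gorb \<longleftrightarrow> root_connected \<Sigma> e O1 O2 \<or> root_connected \<Sigma> e O2 O1"
    if O: "O1 \<in> torb" "O2 \<in> torb" "O1 \<noteq> O2" for O1 O2
  proof -
    obtain \<sigma>1 \<sigma>2 where \<sigma>: "\<sigma>1 \<in> \<Sigma>" "\<sigma>2 \<in> \<Sigma>" and O_eq: "O1 = ?O \<sigma>1" "O2 = ?O \<sigma>2"
      using O unfolding torb by blast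
    show ?thesis
    proof
      assume "O1 \<union> O2 \<in> gorb"
      moreover have "O1 \<union> O2 \<notin> ?O ` (\<Sigma> - orthogonal_cones - join_ray ` orthogonal_cones)"
        using not_both[OF O] unfolding torb by blast
      ultimately obtain \<sigma> where \<sigma>0: "\<sigma> \<in> orthogonal_cones" "O1 \<union> O2 = ?O \<sigma> \<union> ?O (join_ray \<sigma>)"
        unfolding gorb by blast
      then have "{\<sigma>1, \<sigma>2} = {\<sigma>, join_ray \<sigma>}"
        using \<sigma> orthogonal_cones_subset join_ray_in unfolding O_eq
        by (intro cone_orbit_Un_eq[where 'k = 'k]) auto
      then show "root_connected \<Sigma> e O1 O2 \<or> root_connected \<Sigma> e O2 O1"
        using root_connected_join_ray[OF \<sigma>0(1), where 'k = 'k] unfolding O_eq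
        by (auto simp: doubleton_eq_iff)
    next
      assume "root_connected \<Sigma> e O1 O2 \<or> root_connected \<Sigma> e O2 O1"
      then obtain \<sigma> where "\<sigma> \<in> orthogonal_cones" "{\<sigma>1, \<sigma>2} = {\<sigma>, join_ray \<sigma>}"
        using root_connected_imp_paired[OF \<sigma>, where 'k = 'k]
          root_connected_imp_paired[OF \<sigma>(2,1), where 'k = 'k]
        unfolding O_eq by (metis insert_commute)
      then show "O1 \<union> O2 \<in> gorb"
        unfolding gorb O_eq by (auto simp: doubleton_eq_iff Un_commute)
    qed
  qed
  have finite: "finite gorb"
  proof -
    have "orthogonal_cones \<subseteq> \<Sigma>"
      using orthogonal_cones_subset by blast
    then show ?thesis
      unfolding gorb using fan_finite[OF fan] finite_subset by blast
  qed
  show ?thesis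
  proof (intro conjI ballI impI)
    fix Y assume "Y \<in> gorb"
    then show "(\<exists>O1\<in>torb. \<exists>O2\<in>torb. O1 \<noteq> O2 \<and> Y = O1 \<union> O2) \<or> Y \<in> torb"
      by (rule pair_or_single)
    show "\<not> ((\<exists>O1\<in>torb. \<exists>O2\<in>torb. O1 \<noteq> O2 \<and> Y = O1 \<union> O2) \<and> Y \<in> torb)"
      using not_both by blast
  qed (fact pair_iff finite)+
qed

end
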